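(* Let $n\ge 2$, let $\Omega\subset\mathbb{R}^n$ be a bounded domain, let $h\colon\mathbb{R}\to\mathbb{R}$ be continuous and nondecreasing, and let $f(t)=\int_0^t h(s)\,ds$. Suppose that $u\in W^{1,n}_{loc}(\Omega;\mathbb{R}^n)$ is a weak solution of $$\operatorname{div}\big(h(\det Du)\operatorname{cof} Du\big)=0\quad\text{in }\Omega$$ such that $h(\det Du)$ is constant a.e. on $\Omega$. Then for all subdomains $G\subset\subset\Omega$, the inequality $$\int_G f(\det Du(x))\,dx\le\int_G f(\det Dv(x))\,dx$$ holds for all $v\in W^{1,n}(G;\mathbb{R}^n)$ satisfying $v-u\in W^{1,n}_0(G;\mathbb{R}^n)$.
   Context: $\mathbb{M}^{n\times n}$ is the space of real $n\times n$ matrices with inner product $A:B=\sum_{i,j}A^i_jB^i_j$; $\operatorname{cof}A$ is the cofactor matrix, so that $A^T\operatorname{cof}A=(\operatorname{cof}A)A^T=(\det A)I$. $Du$ is the Jacobian matrix, $(Du)^i_j=\partial u^i/\partial x_j$. A function $u\in W^{1,1}_{loc}(\Omega;\mathbb{R}^n)$ is a weak solution of $\operatorname{div}(h(\det Du)\operatorname{cof}Du)=0$ in $\Omega$ if $h(\det Du)\operatorname{cof}Du\in L^1_{loc}(\Omega;\mathbb{M}^{n\times n})$ and $\int_\Omega h(\det Du)\operatorname{cof}Du:D\zeta\,dx=0$ for all $\zeta\in C^1_c(\Omega;\mathbb{R}^n)$. *)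

theory Defs
  imports "HOL-Analysis.Analysis"
begin

definition is_domain :: "(real^'n) set \<Rightarrow> bool" where
  "is_domain S \<longleftrightarrow> open S \<and> connected S \<and> S \<noteq> {}"

definition compactly_contained :: "(real^'n) set \<Rightarrow> (real^'n) set \<Rightarrow> bool" where
  "compactly_contained G S \<longleftrightarrow> compact (closure G) \<and> closure G \<subseteq> S"

(* The (i,j) cofactor: the determinant of A with row i and column j cleared and a 1 put in the
   crossing position. On a linearly ordered index type this is (-1)^(i+j) times the (i,j) minor.
   The two lemmas below give the identities that fix the index convention. *)
definition cof :: "real^'n^'n \<Rightarrow> real^'n^'n" where
  "cof A = (\<chi> i j. det (\<chi> k l. if k = i \<and> l = j then 1
                              else if k = i \<or> l = j then 0 else A $ k $ l))"

lemma cof_eq_det_row: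
  fixes A :: "real^'n^'n"
  shows "cof A $ i $ j = det (\<chi> k. if k = i then axis j 1 else A $ k)"
proof -
  have "(\<Prod>k\<in>UNIV. if k = i \<and> p k = j then 1 else if k = i \<or> p k = j then 0 else A $ k $ p k)
      = (\<Prod>k\<in>UNIV. (if k = i then axis j 1 else A $ k) $ p k)"
    if "p permutes UNIV" for p
  proof (cases "p i = j")
    case True
    show ?thesis
      using True permutes_inj[OF that] by (intro prod.cong) (auto simp: axis_def inj_eq)
  next
    case False
    have L: "\<exists>k\<in>UNIV. (if k = i \<and> p k = j then 1
            else if k = i \<or> p k = j then 0 else A $ k $ p k) = 0"
      using False by (intro bexI[of _ i]) auto
    have R: "\<exists>k\<in>UNIV. (if k = i then axis j 1 else A $ k) $ p k = (0::real)"
      using False by (intro bexI[of _ i]) (auto simp: axis_def)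
    show ?thesis
      by (simp only: prod_zero[OF finite L] prod_zero[OF finite R])
  qed
  then show ?thesis
    unfolding cof_def det_def vec_lambda_beta by (intro sum.cong) auto
qed

lemma cof_transpose: "cof (transpose A) = transpose (cof A)"
proof -
  have "det (\<chi> k l. if k = i \<and> l = j then 1 else if k = i \<or> l = j then 0 else transpose A $ k $ l)
      = det (\<chi> k l. if k = j \<and> l = i then 1 else if k = j \<or> l = i then 0 else A $ k $ l)" for i j
    by (subst det_transpose[symmetric], rule arg_cong[where f = det])
       (auto simp: transpose_def vec_eq_iff)
  then have "cof (transpose A) $ i $ j = transpose (cof A) $ i $ j" for i j
    unfolding cof_def transpose_def[of "vec_lambda _"] vec_lambda_beta .
  then show ?thesis by (simp only: vec_eq_iff) simp
qed

lemma cof_mult_transpose: "cof A ** transpose A = det A *\<^sub>R mat 1"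
proof -
  have "(\<Sum>j\<in>UNIV. cof A $ i $ j * A $ m $ j) = (if i = m then det A else 0)" for i m
  proof -
    have "(\<Sum>j\<in>UNIV. cof A $ i $ j * A $ m $ j)
        = (\<Sum>j\<in>UNIV. det (\<chi> k. if k = i then A $ m $ j *s axis j 1 else A $ k))"
      by (simp add: cof_eq_det_row det_row_mul mult.commute)
    also have "\<dots> = det (\<chi> k. if k = i then (\<Sum>j\<in>UNIV. A $ m $ j *s axis j 1) else A $ k)"
      by (simp add: det_linear_row_sum)
    also have "\<dots> = det (\<chi> k. if k = i then A $ m else A $ k)"
      by (simp only: basis_expansion)
    also have "\<dots> = (if i = m then det A else 0)"
    proof (cases "i = m")
      case True
      then have "(\<chi> k. if k = i then A $ m else A $ k) = A" by (auto simp: vec_eq_iff)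
      with True show ?thesis by simp
    next
      case False
      then show ?thesis by (auto intro!: det_identical_rows[of i m] simp: row_def vec_eq_iff)
    qed
    finally show ?thesis .
  qed
  then show ?thesis
    by (simp add: matrix_matrix_mult_def transpose_def vec_eq_iff mat_def)
qed

lemma transpose_mult_cof: "transpose A ** cof A = det A *\<^sub>R mat 1"
proof -
  have "transpose (cof (transpose A) ** A) = det A *\<^sub>R mat 1"
    using cof_mult_transpose[of "transpose A"]
    by (simp add: transpose_transpose det_transpose transpose_scalar transpose_mat)
  then show ?thesis by (simp add: matrix_transpose_mul cof_transpose transpose_transpose)
qed

(* C^1 functions on the whole space with compact support in S, i.e. elements of C^1_c(S)
   extended by zero. *)
definition C1_c :: "(real^'n) set \<Rightarrow> (real^'n \<Rightarrow> 'b::euclidean_space) set" where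
  "C1_c S = {\<phi>. (\<forall>x. \<phi> differentiable (at x)) \<and>
                (\<forall>w. continuous_on UNIV (\<lambda>x. frechet_derivative \<phi> (at x) w)) \<and>
                compact (closure {x. \<phi> x \<noteq> 0}) \<and> closure {x. \<phi> x \<noteq> 0} \<subseteq> S}"

(* L^p(S) for integer p \<ge> 1. The norm on matrices real^'n^'m is the Frobenius norm. *)
definition Lp :: "nat \<Rightarrow> (real^'n) set \<Rightarrow> (real^'n \<Rightarrow> 'b::euclidean_space) set" where
  "Lp p S = {f. f \<in> borel_measurable (lebesgue_on S) \<and>
               integrable (lebesgue_on S) (\<lambda>x. norm (f x) ^ p)}"

definition Lp_loc :: "nat \<Rightarrow> (real^'n) set \<Rightarrow> (real^'n \<Rightarrow> 'b::euclidean_space) set" where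
  "Lp_loc p S = {f. \<forall>K. compact K \<and> K \<subseteq> S \<longrightarrow> f \<in> Lp p K}"

(* First-order weak derivatives are tested against C^1_c(S), and W^{1,p}_0(S) is the closure of
   C^1_c(S) in W^{1,p}(S), as in Gilbarg and Trudinger, Chapter 7. *)
definition has_weak_jacobian ::
    "(real^'n) set \<Rightarrow> (real^'n \<Rightarrow> real^'m) \<Rightarrow> (real^'n \<Rightarrow> real^'n^'m) \<Rightarrow> bool" where
  "has_weak_jacobian S u U \<longleftrightarrow> u \<in> Lp_loc 1 S \<and> U \<in> Lp_loc 1 S \<and>
     (\<forall>\<phi>::real^'n \<Rightarrow> real. \<phi> \<in> C1_c S \<longrightarrow> (\<forall>i j.
        (LINT x|lebesgue_on S. u x $ i * frechet_derivative \<phi> (at x) (axis j 1))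
          = - (LINT x|lebesgue_on S. U x $ i $ j * \<phi> x)))"

(* Du on S: a representative of the weak Jacobian, which is unique up to null sets. *)
definition weak_jacobian ::
    "(real^'n) set \<Rightarrow> (real^'n \<Rightarrow> real^'m) \<Rightarrow> real^'n \<Rightarrow> real^'n^'m" where
  "weak_jacobian S u = (SOME U. has_weak_jacobian S u U)"

definition weakly_differentiable :: "(real^'n) set \<Rightarrow> (real^'n \<Rightarrow> real^'m) \<Rightarrow> bool" where
  "weakly_differentiable S u \<longleftrightarrow> (\<exists>U. has_weak_jacobian S u U)"

definition W1 :: "nat \<Rightarrow> (real^'n) set \<Rightarrow> (real^'n \<Rightarrow> real^'m) set" where
  "W1 p S = {u. weakly_differentiable S u \<and> u \<in> Lp p S \<and> weak_jacobian S u \<in> Lp p S}"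

definition W1_loc :: "nat \<Rightarrow> (real^'n) set \<Rightarrow> (real^'n \<Rightarrow> real^'m) set" where
  "W1_loc p S = {u. weakly_differentiable S u \<and> u \<in> Lp_loc p S \<and> weak_jacobian S u \<in> Lp_loc p S}"

definition W1_norm :: "nat \<Rightarrow> (real^'n) set \<Rightarrow> (real^'n \<Rightarrow> real^'m) \<Rightarrow> real" where
  "W1_norm p S u = root p ((LINT x|lebesgue_on S. norm (u x) ^ p)
                         + (LINT x|lebesgue_on S. norm (weak_jacobian S u x) ^ p))"

definition W1_0 :: "nat \<Rightarrow> (real^'n) set \<Rightarrow> (real^'n \<Rightarrow> real^'m) set" where
  "W1_0 p S = {u \<in> W1 p S. \<exists>\<phi>::nat \<Rightarrow> real^'n \<Rightarrow> real^'m.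
      (\<forall>k. \<phi> k \<in> C1_c S) \<and> (\<lambda>k. W1_norm p S (\<lambda>x. \<phi> k x - u x)) \<longlonglongrightarrow> 0}"

(* The inner product of real^'n^'n is A : B, the sum of all A $ i $ j * B $ i $ j. *)
definition weak_solution ::
    "(real \<Rightarrow> real) \<Rightarrow> (real^'n) set \<Rightarrow> (real^'n \<Rightarrow> real^'n) \<Rightarrow> bool" where
  "weak_solution h S u \<longleftrightarrow> u \<in> W1_loc 1 S \<and>
     (\<lambda>x. h (det (weak_jacobian S u x)) *\<^sub>R cof (weak_jacobian S u x)) \<in> Lp_loc 1 S \<and>
     (\<forall>\<zeta>::real^'n \<Rightarrow> real^'n. \<zeta> \<in> C1_c S \<longrightarrow>
        (LINT x|lebesgue_on S.
           (h (det (weak_jacobian S u x)) *\<^sub>R cof (weak_jacobian S u x)) \<bullet> jacobian \<zeta> (at x)) = 0)"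

(* The Lebesgue integral with values in [-\<infinity>,\<infinity>]; the Bochner integral would return 0 for a function
   with integral \<infinity>. If both parts have infinite integral, the value is left unspecified, so that
   nothing about it can be proved. *)
definition ext_integral :: "(real^'n) set \<Rightarrow> (real^'n \<Rightarrow> real) \<Rightarrow> ereal" where
  "ext_integral S g =
     (let P = \<integral>\<^sup>+ x. ennreal (g x) \<partial>lebesgue_on S;
          N = \<integral>\<^sup>+ x. ennreal (- g x) \<partial>lebesgue_on S
      in if P = \<infinity> \<and> N = \<infinity> then undefined else enn2ereal P - enn2ereal N)"

end

theory Submission
  imports Defs
begin

text \<open>
  Since \<open>h\<close> is nondecreasing, \<open>f\<close> is convex and \<open>f t \<ge> f s + h s * (t - s)\<close> for all \<open>s\<close> and \<open>t\<close>. With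
  \<open>s = det Du\<close> and \<open>t = det Dv\<close> the slope \<open>h (det Du)\<close> is almost everywhere a constant \<open>c\<close>, and integration
  over \<open>G\<close> gives \<open>\<integral> f (det Dv) \<ge> \<integral> f (det Du) + c * (\<integral> det Dv - \<integral> det Du)\<close>. The determinant is a null
  Lagrangian, so its integral depends only on the boundary values and the last bracket vanishes. This is
  \<open>integral_det_eq_if_W1_0\<close>, to which most of the text leads. Both energies make sense as extended
  reals because \<open>f\<close> lies above its tangent at \<open>0\<close>.

  The null Lagrangian property for Sobolev functions comes from the smooth case by approximation. For a
  compactly supported map with symmetric continuous second derivatives the integral of the Jacobian
  determinant is zero: integrate by parts in one component and pair each permutation in the Leibniz formula
  with its composition with a transposition (\<open>integral_det_smooth_eq_0\<close>). Convolution with an explicit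
  kernel of class \<open>C\<^sup>2\<close> produces such maps. It commutes with weak derivatives
  (\<open>mollified_weak_jacobian\<close>) and converges in \<open>L\<^sup>n\<close> (\<open>conv_mollifier_tendsto_Lp\<close>). Because
  the determinant is homogeneous of degree \<open>n\<close>, convergence of Jacobians in \<open>L\<^sup>n\<close> is enough for convergence
  of the integrals of their determinants (\<open>det_diff_le\<close>). First this shows that adding a test
  function leaves the integral unchanged (\<open>integral_det_add_C1_c\<close>), then the limit in the definition of
  \<open>W\<^sup>1\<^sub>0\<close> is taken. The weak Jacobian being fixed only by a choice, the limit also needs uniqueness of weak
  derivatives, which mollification provides as well (\<open>AE_eq_0_if_orthogonal_to_C1_c\<close>).
\<close>

section \<open>Convolution with a smooth kernel\<close>

definition conv :: "('a::euclidean_space \<Rightarrow> real) \<Rightarrow> ('a \<Rightarrow> 'b::euclidean_space) \<Rightarrow> 'a \<Rightarrow> 'b" where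
  "conv k g x = (LINT y|lborel. k (x - y) *\<^sub>R g y)"

lemma continuous_compact_support_bounded:
  fixes k :: "'a::euclidean_space \<Rightarrow> 'b::euclidean_space"
  assumes k: "continuous_on UNIV k" and supp: "\<And>z. R < norm z \<Longrightarrow> k z = 0"
  obtains B where "0 \<le> B" "\<And>z. norm (k z) \<le> B"
proof -
  have "compact (k ` cball 0 R)"
    using k by (intro compact_continuous_image) (auto intro: continuous_on_subset)
  then obtain B where B: "\<And>z. z \<in> cball 0 R \<Longrightarrow> norm (k z) \<le> B"
    by (meson bounded_iff compact_imp_bounded imageI)
  show ?thesis
  proof (rule that[of "max 0 B"])
    show "norm (k z) \<le> max 0 B" for z
      using B[of z] supp[of z] by (cases "norm z \<le> R") auto
  qed auto
qed

lemma continuous_compact_support_uniformly_continuous: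
  fixes k :: "'a::euclidean_space \<Rightarrow> 'b::euclidean_space"
  assumes k: "continuous_on UNIV k" and supp: "\<And>z. R < norm z \<Longrightarrow> k z = 0" and "0 < e"
  obtains d where "0 < d" "\<And>z w. dist z w < d \<Longrightarrow> dist (k z) (k w) < e"
proof -
  have "uniformly_continuous_on (cball 0 (R + 1)) k"
    using k by (intro compact_uniformly_continuous) (auto intro: continuous_on_subset)
  then obtain d where "0 < d"
    and d: "\<And>z w. \<lbrakk>z \<in> cball 0 (R + 1); w \<in> cball 0 (R + 1); dist w z < d\<rbrakk> \<Longrightarrow> dist (k w) (k z) < e"
    using \<open>0 < e\<close> unfolding uniformly_continuous_on_def by metis
  show ?thesis
  proof (rule that[of "min d 1"])
    show "dist (k z) (k w) < e" if zw: "dist z w < min d 1" for z w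
    proof (cases "z \<in> cball 0 (R + 1) \<and> w \<in> cball 0 (R + 1)")
      case True
      then show ?thesis using d[of w z] zw by auto
    next
      case False
      have "\<bar>norm z - norm w\<bar> < 1"
        using zw norm_triangle_ineq3[of z w] by (simp add: dist_norm)
      with False have "R < norm z" "R < norm w" by auto
      then show ?thesis using supp \<open>0 < e\<close> by simp
    qed
  qed (use \<open>0 < d\<close> in auto)
qed

lemma integrable_continuous_compact_support:
  fixes k :: "'a::euclidean_space \<Rightarrow> 'b::euclidean_space"
  assumes k: "continuous_on UNIV k" and supp: "\<And>z. R < norm z \<Longrightarrow> k z = 0"
  shows "integrable lborel k"
proof -
  have "integrable lborel (\<lambda>x. indicator (cball 0 R) x *\<^sub>R k x)"
    using k by (intro borel_integrable_compact) (auto intro: continuous_on_subset)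
  moreover have "(\<lambda>x. indicator (cball 0 R) x *\<^sub>R k x) = k"
    using supp by (auto simp: indicator_def fun_eq_iff)
  ultimately show ?thesis by simp
qed

lemma integrable_conv:
  fixes g :: "'a::euclidean_space \<Rightarrow> 'b::euclidean_space"
  assumes k: "continuous_on UNIV k" and supp: "\<And>z. R < norm z \<Longrightarrow> k z = (0::real)"
    and g: "integrable lborel g"
  shows "integrable lborel (\<lambda>y. k (x - y) *\<^sub>R g y)"
proof -
  obtain B where "0 \<le> B" and B: "\<And>z. norm (k z) \<le> B"
    using continuous_compact_support_bounded[OF k supp] by blast
  have k': "(\<lambda>y. k (x - y)) \<in> borel_measurable borel"
    by (intro borel_measurable_continuous_onI continuous_on_compose2[OF k] continuous_intros) auto
  show ?thesis
  proof (rule Bochner_Integration.integrable_bound)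
    show "integrable lborel (\<lambda>y. B *\<^sub>R norm (g y))" using g by auto
    show "(\<lambda>y. k (x - y) *\<^sub>R g y) \<in> borel_measurable lborel"
      using k' g by (auto intro!: borel_measurable_scaleR)
    show "AE y in lborel. norm (k (x - y) *\<^sub>R g y) \<le> norm (B *\<^sub>R norm (g y))"
      using B \<open>0 \<le> B\<close> by (auto intro!: mult_right_mono)
  qed
qed

text \<open>The kernel is uniformly continuous, so a small shift changes \<open>conv k g\<close> by at most a small
multiple of the \<open>L\<^sup>1\<close> norm of \<open>g\<close>. The argument for the derivative below is the same, one order higher.\<close>
lemma continuous_on_conv:
  fixes g :: "'a::euclidean_space \<Rightarrow> 'b::euclidean_space"
  assumes k: "continuous_on UNIV k" and supp: "\<And>z. R < norm z \<Longrightarrow> k z = (0::real)"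
    and g: "integrable lborel g"
  shows "continuous_on UNIV (conv k g)"
  unfolding continuous_on_iff
proof (intro ballI allI impI)
  fix x :: 'a and e :: real assume "0 < e"
  define N where "N = (LINT y|lborel. norm (g y))"
  have N: "0 \<le> N" unfolding N_def by simp
  define e' where "e' = e / (N + 1)"
  have "0 < e'" "e' * N < e" using N \<open>0 < e\<close> by (auto simp: e'_def field_simps)
  obtain d where "0 < d" and d: "\<And>z w. dist z w < d \<Longrightarrow> dist (k z) (k w) < e'"
    using continuous_compact_support_uniformly_continuous[OF k supp \<open>0 < e'\<close>] by blast
  have "dist (conv k g x') (conv k g x) < e" if "dist x' x < d" for x'
  proof -
    have "conv k g x' - conv k g x = (LINT y|lborel. (k (x' - y) - k (x - y)) *\<^sub>R g y)"
      unfolding conv_def scaleR_diff_left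
      by (intro Bochner_Integration.integral_diff[symmetric] integrable_conv[OF k supp g])
    also have "norm \<dots> \<le> (LINT y|lborel. e' * norm (g y))"
    proof (rule Bochner_Integration.integral_norm_bound_integral)
      show "integrable lborel (\<lambda>y. (k (x' - y) - k (x - y)) *\<^sub>R g y)"
        unfolding scaleR_diff_left
        by (intro Bochner_Integration.integrable_diff integrable_conv[OF k supp g])
      show "integrable lborel (\<lambda>y. e' * norm (g y))" using g by auto
      fix y
      have "dist (k (x' - y)) (k (x - y)) < e'" using that by (intro d) (simp add: dist_norm)
      then show "norm ((k (x' - y) - k (x - y)) *\<^sub>R g y) \<le> e' * norm (g y)"
        by (simp add: dist_real_def mult_right_mono)
    qed
    also have "\<dots> = e' * N" by (simp add: N_def)
    finally show ?thesis using \<open>e' * N < e\<close> by (simp add: dist_norm)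
  qed
  then show "\<exists>d>0. \<forall>x'\<in>UNIV. dist x' x < d \<longrightarrow> dist (conv k g x') (conv k g x) < e"
    using \<open>0 < d\<close> by blast
qed

text \<open>All derivatives fall on the kernel: the first-order Taylor remainder of \<open>k\<close> is uniformly
\<open>o(|h|)\<close>, because the gradient \<open>G\<close> is uniformly continuous, and it is integrated against \<open>|g|\<close>.
The derivative is again a convolution, so the lemma can be applied to it in turn.\<close>
lemma has_derivative_conv:
  fixes g :: "'a::euclidean_space \<Rightarrow> 'b::euclidean_space"
  assumes der: "\<And>z. (k has_derivative (\<lambda>h. G z \<bullet> h)) (at z)"
    and G: "continuous_on UNIV G"
    and supp: "\<And>z. R < norm z \<Longrightarrow> k z = (0::real)" "\<And>z. R < norm z \<Longrightarrow> G z = 0"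
    and g: "integrable lborel g"
  shows "(conv k g has_derivative (\<lambda>h. conv (\<lambda>z. G z \<bullet> h) g x)) (at x)"
proof -
  have k: "continuous_on UNIV k"
    by (intro continuous_at_imp_continuous_on ballI has_derivative_continuous[OF der])
  have Gh: "continuous_on UNIV (\<lambda>z. G z \<bullet> h)" "\<And>z. R < norm z \<Longrightarrow> G z \<bullet> h = 0" for h
    using G supp by (auto intro!: continuous_intros)
  have intG: "integrable lborel (\<lambda>y. (G (x - y) \<bullet> h) *\<^sub>R g y)" for h
    using integrable_conv[OF Gh g] .
  define N where "N = (LINT y|lborel. norm (g y))"
  have N: "0 \<le> N" unfolding N_def by simp
  have "linear (\<lambda>h. conv (\<lambda>z. G z \<bullet> h) g x)"
  proof (rule linearI)
    show "conv (\<lambda>z. G z \<bullet> (a + b)) g x = conv (\<lambda>z. G z \<bullet> a) g x + conv (\<lambda>z. G z \<bullet> b) g x" for a b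
      unfolding conv_def inner_add_right scaleR_add_left
      by (intro Bochner_Integration.integral_add intG)
    show "conv (\<lambda>z. G z \<bullet> (c *\<^sub>R a)) g x = c *\<^sub>R conv (\<lambda>z. G z \<bullet> a) g x" for c a
      unfolding conv_def inner_scaleR_right scaleR_scaleR[symmetric]
      by (simp del: scaleR_scaleR)
  qed
  then have bl: "bounded_linear (\<lambda>h. conv (\<lambda>z. G z \<bullet> h) g x)"
    by (simp add: linear_conv_bounded_linear)
  show ?thesis
    unfolding has_derivative_at_alt
  proof (intro conjI bl allI impI)
    fix e :: real assume "0 < e"
    define e' where "e' = e / (N + 1)"
    have "0 < e'" "e' * N \<le> e" using N \<open>0 < e\<close> by (auto simp: e'_def field_simps)
    obtain d where "0 < d" and d: "\<And>z w. dist z w < d \<Longrightarrow> dist (G z) (G w) < e'"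
      using continuous_compact_support_uniformly_continuous[OF G supp(2) \<open>0 < e'\<close>] by blast
    have taylor: "\<bar>k (z + h) - k z - G z \<bullet> h\<bar> \<le> e' * norm h" if "norm h < d" for z h
    proof -
      have "norm ((k (z + h) - G z \<bullet> (z + h)) - (k z - G z \<bullet> z)) \<le> e' * norm ((z + h) - z)"
      proof (rule differentiable_bound[of "ball z d" _ "\<lambda>w h. G w \<bullet> h - G z \<bullet> h"])
        fix w assume w: "w \<in> ball z d"
        show "((\<lambda>w. k w - G z \<bullet> w) has_derivative (\<lambda>h. G w \<bullet> h - G z \<bullet> h)) (at w within ball z d)"
          by (rule has_derivative_at_withinI)
             (intro has_derivative_diff der has_derivative_inner_right has_derivative_ident)
        show "onorm (\<lambda>h. G w \<bullet> h - G z \<bullet> h) \<le> e'"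
        proof (rule onorm_le)
          fix h
          have "norm (G w \<bullet> h - G z \<bullet> h) \<le> norm (G w - G z) * norm h"
            by (simp add: inner_diff_left[symmetric] Cauchy_Schwarz_ineq2)
          also have "\<dots> \<le> e' * norm h"
            using d[of w z] w by (intro mult_right_mono) (auto simp: dist_norm norm_minus_commute)
          finally show "norm (G w \<bullet> h - G z \<bullet> h) \<le> e' * norm h" .
        qed
      qed (use that \<open>0 < d\<close> in \<open>auto simp: dist_norm\<close>)
      then show ?thesis by (simp add: inner_add_right algebra_simps)
    qed
    have "norm (conv k g y - conv k g x - conv (\<lambda>z. G z \<bullet> (y - x)) g x) \<le> e * norm (y - x)"
      if y: "norm (y - x) < d" for y
    proof -
      have "conv k g y - conv k g x - conv (\<lambda>z. G z \<bullet> (y - x)) g x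
          = (LINT t|lborel. (k (y - t) - k (x - t) - G (x - t) \<bullet> (y - x)) *\<^sub>R g t)"
        unfolding conv_def scaleR_diff_left
        using integrable_conv[OF k supp(1) g] intG by simp
      also have "norm \<dots> \<le> (LINT t|lborel. (e' * norm (y - x)) * norm (g t))"
      proof (rule Bochner_Integration.integral_norm_bound_integral)
        show "integrable lborel (\<lambda>t. (k (y - t) - k (x - t) - G (x - t) \<bullet> (y - x)) *\<^sub>R g t)"
          unfolding scaleR_diff_left
          by (intro Bochner_Integration.integrable_diff integrable_conv[OF k supp(1) g] intG)
        show "integrable lborel (\<lambda>t. (e' * norm (y - x)) * norm (g t))" using g by auto
        fix t
        have shift: "x - t + (y - x) = y - t" by simp
        show "norm ((k (y - t) - k (x - t) - G (x - t) \<bullet> (y - x)) *\<^sub>R g t)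
            \<le> (e' * norm (y - x)) * norm (g t)"
          unfolding norm_scaleR real_norm_def
          by (rule mult_right_mono[OF taylor[OF y, of "x - t", unfolded shift] norm_ge_zero])
      qed
      also have "\<dots> = (e' * N) * norm (y - x)" by (simp add: N_def)
      also have "\<dots> \<le> e * norm (y - x)" using \<open>e' * N \<le> e\<close> by (intro mult_right_mono) auto
      finally show ?thesis .
    qed
    then show "\<exists>d>0. \<forall>y. norm (y - x) < d \<longrightarrow>
        norm (conv k g y - conv k g x - conv (\<lambda>z. G z \<bullet> (y - x)) g x) \<le> e * norm (y - x)"
      using \<open>0 < d\<close> by blast
  qed
qed

lemma conv_eq_0:
  assumes "\<And>z. R < norm z \<Longrightarrow> k z = (0::real)" "\<And>y. r < norm y \<Longrightarrow> g y = 0" "R + r < norm x"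
  shows "conv k g x = 0"
proof -
  have "k (x - y) *\<^sub>R g y = 0" for y
  proof (cases "r < norm y")
    case False
    then have "R < norm (x - y)" using assms(3) norm_triangle_ineq[of "x - y" y] by simp
    then show ?thesis using assms(1) by simp
  qed (use assms(2) in simp)
  then show ?thesis unfolding conv_def by (simp only: Bochner_Integration.integral_zero)
qed

lemma lborel_distr_reflect: "distr lborel borel (\<lambda>y. x - y) = (lborel :: 'a::euclidean_space measure)"
  by (subst (2) lborel_affine[of "-1" x]) (auto simp: density_1)

lemma integral_reflect:
  fixes k :: "'a::euclidean_space \<Rightarrow> 'b::euclidean_space"
  assumes [measurable]: "k \<in> borel_measurable borel"
  shows "(LINT y|lborel. k (x - y)) = (LINT y|lborel. k y)"
  by (subst (2) lborel_distr_reflect[symmetric, of x]) (simp add: integral_distr)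

text \<open>Integrals over the whole space are invariant under translation of the integrand. Concretely,
the convolution of \<open>k\<close> with the indicator of a large ball is constant near the origin, so its
derivative there, which is the integral of the derivative of \<open>k\<close>, vanishes.\<close>
lemma integral_derivative_eq_0:
  fixes k :: "'a::euclidean_space \<Rightarrow> real"
  assumes der: "\<And>z. (k has_derivative (\<lambda>h. G z \<bullet> h)) (at z)"
    and G: "continuous_on UNIV G"
    and supp: "\<And>z. R < norm z \<Longrightarrow> k z = (0::real)" "\<And>z. R < norm z \<Longrightarrow> G z = 0"
  shows "(LINT y|lborel. G y \<bullet> h) = 0"
proof -
  let ?B = "cball (0::'a) (R + 1)"
  define g :: "'a \<Rightarrow> real" where "g = indicator ?B"
  have g: "integrable lborel g"
    unfolding g_def by (rule integrable_real_indicator[OF _ emeasure_bounded_finite[OF bounded_cball]]) simp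
  have const: "conv k g x = (LINT y|lborel. k y)" if "norm x < 1" for x
  proof -
    have "k (x - y) *\<^sub>R g y = k (x - y)" for y
    proof (cases "y \<in> ?B")
      case False
      then have "R < norm (x - y)"
        using norm_triangle_ineq2[of y x] that by (simp add: norm_minus_commute)
      then show ?thesis using supp(1) by simp
    qed (simp add: g_def)
    then have "conv k g x = (LINT y|lborel. k (x - y))"
      unfolding conv_def by presburger
    also have "\<dots> = (LINT y|lborel. k y)"
    proof (rule integral_reflect)
      have "continuous_on UNIV k"
        by (intro continuous_at_imp_continuous_on ballI has_derivative_continuous[OF der])
      then show "k \<in> borel_measurable borel" by (rule borel_measurable_continuous_onI)
    qed
    finally show ?thesis .
  qed
  have "((\<lambda>x. LINT y|lborel. k y) has_derivative (\<lambda>h. conv (\<lambda>z. G z \<bullet> h) g 0)) (at 0)"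
    by (rule has_derivative_transform_within_open[OF has_derivative_conv[OF der G supp g], where s="ball 0 1"])
       (auto simp: const)
  then have "(\<lambda>h. conv (\<lambda>z. G z \<bullet> h) g 0) = (\<lambda>h. 0)"
    by (intro has_derivative_unique) auto
  then have "0 = conv (\<lambda>z. G z \<bullet> h) g 0" by metis
  also have "\<dots> = (LINT y|lborel. G (0 - y) \<bullet> h)"
  proof -
    have "(G (0 - y) \<bullet> h) *\<^sub>R g y = G (0 - y) \<bullet> h" for y
    proof (cases "y \<in> ?B")
      case False
      then have "R < norm (- y)" by simp
      then show ?thesis using supp(2) by simp
    qed (simp add: g_def)
    then show ?thesis unfolding conv_def by presburger
  qed
  also have "\<dots> = (LINT y|lborel. G y \<bullet> h)"
    using G by (intro integral_reflect borel_measurable_continuous_onI continuous_intros)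
  finally show ?thesis by simp
qed

section \<open>An explicit mollifier of class \<open>C\<^sup>2\<close>\<close>

text \<open>The cube makes the bump twice continuously differentiable, with a Hessian that is visibly
symmetric. Two derivatives and their symmetry are all that the Piola identity asks of the kernel.\<close>
definition bump :: "real \<Rightarrow> 'a::euclidean_space \<Rightarrow> real" where
  "bump e z = max 0 (e\<^sup>2 - z \<bullet> z) ^ 3"

definition bump_grad :: "real \<Rightarrow> 'a::euclidean_space \<Rightarrow> 'a" where
  "bump_grad e z = (- 6 * max 0 (e\<^sup>2 - z \<bullet> z) ^ 2) *\<^sub>R z"

text \<open>The vector \<open>bump_hess e a z\<close> is the Hessian of \<open>bump e\<close> at \<open>z\<close> applied to \<open>a\<close>.\<close>
definition bump_hess :: "real \<Rightarrow> 'a::euclidean_space \<Rightarrow> 'a \<Rightarrow> 'a" where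
  "bump_hess e a z = (- 6 * max 0 (e\<^sup>2 - z \<bullet> z) ^ 2) *\<^sub>R a
     + (24 * max 0 (e\<^sup>2 - z \<bullet> z) * (z \<bullet> a)) *\<^sub>R z"

text \<open>For exponents at least two the power of the positive part is differentiable at the origin too,
since both one-sided derivatives vanish there.\<close>
lemma max_0_power_has_derivative:
  "((\<lambda>t::real. max 0 t ^ Suc (Suc n)) has_derivative (\<lambda>h. (real (Suc (Suc n)) * max 0 t ^ Suc n) * h)) (at t)"
proof -
  have D: "((\<lambda>t::real. t ^ Suc (Suc n)) has_derivative (\<lambda>h. (real (Suc (Suc n)) * t ^ Suc n) * h)) (at t)" for t
    using DERIV_pow[of "Suc (Suc n)" t] unfolding has_field_derivative_def by simp
  have U: "{0..} \<union> {..<0::real} = UNIV" by auto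
  have cl: "t \<in> closure {0..} \<Longrightarrow> t \<in> closure {..<0::real} \<Longrightarrow> t = 0" by auto
  have "((\<lambda>t::real. if t \<in> {0..} then t ^ Suc (Suc n) else 0) has_derivative
      (if t \<in> {0..} then (\<lambda>h. (real (Suc (Suc n)) * t ^ Suc n) * h) else (\<lambda>h. 0)))
      (at t within {0..} \<union> {..<0})"
    by (rule has_derivative_If_within_closures[where f = "\<lambda>t. t ^ Suc (Suc n)" and g = "\<lambda>t. 0"
          and f' = "\<lambda>t h. (real (Suc (Suc n)) * t ^ Suc n) * h" and g' = "\<lambda>t h. 0"
          and S = "{0..}" and T = "{..<0}"])
       (use cl in \<open>auto intro!: has_derivative_at_withinI[OF D] simp del: power_Suc of_nat_Suc simp: zero_power\<close>)
  then have "((\<lambda>t::real. if t \<in> {0..} then t ^ Suc (Suc n) else 0) has_derivative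
      (if t \<in> {0..} then (\<lambda>h. (real (Suc (Suc n)) * t ^ Suc n) * h) else (\<lambda>h. 0))) (at t)"
    unfolding U .
  moreover have "(\<lambda>t::real. if t \<in> {0..} then t ^ Suc (Suc n) else 0) = (\<lambda>t. max 0 t ^ Suc (Suc n))"
    by (auto simp: fun_eq_iff max_def)
  moreover have "(if t \<in> {0..} then (\<lambda>h. (real (Suc (Suc n)) * t ^ Suc n) * h) else (\<lambda>h. 0))
      = (\<lambda>h. (real (Suc (Suc n)) * max 0 t ^ Suc n) * h)"
    by (auto simp: fun_eq_iff max_def)
  ultimately show ?thesis by simp
qed

lemma sphere_has_derivative:
  "((\<lambda>z::'a::euclidean_space. e\<^sup>2 - z \<bullet> z) has_derivative (\<lambda>h. - 2 * (z \<bullet> h))) (at z)"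
  by (auto intro!: derivative_eq_intros simp: inner_commute)

lemma bump_has_derivative: "(bump e has_derivative (\<lambda>h. bump_grad e z \<bullet> h)) (at z)"
proof -
  have "((\<lambda>t. max 0 t ^ 3) \<circ> (\<lambda>z. e\<^sup>2 - z \<bullet> z) has_derivative
      (\<lambda>h. 3 * max 0 (e\<^sup>2 - z \<bullet> z) ^ 2 * h) \<circ> (\<lambda>h. - 2 * (z \<bullet> h))) (at z)"
    using max_0_power_has_derivative[of 1 "e\<^sup>2 - z \<bullet> z"]
    by (intro diff_chain_at sphere_has_derivative) (simp add: numeral_eq_Suc)
  moreover have "(\<lambda>h. 3 * max 0 (e\<^sup>2 - z \<bullet> z) ^ 2 * h) \<circ> (\<lambda>h. - 2 * (z \<bullet> h)) = (\<lambda>h. bump_grad e z \<bullet> h)"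
    by (auto simp: bump_grad_def fun_eq_iff)
  moreover have "(\<lambda>t. max 0 t ^ 3) \<circ> (\<lambda>z. e\<^sup>2 - z \<bullet> z) = bump e"
    by (auto simp: bump_def fun_eq_iff)
  ultimately show ?thesis by metis
qed

lemma bump_grad_has_derivative:
  "((\<lambda>z. bump_grad e z \<bullet> a) has_derivative (\<lambda>h. bump_hess e a z \<bullet> h)) (at z)"
proof -
  have "((\<lambda>t. max 0 t ^ 2) \<circ> (\<lambda>z. e\<^sup>2 - z \<bullet> z) has_derivative
      (\<lambda>h. 2 * max 0 (e\<^sup>2 - z \<bullet> z) * h) \<circ> (\<lambda>h. - 2 * (z \<bullet> h))) (at z)"
    using max_0_power_has_derivative[of 0 "e\<^sup>2 - z \<bullet> z"]
    by (intro diff_chain_at sphere_has_derivative) (simp add: numeral_eq_Suc)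
  then have "((\<lambda>z. max 0 (e\<^sup>2 - z \<bullet> z) ^ 2) has_derivative
      (\<lambda>h. 2 * max 0 (e\<^sup>2 - z \<bullet> z) * (- 2 * (z \<bullet> h)))) (at z)"
    by (simp add: o_def)
  then have "((\<lambda>z. - 6 * max 0 (e\<^sup>2 - z \<bullet> z) ^ 2 * (z \<bullet> a)) has_derivative
      (\<lambda>h. - 6 * max 0 (e\<^sup>2 - z \<bullet> z) ^ 2 * (h \<bullet> a)
        + - 6 * (2 * max 0 (e\<^sup>2 - z \<bullet> z) * (- 2 * (z \<bullet> h))) * (z \<bullet> a))) (at z)"
    by (intro has_derivative_mult has_derivative_mult_right has_derivative_inner_left has_derivative_ident)
  then show ?thesis
    by (simp add: bump_grad_def bump_hess_def inner_add_left algebra_simps inner_commute[of a])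
qed

lemma bump_hess_symmetric: "bump_hess e a z \<bullet> b = bump_hess e b z \<bullet> a"
proof -
  have "bump_hess e a z \<bullet> b = (- 6 * max 0 (e\<^sup>2 - z \<bullet> z) ^ 2) * (a \<bullet> b)
     + (24 * max 0 (e\<^sup>2 - z \<bullet> z)) * ((z \<bullet> a) * (z \<bullet> b))" for a b
    unfolding bump_hess_def inner_add_left inner_scaleR_left by simp
  then show ?thesis by (simp only: inner_commute[of a b] mult.commute[of "z \<bullet> a"])
qed

lemma bump_eq_0:
  assumes "0 \<le> e" "e < norm z"
  shows "bump e z = 0" "bump_grad e z = 0" "bump_hess e a z = 0"
proof -
  have "e\<^sup>2 \<le> z \<bullet> z"
    using assms by (simp add: power2_norm_eq_inner[symmetric] power_mono)
  then have "max 0 (e\<^sup>2 - z \<bullet> z) = 0" by simp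
  then show "bump e z = 0" "bump_grad e z = 0" "bump_hess e a z = 0"
    unfolding bump_def bump_grad_def bump_hess_def by simp_all
qed

lemma continuous_on_bump:
  "continuous_on UNIV (bump e)" "continuous_on UNIV (bump_grad e)" "continuous_on UNIV (bump_hess e a)"
  unfolding bump_def[abs_def] bump_grad_def[abs_def] bump_hess_def[abs_def]
  by (auto intro!: continuous_intros)

lemma integrable_bump: "0 \<le> e \<Longrightarrow> integrable lborel (bump e)"
  by (rule integrable_continuous_compact_support[where R = e]) (auto simp: continuous_on_bump bump_eq_0)

lemma integral_bump_pos:
  assumes "0 < e"
  shows "0 < (LINT z|lborel. bump e (z::'a::euclidean_space))"
proof (rule ccontr)
  have nn: "0 \<le> bump e (z::'a)" for z by (simp add: bump_def)
  assume "\<not> ?thesis"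
  then have "(LINT z|lborel. bump e (z::'a)) = 0"
    using nn by (meson Bochner_Integration.integral_nonneg antisym not_less)
  moreover have "integrable lborel (bump e :: 'a \<Rightarrow> real)"
    using assms by (intro integrable_bump) simp
  ultimately have "AE z in lborel. bump e (z::'a) = 0"
    using integral_nonneg_eq_0_iff_AE[of lborel "bump e :: 'a \<Rightarrow> real"] nn by simp
  then have "AE z in lborel. z \<notin> ball (0::'a) e"
  proof (rule AE_mp, intro AE_I2 impI notI)
    fix z :: 'a assume "bump e z = 0" "z \<in> ball 0 e"
    moreover have "z \<bullet> z < e\<^sup>2" if "norm z < e"
      using that by (simp add: power2_norm_eq_inner[symmetric] power_strict_mono)
    ultimately show False by (auto simp: bump_def max_def split: if_splits)
  qed
  then have "ball (0::'a) e \<in> null_sets lborel"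
    by (subst AE_iff_null_sets) auto
  then have "negligible (ball (0::'a) e)"
    by (simp add: negligible_iff_null_sets null_sets_completionI)
  then show False using assms open_not_negligible[of "ball (0::'a) e"] by simp
qed

definition mollifier :: "real \<Rightarrow> 'a::euclidean_space \<Rightarrow> real" where
  "mollifier e z = bump e z / (LINT z|lborel. bump e (z::'a))"

definition mollifier_grad :: "real \<Rightarrow> 'a::euclidean_space \<Rightarrow> 'a" where
  "mollifier_grad e z = bump_grad e z /\<^sub>R (LINT z|lborel. bump e (z::'a))"

definition mollifier_hess :: "real \<Rightarrow> 'a::euclidean_space \<Rightarrow> 'a \<Rightarrow> 'a" where
  "mollifier_hess e a z = bump_hess e a z /\<^sub>R (LINT z|lborel. bump e (z::'a))"

lemma mollifier_has_derivative: "(mollifier e has_derivative (\<lambda>h. mollifier_grad e z \<bullet> h)) (at z)"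
  using has_derivative_mult_left[OF bump_has_derivative[of e z], of "inverse (LINT z|lborel. bump e (z::'a))"]
  by (simp add: mollifier_def[abs_def] mollifier_grad_def divide_inverse mult.commute)

lemma mollifier_grad_has_derivative:
  "((\<lambda>z. mollifier_grad e z \<bullet> a) has_derivative (\<lambda>h. mollifier_hess e a z \<bullet> h)) (at z)"
  using has_derivative_mult_right[OF bump_grad_has_derivative[of e a z], of "inverse (LINT z|lborel. bump e (z::'a))"]
  by (simp add: mollifier_grad_def mollifier_hess_def)

lemma mollifier_hess_symmetric: "mollifier_hess e a z \<bullet> b = mollifier_hess e b z \<bullet> a"
  by (simp add: mollifier_hess_def bump_hess_symmetric[of e a])

lemma mollifier_eq_0:
  assumes "0 \<le> e" "e < norm z"
  shows "mollifier e z = 0" "mollifier_grad e z = 0" "mollifier_hess e a z = 0"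
  using bump_eq_0[OF assms] by (simp_all add: mollifier_def mollifier_grad_def mollifier_hess_def)

lemma continuous_on_mollifier:
  "continuous_on UNIV (mollifier e)" "continuous_on UNIV (mollifier_grad e)"
  "continuous_on UNIV (mollifier_hess e a)"
  unfolding mollifier_def[abs_def] mollifier_grad_def[abs_def] mollifier_hess_def[abs_def] divide_inverse
  by (intro continuous_intros continuous_on_bump)+

lemma mollifier_nonneg: "0 \<le> mollifier e z"
  unfolding mollifier_def by (intro divide_nonneg_nonneg Bochner_Integration.integral_nonneg) (auto simp: bump_def)

lemma integral_mollifier:
  assumes "0 < e" shows "(LINT z|lborel. mollifier e (z::'a::euclidean_space)) = 1"
  using integral_bump_pos[OF assms, where 'a='a] by (simp add: mollifier_def)

section \<open>Mollification in \<open>L\<^sup>p\<close>\<close>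

lemma power_add_le:
  assumes "0 \<le> a" "0 \<le> (b::real)"
  shows "(a + b) ^ p \<le> 2 ^ p * (a ^ p + b ^ p)"
proof -
  have "(a + b) ^ p \<le> (2 * max a b) ^ p" using assms by (intro power_mono) auto
  also have "\<dots> = 2 ^ p * max a b ^ p" by (simp add: power_mult_distrib)
  also have "max a b ^ p \<le> a ^ p + b ^ p" using assms by (auto simp: max_def)
  finally show ?thesis by simp
qed

text \<open>Convexity of the power: its graph lies above the tangent at \<open>m\<close>. Integrated against a
probability density with mean \<open>m\<close> this is Jensen's inequality.\<close>
lemma power_tangent_le:
  assumes "0 \<le> a" "0 \<le> (m::real)"
  shows "m ^ Suc p + real (Suc p) * m ^ p * (a - m) \<le> a ^ Suc p"
proof (induction p)
  case (Suc p)
  have "m ^ Suc (Suc p) + real (Suc (Suc p)) * m ^ Suc p * (a - m) + real (Suc p) * m ^ p * (a - m)\<^sup>2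
      = a * (m ^ Suc p + real (Suc p) * m ^ p * (a - m))"
    by (simp add: power2_eq_square algebra_simps)
  also have "\<dots> \<le> a * a ^ Suc p" using Suc assms by (intro mult_left_mono) auto
  finally have "m ^ Suc (Suc p) + real (Suc (Suc p)) * m ^ Suc p * (a - m)
      + real (Suc p) * m ^ p * (a - m)\<^sup>2 \<le> a ^ Suc (Suc p)" by simp
  moreover have "0 \<le> real (Suc p) * m ^ p * (a - m)\<^sup>2" using assms by simp
  ultimately show ?case by linarith
qed (use assms in simp)

lemma integrable_reflected_mollifier:
  assumes "0 < e"
  shows "integrable lborel (\<lambda>y. mollifier e (x - y))"
proof (rule integrable_continuous_compact_support)
  show "continuous_on UNIV (\<lambda>y. mollifier e (x - y))"
    by (intro continuous_on_compose2[OF continuous_on_mollifier(1)] continuous_intros) auto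
  show "mollifier e (x - y) = 0" if "e + norm x < norm y" for y
    using that assms norm_triangle_ineq2[of y x] by (intro mollifier_eq_0) (auto simp: norm_minus_commute)
qed

lemma integral_reflected_mollifier:
  assumes "0 < e"
  shows "(LINT y|lborel. mollifier e (x - y)) = 1"
  using integral_reflect[of "mollifier e" x] integral_mollifier[OF assms, where 'a = 'a]
  by (simp add: borel_measurable_continuous_onI continuous_on_mollifier)

lemma integrable_conv_mollifier:
  fixes g :: "'a::euclidean_space \<Rightarrow> 'b::euclidean_space"
  assumes "0 < e" "integrable lborel g"
  shows "integrable lborel (\<lambda>y. mollifier e (x - y) *\<^sub>R g y)"
  using assms by (intro integrable_conv[where R = e] continuous_on_mollifier mollifier_eq_0) auto

lemma norm_conv_mollifier_power_le:
  fixes g :: "'a::euclidean_space \<Rightarrow> 'b::euclidean_space"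
  assumes e: "0 < e" and g: "integrable lborel g" and gp: "integrable lborel (\<lambda>y. norm (g y) ^ Suc p)"
  shows "norm (conv (mollifier e) g x) ^ Suc p \<le> conv (mollifier e) (\<lambda>y. norm (g y) ^ Suc p) x"
proof -
  define m where "m = conv (mollifier e) (\<lambda>y. norm (g y)) x"
  note I = integrable_conv_mollifier[OF e integrable_norm[OF g], of x]
    integrable_conv_mollifier[OF e gp, of x] integrable_reflected_mollifier[OF e, of x]
  have mI: "(LINT y|lborel. mollifier e (x - y) * norm (g y)) = m"
    by (simp add: m_def conv_def)
  have m: "0 \<le> m"
    unfolding m_def conv_def by (intro Bochner_Integration.integral_nonneg) (simp add: mollifier_nonneg)
  have "norm (conv (mollifier e) g x) \<le> m"
    unfolding m_def conv_def
    by (rule order_trans[OF integral_norm_bound]) (simp add: mollifier_nonneg)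
  then have "norm (conv (mollifier e) g x) ^ Suc p \<le> m ^ Suc p"
    by (intro power_mono) auto
  also have "m ^ Suc p = (LINT y|lborel. (m ^ Suc p - real (Suc p) * m ^ p * m) * mollifier e (x - y)
      + real (Suc p) * m ^ p * (mollifier e (x - y) *\<^sub>R norm (g y)))"
    using I by (subst Bochner_Integration.integral_add)
      (auto simp: integral_reflected_mollifier[OF e] mI)
  also have "\<dots> \<le> (LINT y|lborel. mollifier e (x - y) *\<^sub>R (norm (g y) ^ Suc p))"
  proof (rule integral_mono)
    show "integrable lborel (\<lambda>y. (m ^ Suc p - real (Suc p) * m ^ p * m) * mollifier e (x - y)
      + real (Suc p) * m ^ p * (mollifier e (x - y) *\<^sub>R norm (g y)))"
      using I by auto
    show "integrable lborel (\<lambda>y. mollifier e (x - y) *\<^sub>R (norm (g y) ^ Suc p))" by (rule I)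
    fix y
    have "mollifier e (x - y) * (m ^ Suc p + real (Suc p) * m ^ p * (norm (g y) - m))
        \<le> mollifier e (x - y) * norm (g y) ^ Suc p"
      by (intro mult_left_mono power_tangent_le mollifier_nonneg m norm_ge_zero)
    then show "(m ^ Suc p - real (Suc p) * m ^ p * m) * mollifier e (x - y)
      + real (Suc p) * m ^ p * (mollifier e (x - y) *\<^sub>R norm (g y)) \<le> mollifier e (x - y) *\<^sub>R (norm (g y) ^ Suc p)"
      by (simp add: algebra_simps)
  qed
  finally show ?thesis by (simp add: conv_def)
qed

text \<open>By Tonelli's theorem and the symmetry of the mollifier, averaging preserves the integral of a
nonnegative function.\<close>
lemma integral_conv_mollifier:
  fixes a :: "'a::euclidean_space \<Rightarrow> real"
  assumes e: "0 < e" and a: "integrable lborel a" and nn: "\<And>y. 0 \<le> a y"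
  shows "integrable lborel (conv (mollifier e) a)"
    and "(LINT x|lborel. conv (mollifier e) a x) = (LINT x|lborel. a x)"
proof -
  have [measurable]: "a \<in> borel_measurable borel" using a by auto
  have [measurable]: "mollifier e \<in> borel_measurable (borel :: 'a measure)"
    by (intro borel_measurable_continuous_onI continuous_on_mollifier)
  have nnc: "0 \<le> conv (mollifier e) a x" for x
    unfolding conv_def by (intro Bochner_Integration.integral_nonneg) (simp add: mollifier_nonneg nn)
  have cm: "conv (mollifier e) a \<in> borel_measurable lborel"
    using continuous_on_conv[OF continuous_on_mollifier(1) mollifier_eq_0(1) a] e
    by (simp add: borel_measurable_continuous_onI)
  have "(\<integral>\<^sup>+x. ennreal (conv (mollifier e) a x) \<partial>lborel)
      = (\<integral>\<^sup>+x. \<integral>\<^sup>+y. ennreal (mollifier e (x - y) * a y) \<partial>lborel \<partial>lborel)"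
    unfolding conv_def real_scaleR_def
    using integrable_conv_mollifier[OF e a, unfolded real_scaleR_def]
    by (intro nn_integral_cong nn_integral_eq_integral[symmetric])
       (auto simp: mollifier_nonneg nn)
  also have "\<dots> = (\<integral>\<^sup>+y. \<integral>\<^sup>+x. ennreal (mollifier e (x - y) * a y) \<partial>lborel \<partial>lborel)"
    by (rule lborel_pair.Fubini'[symmetric]) measurable
  also have "\<dots> = (\<integral>\<^sup>+y. ennreal (a y) \<partial>lborel)"
  proof (intro nn_integral_cong)
    fix y :: 'a
    have sym: "mollifier e (x - y) = mollifier e (y - x)" for x :: 'a
      by (simp add: mollifier_def bump_def inner_diff algebra_simps inner_commute)
    have "(\<integral>\<^sup>+x. ennreal (mollifier e (x - y) * a y) \<partial>lborel)
        = (\<integral>\<^sup>+x. ennreal (a y) * ennreal (mollifier e (y - x)) \<partial>lborel)"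
      by (simp add: sym ennreal_mult'' mult.commute nn mollifier_nonneg)
    also have "\<dots> = ennreal (a y) * (\<integral>\<^sup>+x. ennreal (mollifier e (y - x)) \<partial>lborel)"
      by (intro nn_integral_cmult) measurable
    also have "(\<integral>\<^sup>+x. ennreal (mollifier e (y - x)) \<partial>lborel) = 1"
      using nn_integral_eq_integral[OF integrable_reflected_mollifier[OF e, of y]]
      by (simp add: mollifier_nonneg integral_reflected_mollifier[OF e])
    finally show "(\<integral>\<^sup>+x. ennreal (mollifier e (x - y) * a y) \<partial>lborel) = ennreal (a y)" by simp
  qed
  also have "\<dots> = ennreal (LINT x|lborel. a x)"
    using a nn by (intro nn_integral_eq_integral) auto
  finally have eq: "(\<integral>\<^sup>+x. ennreal (conv (mollifier e) a x) \<partial>lborel) = ennreal (LINT x|lborel. a x)" .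
  show I: "integrable lborel (conv (mollifier e) a)"
    using cm nnc eq by (intro integrableI_nonneg) auto
  have "ennreal (LINT x|lborel. conv (mollifier e) a x) = ennreal (LINT x|lborel. a x)"
    using nn_integral_eq_integral[OF I] nnc eq by simp
  then show "(LINT x|lborel. conv (mollifier e) a x) = (LINT x|lborel. a x)"
    using nn nnc by (subst (asm) ennreal_inj) (auto intro!: Bochner_Integration.integral_nonneg)
qed

text \<open>Mollification is a contraction on \<open>L\<^sup>p\<close>; here and below the exponent is written \<open>Suc p\<close> so that
it is at least one.\<close>
lemma conv_mollifier_power_integral_le:
  fixes g :: "'a::euclidean_space \<Rightarrow> 'b::euclidean_space"
  assumes e: "0 < e" and g: "integrable lborel g" and gp: "integrable lborel (\<lambda>y. norm (g y) ^ Suc p)"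
  shows "integrable lborel (\<lambda>x. norm (conv (mollifier e) g x) ^ Suc p)"
    and "(LINT x|lborel. norm (conv (mollifier e) g x) ^ Suc p) \<le> (LINT x|lborel. norm (g x) ^ Suc p)"
proof -
  note I = integral_conv_mollifier[OF e gp]
  have "conv (mollifier e) g \<in> borel_measurable lborel"
    using continuous_on_conv[OF continuous_on_mollifier(1) mollifier_eq_0(1) g] e
    by (simp add: borel_measurable_continuous_onI)
  then show I': "integrable lborel (\<lambda>x. norm (conv (mollifier e) g x) ^ Suc p)"
    using norm_conv_mollifier_power_le[OF e g gp]
    by (intro Bochner_Integration.integrable_bound[OF I(1)])
       (auto simp del: power_Suc intro: order_trans[OF _ abs_ge_self])
  have "(LINT x|lborel. norm (conv (mollifier e) g x) ^ Suc p)
      \<le> (LINT x|lborel. conv (mollifier e) (\<lambda>y. norm (g y) ^ Suc p) x)"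
    using I' I(1) by (intro integral_mono norm_conv_mollifier_power_le e g gp) auto
  then show "(LINT x|lborel. norm (conv (mollifier e) g x) ^ Suc p) \<le> (LINT x|lborel. norm (g x) ^ Suc p)"
    using I(2) by simp
qed

lemma sum3_power_le:
  assumes "0 \<le> a" "0 \<le> b" "0 \<le> (c::real)"
  shows "(a + b + c) ^ p \<le> 4 ^ p * (a ^ p + b ^ p + c ^ p)"
proof -
  have "(a + b + c) ^ p \<le> 2 ^ p * ((a + b) ^ p + c ^ p)"
    using assms by (intro power_add_le) auto
  also have "\<dots> \<le> 2 ^ p * (2 ^ p * (a ^ p + b ^ p) + 2 ^ p * c ^ p)"
  proof (intro mult_left_mono add_mono power_add_le assms)
    have "1 * c ^ p \<le> 2 ^ p * c ^ p" using assms by (intro mult_right_mono) auto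
    then show "c ^ p \<le> 2 ^ p * c ^ p" by simp
  qed simp
  also have "\<dots> = 4 ^ p * (a ^ p + b ^ p + c ^ p)"
  proof -
    have "(4::real) ^ p = 2 ^ p * 2 ^ p" by (simp flip: power_mult_distrib)
    then show ?thesis by (simp add: distrib_left mult.assoc)
  qed
  finally show ?thesis .
qed

lemma truncate_approximation:
  fixes g :: "'a::euclidean_space \<Rightarrow> 'b::euclidean_space"
  assumes g: "g \<in> borel_measurable lborel" and gp: "integrable lborel (\<lambda>y. norm (g y) ^ Suc p)" and "0 < d"
  obtains M where "0 < M" "integrable lborel (\<lambda>x. norm (g x - (M / max M (norm (g x))) *\<^sub>R g x) ^ Suc p)"
    "(LINT x|lborel. norm (g x - (M / max M (norm (g x))) *\<^sub>R g x) ^ Suc p) < d"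
proof -
  let ?t = "\<lambda>M x. norm (g x - (M / max M (norm (g x))) *\<^sub>R g x) ^ Suc p"
  have le: "?t M x \<le> norm (g x) ^ Suc p" if "0 < M" for M x
  proof -
    have "g x - (M / max M (norm (g x))) *\<^sub>R g x = (1 - M / max M (norm (g x))) *\<^sub>R g x"
      by (simp add: algebra_simps)
    moreover have "\<bar>1 - M / max M (norm (g x))\<bar> \<le> 1"
    proof -
      have "0 \<le> M / max M (norm (g x))" "M / max M (norm (g x)) \<le> 1"
        using that by (simp_all add: divide_le_eq_1_pos less_max_iff_disj)
      then show ?thesis by linarith
    qed
    ultimately show ?thesis
      by (metis mult_left_le_one_le abs_ge_zero norm_ge_zero norm_scaleR power_mono)
  qed
  have meas: "?t M \<in> borel_measurable lborel" for M using g by measurable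
  have int: "integrable lborel (?t M)" if "0 < M" for M
    by (rule Bochner_Integration.integrable_bound[OF gp meas]) (use le[OF that] in \<open>auto simp del: power_Suc\<close>)
  have "(\<lambda>k. LINT x|lborel. ?t (real (Suc k)) x) \<longlonglongrightarrow> (LINT x|(lborel :: 'a measure). (0::real))"
  proof (rule integral_dominated_convergence[where s = "\<lambda>k. ?t (real (Suc k))" and f = "\<lambda>_. 0"
        and w = "\<lambda>x. norm (g x) ^ Suc p"])
    show "?t (real (Suc k)) \<in> borel_measurable lborel" for k by (rule meas)
    show "integrable lborel (\<lambda>x. norm (g x) ^ Suc p)" by (rule gp)
    show "AE x in lborel. (\<lambda>k. ?t (real (Suc k)) x) \<longlonglongrightarrow> 0"
    proof (rule AE_I2)
      fix x
      have "\<forall>\<^sub>F k in sequentially. ?t (real (Suc k)) x = 0"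
        using eventually_ge_at_top[of "nat \<lceil>norm (g x)\<rceil>"]
      proof eventually_elim
        case (elim k)
        then have "norm (g x) \<le> real (Suc k)" by linarith
        then have "max (real (Suc k)) (norm (g x)) = real (Suc k)" by simp
        then show ?case by simp
      qed
      then show "(\<lambda>k. ?t (real (Suc k)) x) \<longlonglongrightarrow> 0" by (rule tendsto_eventually)
    qed
    show "AE x in lborel. norm (?t (real (Suc k)) x) \<le> norm (g x) ^ Suc p" for k
      using le[of "real (Suc k)"] by (auto simp del: power_Suc)
  qed simp
  then have "\<forall>\<^sub>F k in sequentially. (LINT x|lborel. ?t (real (Suc k)) x) < d"
    using \<open>0 < d\<close> by (intro order_tendstoD(2)) auto
  then obtain k where "(LINT x|lborel. ?t (real (Suc k)) x) < d"
    by (meson eventually_happens' sequentially_bot)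
  then show ?thesis using that[of "real (Suc k)"] int[of "real (Suc k)"] by simp
qed

text \<open>Density of continuous functions in \<open>L\<^sup>p\<close>. A truncated function is the almost everywhere limit of
continuous functions, and these may be truncated at the same height and cut off outside a ball; the
limit is then dominated by a constant on that ball.\<close>
lemma continuous_approximation:
  fixes g :: "'a::euclidean_space \<Rightarrow> 'b::euclidean_space"
  assumes g: "g \<in> borel_measurable lborel" and gp: "integrable lborel (\<lambda>y. norm (g y) ^ Suc p)"
    and supp: "\<And>y. r < norm y \<Longrightarrow> g y = 0" and "0 < d"
  obtains c where "continuous_on UNIV c" "\<And>y. r + 1 < norm y \<Longrightarrow> c y = 0"
    "integrable lborel (\<lambda>x. norm (g x - c x) ^ Suc p)" "(LINT x|lborel. norm (g x - c x) ^ Suc p) < d"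
proof -
  define d' where "d' = d / (2 * 2 ^ Suc p)"
  have "0 < d'" using \<open>0 < d\<close> by (simp add: d'_def)
  obtain M where "0 < M" and M: "integrable lborel (\<lambda>x. norm (g x - (M / max M (norm (g x))) *\<^sub>R g x) ^ Suc p)"
    "(LINT x|lborel. norm (g x - (M / max M (norm (g x))) *\<^sub>R g x) ^ Suc p) < d'"
    using truncate_approximation[OF g gp \<open>0 < d'\<close>] by blast
  define T where "T v = (M / max M (norm v)) *\<^sub>R v" for v :: 'b
  have contT: "continuous_on UNIV T"
    unfolding T_def using \<open>0 < M\<close> by (intro continuous_intros) (auto simp: max_def)
  have normT: "norm (T v) \<le> M" for v
    unfolding T_def using \<open>0 < M\<close> by (auto simp: max_def field_simps)
  \<comment> \<open>A cutoff that equals one on the ball of radius \<open>r\<close>, where \<open>g\<close> lives.\<close>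
  define \<eta> :: "'a \<Rightarrow> real" where "\<eta> x = max 0 (min 1 (r + 1 - norm x))" for x
  have cont\<eta>: "continuous_on UNIV \<eta>"
    unfolding \<eta>_def[abs_def] by (intro continuous_intros)
  have \<eta>01: "0 \<le> \<eta> x" "\<eta> x \<le> 1" for x unfolding \<eta>_def by auto
  have "g \<in> borel_measurable (lebesgue_on UNIV)"
    using measurable_completion[OF g] by simp
  then have "g measurable_on UNIV" by (simp add: measurable_on_iff_borel_measurable)
  then obtain N G where N: "negligible N" and contG: "\<And>k::nat. continuous_on UNIV (G k)"
    and G: "\<And>x. x \<notin> N \<Longrightarrow> (\<lambda>k. G k x) \<longlonglongrightarrow> g x"
    unfolding measurable_on_def by (auto simp del: power_Suc)
  define c where "c k x = \<eta> x *\<^sub>R T (G k x)" for k x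
  have contc: "continuous_on UNIV (c k)" for k
    unfolding c_def[abs_def]
    by (intro continuous_intros cont\<eta> continuous_on_compose2[OF contT contG]) auto
  have suppc: "c k y = 0" if "r + 1 < norm y" for k y
    using that by (simp add: c_def \<eta>_def)
  let ?t = "\<lambda>k x. norm (T (g x) - c k x) ^ Suc p"
  let ?w = "\<lambda>x. (2 * M) ^ Suc p * indicator (cball (0::'a) (r + 1)) x"
  have [measurable]: "T \<in> borel_measurable borel" "\<And>k. c k \<in> borel_measurable borel"
    using contT contc by (auto intro: borel_measurable_continuous_onI)
  have meas: "?t k \<in> borel_measurable lborel" for k using g by measurable
  have intw: "integrable lborel ?w"
    by (intro integrable_mult_right integrable_real_indicator emeasure_bounded_finite bounded_cball) auto
  have le: "?t k x \<le> ?w x" for k x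
  proof (cases "x \<in> cball 0 (r + 1)")
    case True
    have "norm (c k x) \<le> 1 * M"
      unfolding c_def norm_scaleR using \<eta>01 normT by (intro mult_mono) auto
    then have "norm (T (g x) - c k x) \<le> 2 * M"
      using normT[of "g x"] norm_triangle_ineq4[of "T (g x)" "c k x"] by simp
    then have "?t k x \<le> (2 * M) ^ Suc p" by (intro power_mono) auto
    then show ?thesis using True by (simp del: power_Suc)
  next
    case False
    then have "T (g x) = 0" "c k x = 0" using supp[of x] suppc[of x] by (auto simp: T_def)
    then show ?thesis using \<open>0 < M\<close> by simp
  qed
  have int: "integrable lborel (?t k)" for k
    by (rule Bochner_Integration.integrable_bound[OF intw meas]) (use le in \<open>auto simp del: power_Suc intro: order_trans[OF _ abs_ge_self]\<close>)
  have "(\<lambda>k. LINT x|lborel. ?t k x) \<longlonglongrightarrow> (LINT x|(lborel :: 'a measure). (0::real))"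
  proof (rule integral_dominated_convergence[where s = ?t and f = "\<lambda>_. 0" and w = ?w])
    show "?t k \<in> borel_measurable lborel" for k by (rule meas)
    show "integrable lborel ?w" by (rule intw)
    have ae: "AE x in lebesgue. x \<notin> N"
      using N by (simp add: negligible_iff_null_sets AE_not_in)
    have "AE x in lebesgue. (\<lambda>k. ?t k x) \<longlonglongrightarrow> 0"
      using ae
    proof eventually_elim
      case (elim x)
      have eq: "\<eta> x *\<^sub>R T (g x) = T (g x)"
      proof (cases "r < norm x")
        case True
        then show ?thesis using supp by (simp add: T_def)
      next
        case False
        then have "\<eta> x = 1" by (simp add: \<eta>_def)
        then show ?thesis by simp
      qed
      have "(\<lambda>k. T (G k x)) \<longlonglongrightarrow> T (g x)"
        using contT by (intro isCont_tendsto_compose[OF _ G[OF elim]]) (simp add: continuous_on_eq_continuous_at)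
      then have "(\<lambda>k. c k x) \<longlonglongrightarrow> \<eta> x *\<^sub>R T (g x)"
        unfolding c_def by (intro tendsto_scaleR tendsto_const)
      then have "(\<lambda>k. c k x) \<longlonglongrightarrow> T (g x)" unfolding eq .
      then have "(\<lambda>k. ?t k x) \<longlonglongrightarrow> norm (T (g x) - T (g x)) ^ Suc p"
        by (intro tendsto_power tendsto_norm tendsto_diff tendsto_const)
      then show ?case by (simp only: diff_self norm_zero power_0_Suc)
    qed
    then show "AE x in lborel. (\<lambda>k. ?t k x) \<longlonglongrightarrow> 0"
      unfolding AE_completion_iff .
    show "AE x in lborel. norm (?t k x) \<le> ?w x" for k
      by (rule AE_I2) (simp only: real_norm_def abs_of_nonneg zero_le_power norm_ge_zero le)
  qed simp
  then have "\<forall>\<^sub>F k in sequentially. (LINT x|lborel. ?t k x) < d'"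
    using \<open>0 < d'\<close> by (intro order_tendstoD(2)) auto
  then obtain k where k: "(LINT x|lborel. ?t k x) < d'"
    by (meson eventually_happens' sequentially_bot)
  let ?b = "\<lambda>x. 2 ^ Suc p * (norm (g x - T (g x)) ^ Suc p + ?t k x)"
  have intb: "integrable lborel ?b"
    by (intro integrable_mult_right Bochner_Integration.integrable_add M(1)[folded T_def] int)
  have leb: "norm (g x - c k x) ^ Suc p \<le> ?b x" for x
  proof -
    have "norm (g x - c k x) \<le> norm (g x - T (g x)) + norm (T (g x) - c k x)"
      using norm_triangle_ineq[of "g x - T (g x)" "T (g x) - c k x"] by simp
    then have "norm (g x - c k x) ^ Suc p \<le> (norm (g x - T (g x)) + norm (T (g x) - c k x)) ^ Suc p"
      by (rule power_mono) simp
    also have "\<dots> \<le> ?b x" by (intro power_add_le norm_ge_zero)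
    finally show ?thesis .
  qed
  show ?thesis
  proof (rule that[of "c k"])
    show "continuous_on UNIV (c k)" by (rule contc)
    show "c k y = 0" if "r + 1 < norm y" for y using that by (rule suppc)
    show I: "integrable lborel (\<lambda>x. norm (g x - c k x) ^ Suc p)"
      using g by (intro Bochner_Integration.integrable_bound[OF intb])
        (use leb in \<open>auto simp del: power_Suc intro: order_trans[OF _ abs_ge_self]\<close>)
    have "(LINT x|lborel. norm (g x - c k x) ^ Suc p) \<le> (LINT x|lborel. ?b x)"
      by (intro integral_mono I intb leb)
    also have "\<dots> = 2 ^ Suc p * ((LINT x|lborel. norm (g x - T (g x)) ^ Suc p) + (LINT x|lborel. ?t k x))"
      using M(1)[folded T_def] int[of k] by (simp del: power_Suc)
    also have "\<dots> < 2 ^ Suc p * (d' + d')"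
      using M(2)[folded T_def] k by (intro mult_strict_left_mono add_strict_mono) auto
    also have "\<dots> = d" by (simp add: d'_def)
    finally show "(LINT x|lborel. norm (g x - c k x) ^ Suc p) < d" .
  qed
qed

lemma integrable_if_power_integrable:
  fixes g :: "'a::euclidean_space \<Rightarrow> 'b::euclidean_space"
  assumes g: "g \<in> borel_measurable lborel" and gp: "integrable lborel (\<lambda>y. norm (g y) ^ Suc p)"
    and supp: "\<And>y. r < norm y \<Longrightarrow> g y = 0"
  shows "integrable lborel g"
proof (rule Bochner_Integration.integrable_bound[OF _ g])
  show "integrable lborel (\<lambda>y. norm (g y) ^ Suc p + indicator (cball 0 r) y)"
    by (intro Bochner_Integration.integrable_add gp integrable_real_indicator emeasure_bounded_finite bounded_cball) auto
  have "norm (g y) \<le> norm (g y) ^ Suc p + indicator (cball 0 r) y" for y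
  proof (cases "norm (g y) \<le> 1")
    case True
    then show ?thesis using supp[of y] by (cases "r < norm y") (auto intro: add_increasing)
  next
    case False
    then have "norm (g y) ^ 1 \<le> norm (g y) ^ Suc p" by (intro power_increasing) auto
    then show ?thesis by (auto simp: indicator_def)
  qed
  then show "AE y in lborel. norm (g y) \<le> norm (norm (g y) ^ Suc p + indicator (cball 0 r) y)"
    by (auto simp del: power_Suc)
qed

lemma conv_mollifier_uniform:
  fixes c :: "'a::euclidean_space \<Rightarrow> 'b::euclidean_space"
  assumes c: "continuous_on UNIV c" "\<And>y. R < norm y \<Longrightarrow> c y = 0" and e: "0 < e"
    and w: "\<And>y z. dist y z \<le> e \<Longrightarrow> dist (c y) (c z) \<le> w"
  shows "norm (conv (mollifier e) c x - c x) \<le> w"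
proof -
  have ic: "integrable lborel c" by (rule integrable_continuous_compact_support[OF c])
  have I1: "integrable lborel (\<lambda>y. mollifier e (x - y) *\<^sub>R c y)"
    by (rule integrable_conv_mollifier[OF e ic])
  have I2: "integrable lborel (\<lambda>y. mollifier e (x - y) *\<^sub>R c x)"
    by (rule integrable_scaleR_left[OF integrable_reflected_mollifier[OF e]])
  have "(LINT y|lborel. mollifier e (x - y) *\<^sub>R c x) = c x"
    by (subst integral_scaleR_left) (simp_all add: integrable_reflected_mollifier[OF e] integral_reflected_mollifier[OF e])
  then have "conv (mollifier e) c x - c x = (LINT y|lborel. mollifier e (x - y) *\<^sub>R (c y - c x))"
    unfolding scaleR_diff_right conv_def using Bochner_Integration.integral_diff[OF I1 I2] by simp
  also have "norm \<dots> \<le> (LINT y|lborel. mollifier e (x - y) * w)"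
  proof (rule Bochner_Integration.integral_norm_bound_integral)
    show "integrable lborel (\<lambda>y. mollifier e (x - y) *\<^sub>R (c y - c x))"
      unfolding scaleR_diff_right by (rule Bochner_Integration.integrable_diff[OF I1 I2])
    show "integrable lborel (\<lambda>y. mollifier e (x - y) * w)"
      by (intro integrable_mult_left integrable_reflected_mollifier e)
    fix y
    show "norm (mollifier e (x - y) *\<^sub>R (c y - c x)) \<le> mollifier e (x - y) * w"
    proof (cases "dist y x \<le> e")
      case True
      then show ?thesis using w[OF True] mollifier_nonneg[of e "x - y"] by (simp add: dist_norm mult_left_mono)
    next
      case False
      then have "mollifier e (x - y) = 0"
        using e by (intro mollifier_eq_0) (auto simp: dist_norm norm_minus_commute)
      then show ?thesis by simp
    qed
  qed
  also have "\<dots> = w" using integral_reflected_mollifier[OF e, of x] by simp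
  finally show ?thesis .
qed

lemma conv_add:
  fixes g h :: "'a::euclidean_space \<Rightarrow> 'b::euclidean_space"
  assumes k: "continuous_on UNIV k" "\<And>z. R < norm z \<Longrightarrow> k z = 0"
    and g: "integrable lborel g" and h: "integrable lborel h"
  shows "conv k (\<lambda>y. g y + h y) x = conv k g x + conv k h x"
  unfolding conv_def scaleR_add_right
  by (intro Bochner_Integration.integral_add integrable_conv[OF k g] integrable_conv[OF k h])

text \<open>Write \<open>g = \<rho> + c\<close> with \<open>c\<close> continuous and \<open>\<rho>\<close> small in \<open>L\<^sup>p\<close>. The mollified \<open>c\<close> is uniformly
close to \<open>c\<close>, and the mollified \<open>\<rho>\<close> stays small by contraction.\<close>
lemma conv_mollifier_tendsto_Lp:
  fixes g :: "'a::euclidean_space \<Rightarrow> 'b::euclidean_space"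
  assumes g: "g \<in> borel_measurable lborel" and gp: "integrable lborel (\<lambda>y. norm (g y) ^ Suc p)"
    and supp: "\<And>y. r < norm y \<Longrightarrow> g y = 0" and "0 < d"
  obtains e0 where "0 < e0"
    "\<And>e. \<lbrakk>0 < e; e < e0\<rbrakk> \<Longrightarrow> integrable lborel (\<lambda>x. norm (conv (mollifier e) g x - g x) ^ Suc p)
       \<and> (LINT x|lborel. norm (conv (mollifier e) g x - g x) ^ Suc p) < d"
proof -
  define A :: real where "A = 4 ^ Suc p"
  have "0 < A" by (simp add: A_def)
  define d1 where "d1 = d / (4 * A)"
  have "0 < d1" using \<open>0 < d\<close> \<open>0 < A\<close> by (simp add: d1_def)
  obtain c where c: "continuous_on UNIV c" "\<And>y. r + 1 < norm y \<Longrightarrow> c y = 0"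
    and gc: "integrable lborel (\<lambda>x. norm (g x - c x) ^ Suc p)" "(LINT x|lborel. norm (g x - c x) ^ Suc p) < d1"
    using continuous_approximation[OF g gp supp \<open>0 < d1\<close>] by blast
  define \<rho> where "\<rho> x = g x - c x" for x
  have cm: "c \<in> borel_measurable borel" using c(1) by (rule borel_measurable_continuous_onI)
  have \<rho>m: "\<rho> \<in> borel_measurable lborel" unfolding \<rho>_def[abs_def] using g cm by measurable
  have \<rho>p: "integrable lborel (\<lambda>x. norm (\<rho> x) ^ Suc p)" "(LINT x|lborel. norm (\<rho> x) ^ Suc p) < d1"
    using gc by (simp_all only: \<rho>_def)
  have \<rho>s: "\<rho> y = 0" if "r + 1 < norm y" for y
    using that c(2) supp by (simp add: \<rho>_def)
  have \<rho>i: "integrable lborel \<rho>" by (rule integrable_if_power_integrable[OF \<rho>m \<rho>p(1) \<rho>s])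
  have ci: "integrable lborel c" by (rule integrable_continuous_compact_support[OF c])
  define V where "V = measure lborel (cball (0::'a) (r + 3))"
  have "0 \<le> V" by (simp add: V_def)
  \<comment> \<open>With \<open>w \<le> 1\<close> the power \<open>w ^ Suc p\<close> is at most \<open>w\<close>, so a uniform error \<open>w\<close> on the ball costs at most \<open>d1\<close>.\<close>
  define w where "w = min 1 (d1 / (V + 1))"
  have "0 < w" "w \<le> 1" using \<open>0 < d1\<close> \<open>0 \<le> V\<close> by (auto simp: w_def)
  have "w ^ Suc p * V \<le> w * V"
    using \<open>0 < w\<close> \<open>w \<le> 1\<close> \<open>0 \<le> V\<close> by (intro mult_right_mono power_le_one_iff[THEN iffD2] power_Suc_le_self) auto
  also have "\<dots> \<le> d1 / (V + 1) * V" using \<open>0 \<le> V\<close> by (intro mult_right_mono) (auto simp: w_def)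
  also have "\<dots> \<le> d1" using \<open>0 \<le> V\<close> \<open>0 < d1\<close> by (simp add: field_simps)
  finally have wV: "w ^ Suc p * V \<le> d1" .
  obtain e1 where "0 < e1" and e1: "\<And>y z. dist y z < e1 \<Longrightarrow> dist (c y) (c z) < w"
    using continuous_compact_support_uniformly_continuous[OF c \<open>0 < w\<close>] by blast
  show ?thesis
  proof (rule that[of "min 1 e1"])
    show "0 < min 1 e1" using \<open>0 < e1\<close> by simp
    fix e :: real assume e: "0 < e" "e < min 1 e1"
    note molc = continuous_on_mollifier(1)[of e] and mols = mollifier_eq_0(1)[OF less_imp_le[OF e(1)]]
    define u where "u = conv (mollifier e) g"
    define s where "s = conv (mollifier e) \<rho>"
    define t where "t x = conv (mollifier e) c x - c x" for x
    have "g = (\<lambda>y. \<rho> y + c y)" by (simp add: \<rho>_def fun_eq_iff)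
    then have "u = conv (mollifier e) (\<lambda>y. \<rho> y + c y)" by (simp only: u_def)
    then have dec: "u x - g x = s x + t x + (- \<rho> x)" for x
      using conv_add[where x = x, OF molc mols \<rho>i ci] by (simp add: s_def t_def \<rho>_def)
    note sp = conv_mollifier_power_integral_le[OF e(1) \<rho>i \<rho>p(1), folded s_def]
    let ?w = "\<lambda>x. w ^ Suc p * indicator (cball (0::'a) (r + 3)) x"
    have intw: "integrable lborel ?w"
      by (intro integrable_mult_right integrable_real_indicator emeasure_bounded_finite bounded_cball) auto
    have tw: "norm (t x) ^ Suc p \<le> ?w x" for x
    proof (cases "x \<in> cball 0 (r + 3)")
      case True
      have "norm (t x) \<le> w"
        unfolding t_def
      proof (rule conv_mollifier_uniform[OF c e(1)])
        fix y z :: 'a assume "dist y z \<le> e"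
        then show "dist (c y) (c z) \<le> w" using e1[of y z] e by simp
      qed
      then have "norm (t x) ^ Suc p \<le> w ^ Suc p" by (rule power_mono) simp
      then show ?thesis using True by (simp del: power_Suc)
    next
      case False
      then have "e + (r + 1) < norm x" "r + 1 < norm x" using e by auto
      then have "t x = 0"
        unfolding t_def using conv_eq_0[OF mols c(2)] c(2) by simp
      then show ?thesis using \<open>0 < w\<close> by simp
    qed
    have uc: "continuous_on UNIV u" "continuous_on UNIV (conv (mollifier e) c)"
      unfolding u_def
      by (rule continuous_on_conv[OF molc mols integrable_if_power_integrable[OF g gp supp]],
          assumption, assumption) (rule continuous_on_conv[OF molc mols ci], assumption)
    have tm: "t \<in> borel_measurable lborel"
      unfolding t_def[abs_def] using cm borel_measurable_continuous_onI[OF uc(2)] by measurable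
    have um: "(\<lambda>x. norm (u x - g x) ^ Suc p) \<in> borel_measurable lborel"
      using g borel_measurable_continuous_onI[OF uc(1)] by measurable
    have tp: "integrable lborel (\<lambda>x. norm (t x) ^ Suc p)"
      using tm by (intro Bochner_Integration.integrable_bound[OF intw])
        (use tw in \<open>auto simp del: power_Suc intro: order_trans[OF _ abs_ge_self]\<close>)
    have "(LINT x|lborel. norm (t x) ^ Suc p) \<le> (LINT x|lborel. ?w x)"
      by (intro integral_mono tp intw tw)
    also have "\<dots> = w ^ Suc p * V" by (simp add: V_def)
    finally have tI: "(LINT x|lborel. norm (t x) ^ Suc p) \<le> d1" using wV by linarith
    let ?b = "\<lambda>x. A * (norm (s x) ^ Suc p + norm (t x) ^ Suc p + norm (\<rho> x) ^ Suc p)"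
    have intb: "integrable lborel ?b"
      by (intro integrable_mult_right Bochner_Integration.integrable_add sp tp \<rho>p)
    have leb: "norm (u x - g x) ^ Suc p \<le> ?b x" for x
    proof -
      have "norm (u x - g x) \<le> norm (s x) + norm (t x) + norm (\<rho> x)"
        unfolding dec by (metis add_mono norm_minus_cancel norm_triangle_ineq norm_triangle_mono order_refl)
      then have "norm (u x - g x) ^ Suc p \<le> (norm (s x) + norm (t x) + norm (\<rho> x)) ^ Suc p"
        by (rule power_mono) simp
      also have "\<dots> \<le> ?b x" unfolding A_def by (intro sum3_power_le norm_ge_zero)
      finally show ?thesis .
    qed
    have I: "integrable lborel (\<lambda>x. norm (u x - g x) ^ Suc p)"
      using um by (intro Bochner_Integration.integrable_bound[OF intb])
        (use leb in \<open>auto simp del: power_Suc intro: order_trans[OF _ abs_ge_self]\<close>)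
    have "(LINT x|lborel. norm (u x - g x) ^ Suc p) \<le> (LINT x|lborel. ?b x)"
      by (intro integral_mono I intb leb)
    also have "\<dots> = A * ((LINT x|lborel. norm (s x) ^ Suc p) + (LINT x|lborel. norm (t x) ^ Suc p)
        + (LINT x|lborel. norm (\<rho> x) ^ Suc p))"
      using sp(1) tp \<rho>p(1) by (simp del: power_Suc)
    also have "\<dots> \<le> A * (3 * d1)"
      using sp(2) tI \<rho>p(2) \<open>0 < A\<close> by (intro mult_left_mono) auto
    also have "\<dots> < d" using \<open>0 < A\<close> \<open>0 < d\<close> by (simp add: d1_def)
    finally show "integrable lborel (\<lambda>x. norm (conv (mollifier e) g x - g x) ^ Suc p)
       \<and> (LINT x|lborel. norm (conv (mollifier e) g x - g x) ^ Suc p) < d"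
      using I by (simp only: u_def simp_thms)
  qed
qed

section \<open>Test functions and the fundamental lemma\<close>

text \<open>Convolutions and Tonelli's theorem are stated for Borel functions and \<open>lborel\<close>, Sobolev functions
for \<open>lebesgue_on S\<close>. This lemma carries integrals from one setting to the other.\<close>
lemma integral_lebesgue_on_eq:
  fixes F F' :: "'a::euclidean_space \<Rightarrow> 'b::euclidean_space"
  assumes S: "S \<in> sets lebesgue" and F': "F' \<in> borel_measurable borel"
    and ae: "AE x in lborel. indicator S x *\<^sub>R F x = F' x"
  shows "integrable (lebesgue_on S) F \<longleftrightarrow> integrable lborel F'"
    and "(LINT x|lebesgue_on S. F x) = (LINT x|lborel. F' x)"
proof -
  have ae': "AE x in lebesgue. indicator S x *\<^sub>R F x = F' x"
    using ae by (rule AE_completion)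
  have F'l: "F' \<in> borel_measurable lebesgue" using F' by (simp add: measurable_completion)
  have Fl: "(\<lambda>x. indicator S x *\<^sub>R F x) \<in> borel_measurable lebesgue"
    by (rule borel_measurable_AE[OF F'l]) (use ae' in \<open>auto simp: eq_commute\<close>)
  have "integrable (lebesgue_on S) F \<longleftrightarrow> integrable lebesgue F'"
    using S integrable_cong_AE[OF Fl F'l ae'] by (simp add: integrable_restrict_space)
  then show "integrable (lebesgue_on S) F \<longleftrightarrow> integrable lborel F'"
    using F' by (simp add: integrable_completion)
  have "(LINT x|lebesgue_on S. F x) = (LINT x|lebesgue. F' x)"
    using S integral_cong_AE[OF Fl F'l ae'] by (simp add: integral_restrict_space)
  then show "(LINT x|lebesgue_on S. F x) = (LINT x|lborel. F' x)"
    using F' by (simp add: integral_completion)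
qed

lemma borel_representative:
  fixes g :: "'a::euclidean_space \<Rightarrow> 'b::euclidean_space"
  assumes K: "compact K" and g: "g \<in> borel_measurable (lebesgue_on K)"
  obtains g' where "g' \<in> borel_measurable borel" "\<And>x. x \<notin> K \<Longrightarrow> g' x = 0"
    "AE x in lborel. g' x = indicator K x *\<^sub>R g x"
proof -
  have Kl: "K \<in> sets lebesgue" "K \<in> sets borel" using K by (auto simp: borel_compact)
  have "(\<lambda>x. if x \<in> K then g x else 0) \<in> borel_measurable lebesgue"
    using g Kl by (simp add: borel_measurable_if)
  then have m: "(\<lambda>x. (if x \<in> K then g x else 0) \<bullet> b) \<in> borel_measurable (completion lborel)" for b
    by (intro borel_measurable_inner) auto
  have "\<forall>b. \<exists>f. f \<in> borel_measurable lborel \<and> (AE x in lborel. (if x \<in> K then g x else 0) \<bullet> b = f x)"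
    using completion_ex_borel_measurable_real[OF m] by blast
  from choice[OF this] obtain f where f: "\<And>b. f b \<in> borel_measurable lborel"
    and ae: "\<And>b. AE x in lborel. (if x \<in> K then g x else 0) \<bullet> b = f b x" by blast
  show ?thesis
  proof (rule that[of "\<lambda>x. indicator K x *\<^sub>R (\<Sum>b\<in>Basis. f b x *\<^sub>R b)"])
    show "(\<lambda>x. indicator K x *\<^sub>R (\<Sum>b\<in>Basis. f b x *\<^sub>R b)) \<in> borel_measurable borel"
      using f Kl by auto
    have "AE x in lborel. \<forall>b\<in>Basis. (if x \<in> K then g x else 0) \<bullet> b = f b x"
      by (rule AE_finite_allI[OF finite_Basis ae])
    then show "AE x in lborel. indicator K x *\<^sub>R (\<Sum>b\<in>Basis. f b x *\<^sub>R b) = indicator K x *\<^sub>R g x"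
    proof eventually_elim
      case (elim x)
      have "(\<Sum>b\<in>Basis. f b x *\<^sub>R b) = (\<Sum>b\<in>Basis. ((if x \<in> K then g x else 0) \<bullet> b) *\<^sub>R b)"
        using elim by (intro sum.cong) auto
      then show ?case by (simp add: euclidean_representation)
    qed
  qed auto
qed

lemma compact_neighbourhood:
  fixes K :: "'a::euclidean_space set"
  assumes "compact K" "open S" "K \<subseteq> S"
  obtains r K' where "0 < r" "compact K'" "K' \<subseteq> S" "\<And>x. x \<in> K \<Longrightarrow> cball x r \<subseteq> K'"
proof -
  obtain r where r: "0 < r" "(\<Union>x\<in>K. cball x r) \<subseteq> S"
    using compact_subset_open_imp_cball_epsilon_subset[OF assms] by blast
  have eq: "(\<Union>x\<in>K. cball x r) = {x + y | x y. x \<in> K \<and> y \<in> cball 0 r}"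
  proof (intro set_eqI iffI)
    fix z assume "z \<in> (\<Union>x\<in>K. cball x r)"
    then obtain x where "x \<in> K" "dist x z \<le> r" by auto
    then have "z = x + (z - x) \<and> x \<in> K \<and> z - x \<in> cball 0 r"
      by (simp add: dist_norm norm_minus_commute)
    then show "z \<in> {x + y | x y. x \<in> K \<and> y \<in> cball 0 r}" by blast
  next
    fix z assume "z \<in> {x + y | x y. x \<in> K \<and> y \<in> cball 0 r}"
    then obtain x y where "x \<in> K" "norm y \<le> r" "z = x + y" by auto
    then have "x \<in> K" "z \<in> cball x r" by (auto simp: dist_norm)
    then show "z \<in> (\<Union>x\<in>K. cball x r)" by blast
  qed
  show ?thesis
  proof (rule that)
    show "compact (\<Union>x\<in>K. cball x r)"
      unfolding eq using assms(1) by (intro compact_sums) auto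
  qed (use r in auto)
qed

lemma C1_cI:
  fixes \<phi> :: "real^'n \<Rightarrow> 'b::euclidean_space"
  assumes der: "\<And>x. (\<phi> has_derivative \<phi>' x) (at x)" and cont: "\<And>w. continuous_on UNIV (\<lambda>x. \<phi>' x w)"
    and K: "compact K" "K \<subseteq> S" "\<And>x. x \<notin> K \<Longrightarrow> \<phi> x = 0"
  shows "\<phi> \<in> C1_c S"
proof -
  have "closure {x. \<phi> x \<noteq> 0} \<subseteq> K"
    using K by (intro closure_minimal compact_imp_closed) auto
  moreover have "frechet_derivative \<phi> (at x) = \<phi>' x" for x
    using frechet_derivative_at[OF der] by simp
  moreover from calculation(1) have "compact (closure {x. \<phi> x \<noteq> 0})"
    using K(1) compact_Int_closed[OF K(1) closed_closure] by (metis Int_absorb1)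
  ultimately show ?thesis
    unfolding C1_c_def using der cont K(2) by (auto simp: differentiable_def)
qed

lemma C1_cD:
  assumes "\<phi> \<in> C1_c S"
  shows "(\<phi> has_derivative frechet_derivative \<phi> (at x)) (at x)"
    and "continuous_on UNIV (\<lambda>x. frechet_derivative \<phi> (at x) w)"
    and "continuous_on UNIV \<phi>"
proof -
  show D: "(\<phi> has_derivative frechet_derivative \<phi> (at x)) (at x)" for x
    using assms unfolding C1_c_def by (simp add: frechet_derivative_works)
  show "continuous_on UNIV (\<lambda>x. frechet_derivative \<phi> (at x) w)"
    using assms unfolding C1_c_def by simp
  show "continuous_on UNIV \<phi>"
    by (intro continuous_at_imp_continuous_on ballI has_derivative_continuous[OF D])
qed

lemma C1_c_support:
  assumes "\<phi> \<in> C1_c S"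
  obtains K where "compact K" "K \<subseteq> S" "\<And>x. x \<notin> K \<Longrightarrow> \<phi> x = 0"
    "\<And>x w. x \<notin> K \<Longrightarrow> frechet_derivative \<phi> (at x) w = 0"
proof (rule that[of "closure {x. \<phi> x \<noteq> 0}"])
  show "compact (closure {x. \<phi> x \<noteq> 0})" "closure {x. \<phi> x \<noteq> 0} \<subseteq> S"
    using assms by (auto simp: C1_c_def)
  show "\<phi> x = 0" if "x \<notin> closure {x. \<phi> x \<noteq> 0}" for x
    using that closure_subset[of "{x. \<phi> x \<noteq> 0}"] by auto
  show "frechet_derivative \<phi> (at x) w = 0" if x: "x \<notin> closure {x. \<phi> x \<noteq> 0}" for x w
  proof -
    have "(\<phi> has_derivative (\<lambda>_. 0)) (at x)"
    proof (rule has_derivative_transform_within_open[where f = "\<lambda>_. 0" and s = "- closure {x. \<phi> x \<noteq> 0}"])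
      show "0 = \<phi> y" if "y \<in> - closure {x. \<phi> x \<noteq> 0}" for y
        using that closure_subset[of "{x. \<phi> x \<noteq> 0}"] by auto
    qed (use x in auto)
    then have "frechet_derivative \<phi> (at x) = (\<lambda>_. 0)"
      by (rule frechet_derivative_at[symmetric])
    then show ?thesis by simp
  qed
qed

lemma reflected_mollifier_C1_c:
  fixes x :: "real^'n"
  assumes "0 < e" "cball x e \<subseteq> S"
  shows "(\<lambda>y. mollifier e (x - y)) \<in> C1_c S"
    and "frechet_derivative (\<lambda>y. mollifier e (x - y)) (at y) w = - (mollifier_grad e (x - y) \<bullet> w)"
proof -
  have D: "((\<lambda>y. mollifier e (x - y)) has_derivative (\<lambda>h. - (mollifier_grad e (x - y) \<bullet> h))) (at y)" for y
  proof -
    have "((\<lambda>y. x - y) has_derivative (\<lambda>h. - h)) (at y)" by (auto intro!: derivative_eq_intros)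
    then have "((mollifier e) \<circ> (\<lambda>y. x - y) has_derivative (\<lambda>h. mollifier_grad e (x - y) \<bullet> h) \<circ> (\<lambda>h. - h)) (at y)"
      by (rule diff_chain_at) (rule mollifier_has_derivative)
    then show ?thesis by (simp add: o_def)
  qed
  show "frechet_derivative (\<lambda>y. mollifier e (x - y)) (at y) w = - (mollifier_grad e (x - y) \<bullet> w)"
    by (simp flip: frechet_derivative_at[OF D])
  show "(\<lambda>y. mollifier e (x - y)) \<in> C1_c S"
  proof (rule C1_cI[OF D])
    show "continuous_on UNIV (\<lambda>y. - (mollifier_grad e (x - y) \<bullet> w))" for w
      by (intro continuous_intros continuous_on_compose2[OF continuous_on_mollifier(2)]) auto
    show "mollifier e (x - y) = 0" if "y \<notin> cball x e" for y
      using that assms(1) by (intro mollifier_eq_0) (auto simp: dist_norm)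
  qed (use assms in auto)
qed

lemma Lp_1_iff: "f \<in> Lp 1 K \<longleftrightarrow> integrable (lebesgue_on K) f"
  unfolding Lp_def by (auto simp: integrable_norm_iff)

lemma integrable_Lp_loc_mult:
  fixes f \<phi> :: "real^'n \<Rightarrow> real"
  assumes f: "f \<in> Lp_loc 1 S" and S: "open S" and K: "compact K" "K \<subseteq> S"
    and \<phi>: "continuous_on UNIV \<phi>" "\<And>x. x \<notin> K \<Longrightarrow> \<phi> x = 0"
  shows "integrable (lebesgue_on S) (\<lambda>x. f x * \<phi> x)"
proof -
  have Kl: "K \<in> sets lebesgue" using K by (auto simp: borel_compact)
  have "integrable (lebesgue_on K) f" using f K by (simp add: Lp_loc_def flip: Lp_1_iff One_nat_def)
  then have I: "integrable lebesgue (\<lambda>x. indicator K x *\<^sub>R f x)"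
    using Kl by (simp add: integrable_restrict_space)
  have "compact (\<phi> ` K)" using \<phi> K by (intro compact_continuous_image) (auto intro: continuous_on_subset)
  then obtain B where B: "\<And>x. x \<in> K \<Longrightarrow> \<bar>\<phi> x\<bar> \<le> B"
    by (meson bounded_real compact_imp_bounded imageI)
  have m: "\<phi> \<in> borel_measurable lebesgue"
    using \<phi>(1) borel_measurable_continuous_onI by (intro measurable_completion) auto
  have "integrable lebesgue (\<lambda>x. (indicator K x *\<^sub>R f x) * \<phi> x)"
  proof (rule Bochner_Integration.integrable_bound)
    show "integrable lebesgue (\<lambda>x. (indicator K x *\<^sub>R f x) * B)" using I by simp
    show "(\<lambda>x. (indicator K x *\<^sub>R f x) * \<phi> x) \<in> borel_measurable lebesgue"
      using I m by (intro borel_measurable_times) auto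
    have "\<bar>f x\<bar> * \<bar>\<phi> x\<bar> \<le> \<bar>f x\<bar> * \<bar>B\<bar>" if "x \<in> K" for x
      using B[OF that] by (intro mult_left_mono) auto
    then show "AE x in lebesgue. norm ((indicator K x *\<^sub>R f x) * \<phi> x) \<le> norm ((indicator K x *\<^sub>R f x) * B)"
      by (intro AE_I2) (simp add: indicator_def abs_mult)
  qed
  moreover have "(\<lambda>x. (indicator K x *\<^sub>R f x) * \<phi> x) = (\<lambda>x. indicator S x *\<^sub>R (f x * \<phi> x))"
    using K \<phi> by (auto simp: indicator_def fun_eq_iff)
  ultimately show ?thesis using S by (simp add: integrable_restrict_space)
qed

text \<open>The reflected mollifier centred at a point \<open>x\<close> of a compact subset is a test function, so
orthogonality says that the mollified function vanishes at \<open>x\<close>. It also converges to \<open>g\<close> in \<open>L\<^sup>1\<close>.\<close>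
lemma AE_eq_0_if_orthogonal_to_C1_c:
  fixes g :: "real^'n \<Rightarrow> real"
  assumes S: "open S" and g: "g \<in> Lp_loc 1 S"
    and orth: "\<And>\<phi>. \<phi> \<in> C1_c S \<Longrightarrow> (LINT x|lebesgue_on S. g x * \<phi> x) = 0"
  shows "AE x in lebesgue_on S. g x = 0"
proof -
  have Sl: "S \<in> sets lebesgue" using S by auto
  have local: "AE x in lborel. x \<in> K \<longrightarrow> g x = 0" if K: "compact K" "K \<subseteq> S" for K
  proof -
    obtain r K' where r: "0 < r" and K': "compact K'" "K' \<subseteq> S" "\<And>x. x \<in> K \<Longrightarrow> cball x r \<subseteq> K'"
      using compact_neighbourhood[OF K(1) S K(2)] by blast
    have "integrable (lebesgue_on K') g" using g K' by (simp add: Lp_loc_def flip: Lp_1_iff One_nat_def)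
    then obtain g' where g': "g' \<in> borel_measurable borel" "\<And>x. x \<notin> K' \<Longrightarrow> g' x = 0"
      and ae: "AE x in lborel. g' x = indicator K' x *\<^sub>R g x"
      using borel_representative[OF K'(1)] by blast
    have gi: "integrable lborel g'"
      using integral_lebesgue_on_eq(1)[OF _ g'(1), of K' g] ae K'(1) \<open>integrable (lebesgue_on K') g\<close>
      by (auto simp: borel_compact eq_commute)
    then have gp: "integrable lborel (\<lambda>x. norm (g' x) ^ Suc 0)" by simp
    obtain b where b: "\<And>x. x \<in> K' \<Longrightarrow> norm x \<le> b"
      using compact_imp_bounded[OF K'(1)] bounded_iff by blast
    have gs: "g' x = 0" if "b < norm x" for x
      using b[of x] that by (intro g'(2)) auto
    have zero: "conv (mollifier e) g' x = 0" if x: "x \<in> K" and e: "0 < e" "e < r" for x e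
    proof -
      have sub: "cball x e \<subseteq> K'" using K'(3)[OF x] subset_cball[of e r x] e by auto
      have "0 = (LINT y|lebesgue_on S. g y * mollifier e (x - y))"
        using reflected_mollifier_C1_c(1)[of e x S] sub K'(2) e orth by auto
      also have "\<dots> = (LINT y|lborel. mollifier e (x - y) * g' y)"
      proof (rule integral_lebesgue_on_eq[OF Sl])
        have "(\<lambda>y. mollifier e (x - y)) \<in> borel_measurable borel"
          by (intro borel_measurable_continuous_onI continuous_on_compose2[OF continuous_on_mollifier(1)] continuous_intros) auto
        then show "(\<lambda>y. mollifier e (x - y) * g' y) \<in> borel_measurable borel" using g' by simp
        show "AE y in lborel. indicator S y *\<^sub>R (g y * mollifier e (x - y)) = mollifier e (x - y) * g' y"
          using ae
        proof eventually_elim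
          case (elim y)
          show ?case
          proof (cases "y \<in> K'")
            case True
            then show ?thesis using elim K'(2) by auto
          next
            case False
            then have "y \<notin> cball x e" using sub by blast
            then have "mollifier e (x - y) = 0"
              using e by (intro mollifier_eq_0) (auto simp: dist_norm)
            then show ?thesis by simp
          qed
        qed
      qed
      finally show ?thesis by (simp add: conv_def)
    qed
    have Kb: "K \<in> sets borel" using K by (simp add: borel_compact)
    have intK: "integrable lborel (\<lambda>x. indicator K x * \<bar>g' x\<bar>)"
      using gi Kb by (intro integrable_mult_indicator[where f = "\<lambda>x. \<bar>g' x\<bar>", simplified]) auto
    have "(LINT x|lborel. indicator K x * \<bar>g' x\<bar>) \<le> d" if d: "0 < d" for d :: real
    proof -
      obtain e0 where "0 < e0" and e0: "\<And>e. \<lbrakk>0 < e; e < e0\<rbrakk> \<Longrightarrow>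
           integrable lborel (\<lambda>x. norm (conv (mollifier e) g' x - g' x) ^ Suc 0)
           \<and> (LINT x|lborel. norm (conv (mollifier e) g' x - g' x) ^ Suc 0) < d"
        using conv_mollifier_tendsto_Lp[OF _ gp gs d] g'(1) by auto
      define e where "e = min e0 r / 2"
      have e: "0 < e" "e < e0" "e < r" using \<open>0 < e0\<close> r by (auto simp: e_def)
      have "(LINT x|lborel. indicator K x * \<bar>g' x\<bar>)
          \<le> (LINT x|lborel. norm (conv (mollifier e) g' x - g' x) ^ Suc 0)"
      proof (rule integral_mono[OF intK])
        show "indicator K x * \<bar>g' x\<bar> \<le> norm (conv (mollifier e) g' x - g' x) ^ Suc 0" for x
          using zero[of x e] e by (cases "x \<in> K") auto
      qed (use e0[OF e(1,2)] in blast)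
      then show ?thesis using e0[OF e(1,2)] by linarith
    qed
    then have "(LINT x|lborel. indicator K x * \<bar>g' x\<bar>) \<le> 0"
      by (rule field_le_epsilon[where y = 0, simplified])
    moreover have "0 \<le> (LINT x|lborel. indicator K x * \<bar>g' x\<bar>)"
      by (rule Bochner_Integration.integral_nonneg) simp
    ultimately have "AE x in lborel. indicator K x * \<bar>g' x\<bar> = 0"
      using integral_nonneg_eq_0_iff_AE[OF intK] by simp
    with ae show ?thesis
    proof eventually_elim
      case (elim x)
      show ?case
      proof
        assume "x \<in> K"
        then have "x \<in> K'" using K'(3)[of x] r by auto
        then show "g x = 0" using elim \<open>x \<in> K\<close> by simp
      qed
    qed
  qed
  obtain C where C: "\<And>n::nat. compact (C n)" "\<And>n. C n \<subseteq> S" "\<Union> (range C) = S"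
    using open_Union_compact_subsets[OF S] by metis
  have "AE x in lborel. \<forall>n. x \<in> C n \<longrightarrow> g x = 0"
    unfolding AE_all_countable using local[OF C(1,2)] by blast
  then have "AE x in lborel. x \<in> S \<longrightarrow> g x = 0"
    by eventually_elim (use C(3) in blast)
  then have "AE x in lebesgue. x \<in> S \<longrightarrow> g x = 0" by (rule AE_completion)
  then show ?thesis using Sl by (simp add: AE_restrict_space_iff)
qed

section \<open>Weak Jacobians\<close>

lemma integral_frechet_derivative_eq_0:
  fixes k :: "real^'n \<Rightarrow> real"
  assumes k: "k \<in> C1_c UNIV"
  shows "(LINT y|lborel. frechet_derivative k (at y) w) = 0"
proof -
  obtain K where K: "compact K" "\<And>x. x \<notin> K \<Longrightarrow> k x = 0"
    "\<And>x w. x \<notin> K \<Longrightarrow> frechet_derivative k (at x) w = 0"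
    using C1_c_support[OF k] by metis
  obtain R where R: "\<And>x. x \<in> K \<Longrightarrow> norm x \<le> R"
    using compact_imp_bounded[OF K(1)] bounded_iff by blast
  have out: "x \<notin> K" if "R < norm x" for x using R[of x] that by auto
  define G where "G z = (\<Sum>b\<in>Basis. frechet_derivative k (at z) b *\<^sub>R b)" for z
  have G: "frechet_derivative k (at z) h = G z \<bullet> h" for z h
  proof -
    \<comment> \<open>The gradient of \<open>k\<close>, defined through its coordinates, represents the derivative.\<close>
    have "linear (frechet_derivative k (at z))"
      using C1_cD(1)[OF k] has_derivative_linear by blast
    then have "frechet_derivative k (at z) (\<Sum>b\<in>Basis. (h \<bullet> b) *\<^sub>R b)
        = (\<Sum>b\<in>Basis. (h \<bullet> b) *\<^sub>R frechet_derivative k (at z) b)"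
      by (simp add: linear_sum linear_cmul)
    then show ?thesis
      unfolding euclidean_representation by (simp add: G_def inner_sum_left inner_commute[of h] mult.commute)
  qed
  show ?thesis
    unfolding G
  proof (rule integral_derivative_eq_0)
    show "(k has_derivative (\<lambda>h. G z \<bullet> h)) (at z)" for z
      using C1_cD(1)[OF k, of z] unfolding G[abs_def] .
    show "continuous_on UNIV G"
      unfolding G_def[abs_def] by (intro continuous_intros C1_cD(2)[OF k])
    show "k z = 0" if "R < norm z" for z using K(2)[OF out[OF that]] .
    show "G z = 0" if "R < norm z" for z using K(3)[OF out[OF that]] by (simp add: G_def)
  qed
qed

lemma jacobian_nth: "jacobian \<phi> (at x) $ i $ j = frechet_derivative \<phi> (at x) (axis j 1) $ i"
  by (simp add: jacobian_def matrix_def)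

lemma continuous_on_jacobian:
  fixes \<phi> :: "real^'n \<Rightarrow> real^'m"
  assumes "\<phi> \<in> C1_c S"
  shows "continuous_on UNIV (\<lambda>x. jacobian \<phi> (at x))"
proof -
  have "continuous_on UNIV (\<lambda>x. \<chi> i j. frechet_derivative \<phi> (at x) (axis j 1) $ i)"
    by (intro continuous_intros C1_cD(2)[OF assms])
  moreover have "jacobian \<phi> (at x) = (\<chi> i j. frechet_derivative \<phi> (at x) (axis j 1) $ i)" for x
    by (simp add: vec_eq_iff jacobian_nth)
  ultimately show ?thesis by simp
qed

lemma continuous_in_Lp_loc:
  fixes f :: "real^'n \<Rightarrow> 'b::euclidean_space"
  assumes "continuous_on UNIV f"
  shows "f \<in> Lp_loc p S"
  unfolding Lp_loc_def Lp_def
proof (intro CollectI allI impI conjI; elim conjE)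
  fix K :: "(real^'n) set" assume K: "compact K"
  have Kb: "K \<in> sets borel" using K by (simp add: borel_compact)
  have fb: "f \<in> borel_measurable borel" using assms by (rule borel_measurable_continuous_onI)
  then show "f \<in> borel_measurable (lebesgue_on K)"
    by (intro measurable_restrict_space1 measurable_completion) simp
  have "integrable lborel (\<lambda>x. indicator K x *\<^sub>R norm (f x) ^ p)"
    using K assms by (intro borel_integrable_compact continuous_intros) (auto intro: continuous_on_subset)
  then show "integrable (lebesgue_on K) (\<lambda>x. norm (f x) ^ p)"
    using fb Kb by (subst integral_lebesgue_on_eq(1)[where F' = "\<lambda>x. indicator K x *\<^sub>R norm (f x) ^ p"]) auto
qed

lemma Lp_loc_1_diff:
  fixes f g :: "real^'n \<Rightarrow> 'b::euclidean_space"
  assumes "f \<in> Lp_loc 1 S" "g \<in> Lp_loc 1 S"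
  shows "(\<lambda>x. f x - g x) \<in> Lp_loc 1 S"
  using assms unfolding Lp_loc_def Lp_1_iff by auto

lemma Lp_loc_1_bounded_linear:
  fixes f :: "real^'n \<Rightarrow> 'b::euclidean_space" and T :: "'b \<Rightarrow> 'c::euclidean_space"
  assumes "f \<in> Lp_loc 1 S" "bounded_linear T"
  shows "(\<lambda>x. T (f x)) \<in> Lp_loc 1 S"
  using assms integrable_bounded_linear unfolding Lp_loc_def Lp_1_iff by blast

lemma borel_measurable_nth:
  fixes f :: "'a \<Rightarrow> 'b::euclidean_space^'m"
  assumes "f \<in> borel_measurable M" shows "(\<lambda>x. f x $ i) \<in> borel_measurable M"
  by (rule measurable_compose[OF assms]) (intro borel_measurable_continuous_onI continuous_intros)

lemma Lp_loc_1_nth: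
  fixes f :: "real^'n \<Rightarrow> real^'m"
  assumes "f \<in> Lp_loc 1 S" shows "(\<lambda>x. f x $ i) \<in> Lp_loc 1 S"
  by (rule Lp_loc_1_bounded_linear[OF assms bounded_linear_vec_nth])

lemma Lp_loc_1_nth_nth:
  fixes f :: "real^'n \<Rightarrow> real^'k^'m"
  assumes "f \<in> Lp_loc 1 S" shows "(\<lambda>x. f x $ i $ j) \<in> Lp_loc 1 S"
  by (rule Lp_loc_1_bounded_linear[OF assms]) (intro bounded_linear_compose[OF bounded_linear_vec_nth bounded_linear_vec_nth])

lemma has_weak_jacobian_integrable:
  fixes u :: "real^'n \<Rightarrow> real^'m" and \<phi> :: "real^'n \<Rightarrow> real"
  assumes S: "open S" and u: "has_weak_jacobian S u U" and \<phi>: "\<phi> \<in> C1_c S"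
  shows "integrable (lebesgue_on S) (\<lambda>x. u x $ i * frechet_derivative \<phi> (at x) w)"
    and "integrable (lebesgue_on S) (\<lambda>x. U x $ i $ j * \<phi> x)"
proof -
  obtain K where K: "compact K" "K \<subseteq> S" "\<And>x. x \<notin> K \<Longrightarrow> \<phi> x = 0"
    "\<And>x w. x \<notin> K \<Longrightarrow> frechet_derivative \<phi> (at x) w = 0"
    using C1_c_support[OF \<phi>] by metis
  show "integrable (lebesgue_on S) (\<lambda>x. u x $ i * frechet_derivative \<phi> (at x) w)"
    by (rule integrable_Lp_loc_mult[OF Lp_loc_1_nth S K(1,2) C1_cD(2)[OF \<phi>] K(4)])
       (use u in \<open>simp_all add: has_weak_jacobian_def\<close>)
  show "integrable (lebesgue_on S) (\<lambda>x. U x $ i $ j * \<phi> x)"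
    by (rule integrable_Lp_loc_mult[OF Lp_loc_1_nth_nth S K(1,2) C1_cD(3)[OF \<phi>] K(3)])
       (use u in \<open>simp_all add: has_weak_jacobian_def\<close>)
qed

text \<open>The constant \<open>weak_jacobian\<close> is a choice among all weak Jacobians; uniqueness up to null sets
is what allows another representative to be used in its place.\<close>
lemma has_weak_jacobian_unique:
  fixes u :: "real^'n \<Rightarrow> real^'m"
  assumes S: "open S" and U: "has_weak_jacobian S u U" and U': "has_weak_jacobian S u U'"
  shows "AE x in lebesgue_on S. U x = U' x"
proof -
  have "AE x in lebesgue_on S. U x $ i $ j - U' x $ i $ j = 0" for i j
  proof (rule AE_eq_0_if_orthogonal_to_C1_c[OF S])
    show "(\<lambda>x. U x $ i $ j - U' x $ i $ j) \<in> Lp_loc 1 S"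
      using U U' by (intro Lp_loc_1_diff Lp_loc_1_nth_nth) (auto simp: has_weak_jacobian_def)
    fix \<phi> :: "real^'n \<Rightarrow> real" assume \<phi>: "\<phi> \<in> C1_c S"
    have "(LINT x|lebesgue_on S. (U x $ i $ j - U' x $ i $ j) * \<phi> x)
        = (LINT x|lebesgue_on S. U x $ i $ j * \<phi> x) - (LINT x|lebesgue_on S. U' x $ i $ j * \<phi> x)"
      using has_weak_jacobian_integrable(2)[OF S U \<phi>] has_weak_jacobian_integrable(2)[OF S U' \<phi>]
      by (simp add: left_diff_distrib)
    also have "\<dots> = 0"
    proof -
      have "(LINT x|lebesgue_on S. u x $ i * frechet_derivative \<phi> (at x) (axis j 1))
          = - (LINT x|lebesgue_on S. U x $ i $ j * \<phi> x)"
        "(LINT x|lebesgue_on S. u x $ i * frechet_derivative \<phi> (at x) (axis j 1))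
          = - (LINT x|lebesgue_on S. U' x $ i $ j * \<phi> x)"
        using U U' \<phi> unfolding has_weak_jacobian_def by blast+
      then show ?thesis by linarith
    qed
    finally show "(LINT x|lebesgue_on S. (U x $ i $ j - U' x $ i $ j) * \<phi> x) = 0" .
  qed
  then have "AE x in lebesgue_on S. \<forall>j\<in>UNIV. U x $ i $ j - U' x $ i $ j = 0" for i
    by (rule AE_finite_allI[OF finite])
  then have "AE x in lebesgue_on S. \<forall>i\<in>UNIV. \<forall>j\<in>UNIV. U x $ i $ j - U' x $ i $ j = 0"
    by (rule AE_finite_allI[OF finite])
  then show ?thesis by eventually_elim (simp add: vec_eq_iff)
qed

lemma has_weak_jacobian_diff:
  fixes u v :: "real^'n \<Rightarrow> real^'m"
  assumes S: "open S" and u: "has_weak_jacobian S u U" and v: "has_weak_jacobian S v V"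
  shows "has_weak_jacobian S (\<lambda>x. u x - v x) (\<lambda>x. U x - V x)"
  unfolding has_weak_jacobian_def
proof (intro conjI allI impI)
  show "(\<lambda>x. u x - v x) \<in> Lp_loc 1 S" "(\<lambda>x. U x - V x) \<in> Lp_loc 1 S"
    using u v by (auto simp: has_weak_jacobian_def simp del: One_nat_def intro!: Lp_loc_1_diff)
  fix \<phi> :: "real^'n \<Rightarrow> real" and i j assume \<phi>: "\<phi> \<in> C1_c S"
  note I = has_weak_jacobian_integrable[OF S u \<phi>] has_weak_jacobian_integrable[OF S v \<phi>]
  have "(LINT x|lebesgue_on S. u x $ i * frechet_derivative \<phi> (at x) (axis j 1))
      = - (LINT x|lebesgue_on S. U x $ i $ j * \<phi> x)"
    "(LINT x|lebesgue_on S. v x $ i * frechet_derivative \<phi> (at x) (axis j 1))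
      = - (LINT x|lebesgue_on S. V x $ i $ j * \<phi> x)"
    using u v \<phi> unfolding has_weak_jacobian_def by blast+
  then show "(LINT x|lebesgue_on S. (u x - v x) $ i * frechet_derivative \<phi> (at x) (axis j 1))
      = - (LINT x|lebesgue_on S. (U x - V x) $ i $ j * \<phi> x)"
    using I by (simp add: left_diff_distrib)
qed

lemma integral_lebesgue_on_subset:
  fixes F :: "'a::euclidean_space \<Rightarrow> 'b::euclidean_space"
  assumes "T \<subseteq> S" "T \<in> sets lebesgue" "S \<in> sets lebesgue" "\<And>x. x \<notin> T \<Longrightarrow> F x = 0"
  shows "(LINT x|lebesgue_on T. F x) = (LINT x|lebesgue_on S. F x)"
proof -
  have "(\<lambda>x. indicator T x *\<^sub>R F x) = (\<lambda>x. indicator S x *\<^sub>R F x)"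
    using assms by (auto simp: indicator_def fun_eq_iff)
  then show ?thesis using assms by (simp add: integral_restrict_space)
qed

lemma C1_c_mono: "T \<subseteq> S \<Longrightarrow> \<phi> \<in> C1_c T \<Longrightarrow> \<phi> \<in> C1_c S"
  by (auto simp: C1_c_def)

lemma has_weak_jacobian_subset:
  fixes u :: "real^'n \<Rightarrow> real^'m"
  assumes T: "open T" "T \<subseteq> S" and S: "open S" and u: "has_weak_jacobian S u U"
  shows "has_weak_jacobian T u U"
  unfolding has_weak_jacobian_def
proof (intro conjI allI impI)
  show "u \<in> Lp_loc 1 T" "U \<in> Lp_loc 1 T"
    using u T by (auto simp: has_weak_jacobian_def Lp_loc_def)
  fix \<phi> :: "real^'n \<Rightarrow> real" and i j assume \<phi>: "\<phi> \<in> C1_c T"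
  obtain K where K: "compact K" "K \<subseteq> T" "\<And>x. x \<notin> K \<Longrightarrow> \<phi> x = 0"
    "\<And>x w. x \<notin> K \<Longrightarrow> frechet_derivative \<phi> (at x) w = 0"
    using C1_c_support[OF \<phi>] by metis
  have L: "T \<in> sets lebesgue" "S \<in> sets lebesgue" using T S by auto
  have "(LINT x|lebesgue_on T. u x $ i * frechet_derivative \<phi> (at x) (axis j 1))
      = (LINT x|lebesgue_on S. u x $ i * frechet_derivative \<phi> (at x) (axis j 1))"
    using K by (intro integral_lebesgue_on_subset T L) auto
  also have "\<dots> = - (LINT x|lebesgue_on S. U x $ i $ j * \<phi> x)"
    using u C1_c_mono[OF T(2) \<phi>] unfolding has_weak_jacobian_def by blast
  also have "(LINT x|lebesgue_on S. U x $ i $ j * \<phi> x) = (LINT x|lebesgue_on T. U x $ i $ j * \<phi> x)"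
    using K by (intro integral_lebesgue_on_subset[symmetric] T L) auto
  finally show "(LINT x|lebesgue_on T. u x $ i * frechet_derivative \<phi> (at x) (axis j 1))
      = - (LINT x|lebesgue_on T. U x $ i $ j * \<phi> x)" .
qed

text \<open>Integration by parts: the product of \<open>u $ i\<close> with a test function is compactly supported, so its
derivatives have integral zero.\<close>
lemma has_weak_jacobian_C1_c:
  fixes u :: "real^'n \<Rightarrow> real^'m"
  assumes S: "open S" and u: "u \<in> C1_c S"
  shows "has_weak_jacobian S u (\<lambda>x. jacobian u (at x))"
  unfolding has_weak_jacobian_def
proof (intro conjI allI impI)
  show "u \<in> Lp_loc 1 S" "(\<lambda>x. jacobian u (at x)) \<in> Lp_loc 1 S"
    by (rule continuous_in_Lp_loc C1_cD(3)[OF u] continuous_on_jacobian[OF u])+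
  fix \<phi> :: "real^'n \<Rightarrow> real" and i j assume \<phi>: "\<phi> \<in> C1_c S"
  obtain K where K: "compact K" "K \<subseteq> S" "\<And>x. x \<notin> K \<Longrightarrow> \<phi> x = 0"
    "\<And>x w. x \<notin> K \<Longrightarrow> frechet_derivative \<phi> (at x) w = 0"
    using C1_c_support[OF \<phi>] by metis
  obtain R where R: "\<And>x. x \<in> K \<Longrightarrow> norm x \<le> R"
    using compact_imp_bounded[OF K(1)] bounded_iff by blast
  have out: "x \<notin> K" if "R < norm x" for x using R[of x] that by auto
  have Sl: "S \<in> sets lebesgue" using S by auto
  let ?a = "\<lambda>x. u x $ i * frechet_derivative \<phi> (at x) (axis j 1)"
  let ?b = "\<lambda>x. jacobian u (at x) $ i $ j * \<phi> x"
  have ca: "continuous_on UNIV ?a"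
    by (intro continuous_intros C1_cD[OF u] C1_cD[OF \<phi>])
  have cb: "continuous_on UNIV ?b"
    by (intro continuous_intros continuous_on_jacobian[OF u] C1_cD[OF \<phi>])
  have Ia: "integrable lborel ?a" and Ib: "integrable lborel ?b"
    using K out by (auto intro!: integrable_continuous_compact_support[OF ca, of R] integrable_continuous_compact_support[OF cb, of R])
  have D: "((\<lambda>x. u x $ i * \<phi> x) has_derivative
      (\<lambda>h. u x $ i * frechet_derivative \<phi> (at x) h + frechet_derivative u (at x) h $ i * \<phi> x)) (at x)" for x
    by (intro has_derivative_mult C1_cD(1)[OF \<phi>] bounded_linear.has_derivative[OF bounded_linear_vec_nth C1_cD(1)[OF u]])
  have "(\<lambda>x. u x $ i * \<phi> x) \<in> C1_c UNIV"
    by (rule C1_cI[OF D _ K(1)]) (use K in \<open>auto intro!: continuous_intros C1_cD[OF u] C1_cD[OF \<phi>]\<close>)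
  from integral_frechet_derivative_eq_0[OF this, of "axis j 1"]
  have "(LINT x|lborel. ?a x + ?b x) = 0"
    by (simp add: jacobian_nth flip: frechet_derivative_at[OF D])
  then have "(LINT x|lborel. ?a x) = - (LINT x|lborel. ?b x)"
    using Ia Ib by simp
  moreover have "(LINT x|lebesgue_on S. ?a x) = (LINT x|lborel. ?a x)"
    using K by (intro integral_lebesgue_on_eq Sl borel_measurable_continuous_onI ca AE_I2) (auto simp: indicator_def)
  moreover have "(LINT x|lebesgue_on S. ?b x) = (LINT x|lborel. ?b x)"
    using K by (intro integral_lebesgue_on_eq Sl borel_measurable_continuous_onI cb AE_I2) (auto simp: indicator_def)
  ultimately show "(LINT x|lebesgue_on S. ?a x) = - (LINT x|lebesgue_on S. ?b x)" by simp
qed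

text \<open>Mollification commutes with weak differentiation at points whose \<open>e\<close>-ball stays in \<open>K\<close>: this
is the definition of the weak Jacobian for the test function \<open>y \<mapsto> mollifier e (x - y)\<close>. The functions
\<open>u'\<close> and \<open>U'\<close> are Borel representatives on \<open>K\<close>.\<close>
lemma mollified_weak_jacobian:
  fixes u :: "real^'n \<Rightarrow> real^'m"
  assumes S: "open S" and u: "has_weak_jacobian S u U" and K: "K \<subseteq> S" "cball x e \<subseteq> K" and e: "0 < e"
    and u': "u' \<in> borel_measurable borel" "AE y in lborel. u' y = indicator K y *\<^sub>R u y"
    and U': "U' \<in> borel_measurable borel" "AE y in lborel. U' y = indicator K y *\<^sub>R U y"
  shows "conv (\<lambda>z. mollifier_grad e z \<bullet> axis j 1) (\<lambda>y. u' y $ i) x = conv (mollifier e) (\<lambda>y. U' y $ i $ j) x"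
proof -
  have Sl: "S \<in> sets lebesgue" using S by auto
  have xe: "cball x e \<subseteq> S" using K by auto
  define \<phi> where "\<phi> y = mollifier e (x - y)" for y
  have \<phi>: "\<phi> \<in> C1_c S"
    and D: "frechet_derivative \<phi> (at y) w = - (mollifier_grad e (x - y) \<bullet> w)" for y w
    unfolding \<phi>_def[abs_def] by (rule reflected_mollifier_C1_c[OF e xe])+
  have zero: "mollifier e (x - y) = 0" "mollifier_grad e (x - y) = 0" if "y \<notin> K" for y
  proof -
    have "y \<notin> cball x e" using that K by blast
    then have "e < norm (x - y)" by (simp add: dist_norm)
    then show "mollifier e (x - y) = 0" "mollifier_grad e (x - y) = 0"
      using e by (auto intro!: mollifier_eq_0)
  qed
  have m: "(\<lambda>y. mollifier e (x - y)) \<in> borel_measurable borel"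
    "(\<lambda>y. mollifier_grad e (x - y) \<bullet> axis j 1) \<in> borel_measurable borel"
    by (intro borel_measurable_continuous_onI continuous_intros
        continuous_on_compose2[OF continuous_on_mollifier(1)] continuous_on_compose2[OF continuous_on_mollifier(2)]; auto)+
  have [measurable]: "(\<lambda>y. u' y $ i) \<in> borel_measurable borel" "(\<lambda>y. U' y $ i $ j) \<in> borel_measurable borel"
    using u'(1) U'(1) by (auto intro: borel_measurable_nth)
  have "(LINT y|lebesgue_on S. u y $ i * frechet_derivative \<phi> (at y) (axis j 1))
      = (LINT y|lborel. - ((mollifier_grad e (x - y) \<bullet> axis j 1) * u' y $ i))"
  proof (rule integral_lebesgue_on_eq[OF Sl])
    show "(\<lambda>y. - ((mollifier_grad e (x - y) \<bullet> axis j 1) * u' y $ i)) \<in> borel_measurable borel"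
      using m by measurable
    show "AE y in lborel. indicator S y *\<^sub>R (u y $ i * frechet_derivative \<phi> (at y) (axis j 1))
        = - ((mollifier_grad e (x - y) \<bullet> axis j 1) * u' y $ i)"
      using u'(2)
    proof eventually_elim
      case (elim y)
      show ?case
        using elim K(1) zero[of y] by (cases "y \<in> K") (auto simp: D indicator_def)
    qed
  qed
  moreover have "(LINT y|lebesgue_on S. U y $ i $ j * \<phi> y) = (LINT y|lborel. mollifier e (x - y) * U' y $ i $ j)"
  proof (rule integral_lebesgue_on_eq[OF Sl])
    show "(\<lambda>y. mollifier e (x - y) * U' y $ i $ j) \<in> borel_measurable borel"
      using m by measurable
    show "AE y in lborel. indicator S y *\<^sub>R (U y $ i $ j * \<phi> y) = mollifier e (x - y) * U' y $ i $ j"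
      using U'(2)
    proof eventually_elim
      case (elim y)
      show ?case
        using elim K(1) zero[of y] by (cases "y \<in> K") (auto simp: \<phi>_def indicator_def)
    qed
  qed
  moreover have "(LINT y|lebesgue_on S. u y $ i * frechet_derivative \<phi> (at y) (axis j 1))
      = - (LINT y|lebesgue_on S. U y $ i $ j * \<phi> y)"
    using u \<phi> unfolding has_weak_jacobian_def by blast
  ultimately show ?thesis by (simp add: conv_def)
qed

section \<open>The determinant is a null Lagrangian\<close>

lemma continuous_on_det: "continuous_on S (det :: real^'n^'n \<Rightarrow> real)"
  unfolding det_def[abs_def] by (intro continuous_intros)

lemma det_scaleR: "det (t *\<^sub>R A) = t ^ CARD('n) * det (A :: real^'n^'n)"
  unfolding det_def by (simp add: prod.distrib sum_distrib_left mult_ac)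

text \<open>The determinant is homogeneous of degree \<open>CARD('n)\<close> and bounded on the unit ball.\<close>
lemma det_le_norm_power:
  obtains M where "0 \<le> M" "\<And>A :: real^'n^'n. \<bar>det A\<bar> \<le> M * norm A ^ CARD('n)"
proof -
  have "compact (det ` cball (0::real^'n^'n) 1)"
    by (intro compact_continuous_image continuous_on_det compact_cball)
  then obtain M where M: "\<And>A :: real^'n^'n. A \<in> cball 0 1 \<Longrightarrow> \<bar>det A\<bar> \<le> M"
    by (meson bounded_real compact_imp_bounded imageI)
  have "0 \<le> M" using M[of 0] by simp
  moreover have "\<bar>det A\<bar> \<le> M * norm A ^ CARD('n)" for A :: "real^'n^'n"
  proof (cases "A = 0")
    case True
    have "det (0 *\<^sub>R A) = 0" unfolding det_scaleR by (simp add: zero_power)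
    then show ?thesis using True \<open>0 \<le> M\<close> by simp
  next
    case False
    have "det A = det (norm A *\<^sub>R (A /\<^sub>R norm A))" using False by simp
    also have "\<dots> = norm A ^ CARD('n) * det (A /\<^sub>R norm A)" by (rule det_scaleR)
    finally have "\<bar>det A\<bar> = norm A ^ CARD('n) * \<bar>det (A /\<^sub>R norm A)\<bar>" by (simp add: abs_mult)
    also have "\<dots> \<le> norm A ^ CARD('n) * M" using False by (intro mult_left_mono M) auto
    finally show ?thesis by (simp add: mult.commute)
  qed
  ultimately show ?thesis by (rule that)
qed

text \<open>This turns convergence of matrix fields in \<open>L\<^sup>n\<close> into convergence of the integrals of their
determinants. By homogeneity one may scale \<open>A\<close> to unit length: if \<open>B\<close> is relatively close to \<open>A\<close>,
uniform continuity gives the first term; otherwise both norms are bounded by a multiple of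
\<open>norm (A - B)\<close>, which gives the second.\<close>
lemma det_diff_le:
  assumes "0 < \<epsilon>"
  obtains C where "0 \<le> C" "\<And>A B :: real^'n^'n.
    \<bar>det A - det B\<bar> \<le> \<epsilon> * norm A ^ CARD('n) + C * norm (A - B) ^ CARD('n)"
proof -
  let ?n = "CARD('n)"
  obtain M where M: "0 \<le> M" "\<And>A :: real^'n^'n. \<bar>det A\<bar> \<le> M * norm A ^ ?n"
    using det_le_norm_power[where 'n = 'n] by blast
  have "uniformly_continuous_on (cball (0::real^'n^'n) 2) det"
    by (intro compact_uniformly_continuous continuous_on_det compact_cball)
  then obtain d where "0 < d" and d: "\<And>A B :: real^'n^'n. \<lbrakk>A \<in> cball 0 2; B \<in> cball 0 2; dist B A < d\<rbrakk>
      \<Longrightarrow> dist (det B) (det A) < \<epsilon>"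
    using assms unfolding uniformly_continuous_on_def by metis
  define \<delta> where "\<delta> = min d 1"
  have \<delta>: "0 < \<delta>" "\<delta> \<le> 1" "\<delta> \<le> d" using \<open>0 < d\<close> by (auto simp: \<delta>_def)
  define C where "C = M * (1 / \<delta>) ^ ?n + M * (1 + 1 / \<delta>) ^ ?n"
  have "0 \<le> C" using M(1) \<delta> by (simp add: C_def)
  moreover have "\<bar>det A - det B\<bar> \<le> \<epsilon> * norm A ^ ?n + C * norm (A - B) ^ ?n" for A B :: "real^'n^'n"
  proof (cases "norm (A - B) < \<delta> * norm A")
    case True
    then have A: "0 < norm A" using \<delta> by (cases "A = 0") auto
    define A' where "A' = A /\<^sub>R norm A"
    define B' where "B' = B /\<^sub>R norm A"
    have AB: "A = norm A *\<^sub>R A'" "B = norm A *\<^sub>R B'" using A by (auto simp: A'_def B'_def)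
    have nA: "norm A' = 1" using A by (simp add: A'_def)
    have "A' - B' = (A - B) /\<^sub>R norm A" by (simp add: A'_def B'_def scaleR_diff_right)
    then have "norm (A' - B') = norm (A - B) / norm A" using A by (simp add: divide_inverse mult.commute)
    then have nAB: "norm (A' - B') < \<delta>" using True A by (simp add: divide_less_eq)
    have "norm B' \<le> norm A' + norm (A' - B')"
      using norm_triangle_ineq4[of A' "A' - B'"] by simp
    then have "dist (det A') (det B') < \<epsilon>"
      using nA nAB \<delta> by (intro d) (auto simp: dist_norm)
    then have "\<bar>det A' - det B'\<bar> \<le> \<epsilon>" by (simp add: dist_real_def)
    moreover have "det A = norm A ^ ?n * det A'" "det B = norm A ^ ?n * det B'"
      using arg_cong[OF AB(1), of det] arg_cong[OF AB(2), of det] unfolding det_scaleR .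
    then have "det A - det B = norm A ^ ?n * (det A' - det B')" by (simp add: right_diff_distrib)
    ultimately have "\<bar>det A - det B\<bar> \<le> norm A ^ ?n * \<epsilon>"
      by (simp add: abs_mult mult_left_mono)
    moreover have "0 \<le> C * norm (A - B) ^ ?n" using \<open>0 \<le> C\<close> by simp
    ultimately show ?thesis by (simp add: mult.commute)
  next
    case False
    then have A: "norm A \<le> 1 / \<delta> * norm (A - B)" using \<delta> by (simp add: field_simps)
    have "norm B \<le> norm A + norm (A - B)"
      using norm_triangle_ineq4[of A "A - B"] by simp
    with A have B: "norm B \<le> (1 + 1 / \<delta>) * norm (A - B)" by (simp add: distrib_right)
    have "\<bar>det A\<bar> \<le> M * (1 / \<delta> * norm (A - B)) ^ ?n"
      using A by (intro order_trans[OF M(2)] mult_left_mono power_mono M(1)) auto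
    moreover have "\<bar>det B\<bar> \<le> M * ((1 + 1 / \<delta>) * norm (A - B)) ^ ?n"
      using B by (intro order_trans[OF M(2)] mult_left_mono power_mono M(1)) auto
    ultimately have "\<bar>det A - det B\<bar> \<le> C * norm (A - B) ^ ?n"
      unfolding C_def power_mult_distrib
      using distrib_right[of "M * (1 / \<delta>) ^ ?n" "M * (1 + 1 / \<delta>) ^ ?n" "norm (A - B) ^ ?n"]
      unfolding mult.assoc by linarith
    moreover have "0 \<le> \<epsilon> * norm A ^ ?n" using assms by simp
    ultimately show ?thesis by linarith
  qed
  ultimately show ?thesis by (rule that)
qed

text \<open>Composing with the transposition reverses the sign of every summand.\<close>
lemma sum_sign_swap_invariant_eq_0:
  fixes F :: "('n::finite \<Rightarrow> 'n) \<Rightarrow> real"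
  assumes "a \<noteq> b" and F: "\<And>p. p permutes UNIV \<Longrightarrow> F (p \<circ> Transposition.transpose a b) = F p"
  shows "(\<Sum>p | p permutes UNIV. of_int (sign p) * F p) = 0"
proof -
  let ?t = "Transposition.transpose a b"
  have t: "?t permutes UNIV" by (rule permutes_swap_id) auto
  have "(\<Sum>p | p permutes UNIV. of_int (sign p) * F p)
      = (\<Sum>p | p permutes UNIV. of_int (sign (p \<circ> ?t)) * F (p \<circ> ?t))"
    by (rule sum_permutations_compose_right[OF t])
  also have "\<dots> = (\<Sum>p | p permutes UNIV. - (of_int (sign p) * F p))"
  proof (rule sum.cong)
    fix p :: "'n \<Rightarrow> 'n" assume "p \<in> {p. p permutes UNIV}"
    then have p: "p permutes UNIV" by simp
    then have "permutation p" using permutation_permutes[of p] finite by blast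
    then have "sign (p \<circ> ?t) = - sign p"
      using \<open>a \<noteq> b\<close> by (simp add: sign_compose permutation_swap_id sign_swap_id)
    then show "of_int (sign (p \<circ> ?t)) * F (p \<circ> ?t) = - (of_int (sign p) * F p)"
      using F[OF p] by simp
  qed simp
  finally show ?thesis by (simp add: sum_negf)
qed

text \<open>The Piola identity in integrated form. In each term of the Leibniz expansion the derivative of the
component \<open>P a\<close> is moved onto the other factors. The second derivative that arises on the factor \<open>k\<close>
is symmetric, so its term does not change when the permutation is composed with the transposition of
\<open>a\<close> and \<open>k\<close>; the sign does change, and the terms cancel. Here \<open>P' i x h\<close> is the derivative of
\<open>P i\<close> in direction \<open>h\<close>, and \<open>D' i j x h\<close> that of its \<open>j\<close>-th partial derivative.\<close>
lemma integral_det_smooth_eq_0: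
  fixes P :: "'n::finite \<Rightarrow> real^'n \<Rightarrow> real"
  assumes P: "\<And>i x. (P i has_derivative P' i x) (at x)"
    and D: "\<And>i j x. ((\<lambda>x. P' i x (axis j 1)) has_derivative D' i j x) (at x)"
    and sym: "\<And>i j k x. D' i j x (axis k 1) = D' i k x (axis j 1)"
    and cP: "\<And>i w. continuous_on UNIV (\<lambda>x. P' i x w)"
    and cD: "\<And>i j w. continuous_on UNIV (\<lambda>x. D' i j x w)"
    and zero: "\<And>i x. R < norm x \<Longrightarrow> P i x = 0" "\<And>i x w. R < norm x \<Longrightarrow> P' i x w = 0"
  shows "integrable lborel (\<lambda>x. det (\<chi> i j. P' i x (axis j 1)))"
    and "(LINT x|lborel. det (\<chi> i j. P' i x (axis j 1))) = 0"
proof -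
  \<comment> \<open>The value \<open>undefined\<close> only serves to name some index; any component can be integrated by parts.\<close>
  define a :: 'n where "a = undefined"
  let ?m = "\<lambda>p x. \<Prod>i\<in>UNIV. P' i x (axis (p i) 1)"
  let ?r = "\<lambda>p k x. P a x * (D' k (p k) x (axis (p a) 1) * (\<Prod>i\<in>UNIV - {a} - {k}. P' i x (axis (p i) 1)))"
  have cPi: "continuous_on UNIV (P i)" for i
    by (intro continuous_at_imp_continuous_on ballI has_derivative_continuous[OF P])
  have Im: "integrable lborel (?m p)" for p
    by (rule integrable_continuous_compact_support[where R = R])
       (auto intro!: continuous_intros cP simp: zero)
  have Ir: "integrable lborel (?r p k)" for p k
    by (rule integrable_continuous_compact_support[where R = R])
       (auto intro!: continuous_intros cP cD cPi simp: zero)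
  have ibp: "(LINT x|lborel. ?m p x) = - (\<Sum>k\<in>UNIV - {a}. LINT x|lborel. ?r p k x)" for p
  proof -
    let ?F = "\<lambda>x. P a x * (\<Prod>i\<in>UNIV - {a}. P' i x (axis (p i) 1))"
    let ?F' = "\<lambda>x h. P a x * (\<Sum>k\<in>UNIV - {a}. D' k (p k) x h * (\<Prod>i\<in>UNIV - {a} - {k}. P' i x (axis (p i) 1)))
        + P' a x h * (\<Prod>i\<in>UNIV - {a}. P' i x (axis (p i) 1))"
    have F: "(?F has_derivative ?F' x) (at x)" for x
      by (intro has_derivative_mult has_derivative_prod P D)
    have FC: "?F \<in> C1_c UNIV"
      by (rule C1_cI[OF F, where K = "cball 0 R"])
         (auto intro!: continuous_intros cP cD cPi simp: zero)
    have "(LINT x|lborel. ?F' x (axis (p a) 1)) = 0"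
      using integral_frechet_derivative_eq_0[OF FC, of "axis (p a) 1"]
      by (simp only: frechet_derivative_at[OF F, symmetric])
    moreover have "?F' x (axis (p a) 1) = (\<Sum>k\<in>UNIV - {a}. ?r p k x) + ?m p x" for x
      by (simp add: sum_distrib_left prod.remove[of UNIV a "\<lambda>i. P' i x (axis (p i) 1)"])
    ultimately have "(LINT x|lborel. (\<Sum>k\<in>UNIV - {a}. ?r p k x) + ?m p x) = 0" by simp
    then show ?thesis
      using Im Ir by (simp add: Bochner_Integration.integral_sum)
  qed
  have det: "det (\<chi> i j. P' i x (axis j 1)) = (\<Sum>p | p permutes UNIV. of_int (sign p) * ?m p x)" for x
    by (simp add: det_def)
  show "integrable lborel (\<lambda>x. det (\<chi> i j. P' i x (axis j 1)))"
    unfolding det using Im by (intro Bochner_Integration.integrable_sum integrable_mult_right) auto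
  have "(LINT x|lborel. det (\<chi> i j. P' i x (axis j 1)))
      = (\<Sum>p | p permutes UNIV. of_int (sign p) * (LINT x|lborel. ?m p x))"
    unfolding det using Im by (simp add: Bochner_Integration.integral_sum)
  also have "\<dots> = - (\<Sum>k\<in>UNIV - {a}. \<Sum>p | p permutes UNIV. of_int (sign p) * (LINT x|lborel. ?r p k x))"
    unfolding ibp by (subst sum.swap) (simp add: sum_negf sum_distrib_left)
  also have "\<dots> = 0"
  proof -
    have "(\<Sum>p | p permutes UNIV. of_int (sign p) * (LINT x|lborel. ?r p k x)) = 0" if k: "k \<in> UNIV - {a}" for k
    proof (rule sum_sign_swap_invariant_eq_0[of a k])
      show "a \<noteq> k" using k by auto
      fix p :: "'n \<Rightarrow> 'n"
      let ?q = "p \<circ> Transposition.transpose a k"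
      have "?r ?q k x = ?r p k x" for x
      proof -
        have "(\<Prod>i\<in>UNIV - {a} - {k}. P' i x (axis (?q i) 1)) = (\<Prod>i\<in>UNIV - {a} - {k}. P' i x (axis (p i) 1))"
          by (rule prod.cong) (auto simp: transpose_apply_other)
        then show ?thesis by (simp add: sym[of k "p a"])
      qed
      then show "(LINT x|lborel. ?r ?q k x) = (LINT x|lborel. ?r p k x)" by presburger
    qed
    then show ?thesis by simp
  qed
  finally show "(LINT x|lborel. det (\<chi> i j. P' i x (axis j 1))) = 0" .
qed

text \<open>A mollified function has derivatives of second order, obtained from the gradient and the Hessian of
the kernel, whatever the regularity of \<open>g\<close>.\<close>
lemma integral_det_mollified_eq_0:
  fixes g :: "real^'n \<Rightarrow> real^'n"
  assumes e: "0 < e" and g: "integrable lborel g" and supp: "\<And>y. r < norm y \<Longrightarrow> g y = 0"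
  shows "integrable lborel (\<lambda>x. det (\<chi> i j. conv (\<lambda>z. mollifier_grad e z \<bullet> axis j 1) (\<lambda>y. g y $ i) x))"
    and "(LINT x|lborel. det (\<chi> i j. conv (\<lambda>z. mollifier_grad e z \<bullet> axis j 1) (\<lambda>y. g y $ i) x)) = 0"
proof -
  have gi: "integrable lborel (\<lambda>y. g y $ i)" for i
    by (rule integrable_bounded_linear[OF bounded_linear_vec_nth g])
  have gs: "g y $ i = 0" if "r < norm y" for y i using supp[OF that] by simp
  note mz = mollifier_eq_0[OF less_imp_le[OF e]]
  have mz': "mollifier_grad e z \<bullet> h = 0" "mollifier_hess e a z \<bullet> h = 0" if "e < norm z" for z h a :: "real^'n"
    using mz[OF that] by simp_all
  have cg: "continuous_on UNIV (\<lambda>z::real^'n. mollifier_grad e z \<bullet> h)"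
    "continuous_on UNIV (\<lambda>z::real^'n. mollifier_hess e a z \<bullet> h)" for h a
    by (intro continuous_intros continuous_on_mollifier)+
  note A = integral_det_smooth_eq_0[where P = "\<lambda>i. conv (mollifier e) (\<lambda>y. g y $ i)"
    and P' = "\<lambda>i x h. conv (\<lambda>z. mollifier_grad e z \<bullet> h) (\<lambda>y. g y $ i) x"
    and D' = "\<lambda>i j x h. conv (\<lambda>z. mollifier_hess e (axis j 1) z \<bullet> h) (\<lambda>y. g y $ i) x" and R = "e + r"]
  have 1: "(conv (mollifier e) (\<lambda>y. g y $ i) has_derivative
      (\<lambda>h. conv (\<lambda>z. mollifier_grad e z \<bullet> h) (\<lambda>y. g y $ i) x)) (at x)" for i x
    by (rule has_derivative_conv[OF mollifier_has_derivative continuous_on_mollifier(2) mz(1,2) gi])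
  have 2: "(conv (\<lambda>z. mollifier_grad e z \<bullet> axis j 1) (\<lambda>y. g y $ i) has_derivative
      (\<lambda>h. conv (\<lambda>z. mollifier_hess e (axis j 1) z \<bullet> h) (\<lambda>y. g y $ i) x)) (at x)" for i j x
    by (rule has_derivative_conv[OF mollifier_grad_has_derivative continuous_on_mollifier(3) mz'(1) mz(3) gi])
  have 3: "conv (\<lambda>z. mollifier_hess e (axis j 1) z \<bullet> axis k 1) (\<lambda>y. g y $ i) x
      = conv (\<lambda>z. mollifier_hess e (axis k 1) z \<bullet> axis j 1) (\<lambda>y. g y $ i) x" for i j k x
    by (simp only: mollifier_hess_symmetric[of e "axis j 1"])
  have 4: "continuous_on UNIV (\<lambda>x. conv (\<lambda>z. mollifier_grad e z \<bullet> w) (\<lambda>y. g y $ i) x)" for i w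
    by (rule continuous_on_conv[OF cg(1) mz'(1) gi])
  have 5: "continuous_on UNIV (\<lambda>x. conv (\<lambda>z. mollifier_hess e (axis j 1) z \<bullet> w) (\<lambda>y. g y $ i) x)" for i j w
    by (rule continuous_on_conv[OF cg(2) mz'(2) gi])
  have 6: "conv (mollifier e) (\<lambda>y. g y $ i) x = 0" if "e + r < norm x" for i x
    by (rule conv_eq_0[OF mz(1) gs that])
  have 7: "conv (\<lambda>z. mollifier_grad e z \<bullet> w) (\<lambda>y. g y $ i) x = 0" if "e + r < norm x" for i x w
    by (rule conv_eq_0[OF mz'(1) gs that])
  show "integrable lborel (\<lambda>x. det (\<chi> i j. conv (\<lambda>z. mollifier_grad e z \<bullet> axis j 1) (\<lambda>y. g y $ i) x))"
    "(LINT x|lborel. det (\<chi> i j. conv (\<lambda>z. mollifier_grad e z \<bullet> axis j 1) (\<lambda>y. g y $ i) x)) = 0"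
    by (rule A[OF 1 2 3 4 5 6 7]; assumption)+
qed

lemma conv_nth:
  fixes g :: "'a::euclidean_space \<Rightarrow> 'b::euclidean_space^'m"
  assumes k: "continuous_on UNIV k" "\<And>z. R < norm z \<Longrightarrow> k z = 0" and g: "integrable lborel g"
  shows "conv k g x $ i = conv k (\<lambda>y. g y $ i) x"
proof -
  have "conv k g x $ i = (LINT y|lborel. (k (x - y) *\<^sub>R g y) $ i)"
    unfolding conv_def
    by (rule integral_bounded_linear[symmetric, OF bounded_linear_vec_nth integrable_conv[OF k g]])
  then show ?thesis by (simp add: conv_def)
qed

lemma integrable_det:
  fixes U :: "'a \<Rightarrow> real^'n^'n"
  assumes U: "U \<in> borel_measurable M" and I: "integrable M (\<lambda>x. norm (U x) ^ CARD('n))"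
  shows "integrable M (\<lambda>x. det (U x))"
proof -
  obtain C where C: "0 \<le> C" "\<And>A :: real^'n^'n. \<bar>det A\<bar> \<le> C * norm A ^ CARD('n)"
    using det_le_norm_power[where 'n = 'n] by blast
  have m: "(\<lambda>x. det (U x)) \<in> borel_measurable M"
    by (rule measurable_compose[OF U]) (intro borel_measurable_continuous_onI continuous_on_det)
  show ?thesis
    by (rule Bochner_Integration.integrable_bound[OF _ m, where f = "\<lambda>x. C * norm (U x) ^ CARD('n)"])
       (use I C in auto)
qed

text \<open>The estimate between determinants, integrated. The set \<open>A\<close> localises the integral of the
difference, whereas the norms on the right are taken over the whole space.\<close>
lemma abs_integral_det_diff_le:
  fixes U V :: "'a \<Rightarrow> real^'n^'n"
  assumes bound: "\<And>A B :: real^'n^'n. \<bar>det A - det B\<bar> \<le> \<epsilon> * norm A ^ CARD('n) + C * norm (A - B) ^ CARD('n)"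
    and U: "U \<in> borel_measurable M" "integrable M (\<lambda>x. norm (U x) ^ CARD('n))"
    and V: "V \<in> borel_measurable M" "integrable M (\<lambda>x. norm (U x - V x) ^ CARD('n))"
    and A: "A \<in> sets M" and nn: "0 \<le> \<epsilon>" "0 \<le> C"
  shows "integrable M (\<lambda>x. indicator A x * (det (U x) - det (V x)))"
    and "\<bar>LINT x|M. indicator A x * (det (U x) - det (V x))\<bar>
      \<le> \<epsilon> * (LINT x|M. norm (U x) ^ CARD('n)) + C * (LINT x|M. norm (U x - V x) ^ CARD('n))"
proof -
  let ?b = "\<lambda>x. \<epsilon> * norm (U x) ^ CARD('n) + C * norm (U x - V x) ^ CARD('n)"
  have m: "(\<lambda>x. det (U x)) \<in> borel_measurable M" "(\<lambda>x. det (V x)) \<in> borel_measurable M"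
    by (rule measurable_compose[OF U(1)] measurable_compose[OF V(1)],
        intro borel_measurable_continuous_onI continuous_on_det)+
  have Ib: "integrable M ?b" using U V by auto
  have le: "\<bar>indicator A x * (det (U x) - det (V x))\<bar> \<le> ?b x" for x
  proof -
    have "\<bar>indicator A x * (det (U x) - det (V x))\<bar> \<le> \<bar>det (U x) - det (V x)\<bar>"
      by (simp add: indicator_def)
    then show ?thesis using bound[of "U x" "V x"] by linarith
  qed
  show I: "integrable M (\<lambda>x. indicator A x * (det (U x) - det (V x)))"
    by (rule Bochner_Integration.integrable_bound[OF Ib])
       (use m A le in \<open>auto intro: order_trans[OF _ abs_ge_self]\<close>)
  have "\<bar>LINT x|M. indicator A x * (det (U x) - det (V x))\<bar>
      \<le> (LINT x|M. \<bar>indicator A x * (det (U x) - det (V x))\<bar>)"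
    by (rule integral_abs_bound)
  also have "\<dots> \<le> (LINT x|M. ?b x)"
    using I Ib le by (intro integral_mono) auto
  also have "\<dots> = \<epsilon> * (LINT x|M. norm (U x) ^ CARD('n)) + C * (LINT x|M. norm (U x - V x) ^ CARD('n))"
    using U V by simp
  finally show "\<bar>LINT x|M. indicator A x * (det (U x) - det (V x))\<bar>
      \<le> \<epsilon> * (LINT x|M. norm (U x) ^ CARD('n)) + C * (LINT x|M. norm (U x - V x) ^ CARD('n))" .
qed

text \<open>For smooth \<open>u\<close> with compact support both determinants have integral zero. The general case follows
by mollifying \<open>u\<close> and \<open>\<phi>\<close>, cut off outside a compact set: the mollified Jacobians of \<open>u\<close> and \<open>u + \<phi>\<close>
differ only near the support of \<open>\<phi>\<close>, and there they are the mollifications of \<open>U\<close> and \<open>U + D\<phi>\<close>, so the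
limit in \<open>L\<^sup>n\<close> can be taken.\<close>
lemma integral_det_add_C1_c:
  fixes u \<phi> :: "real^'n \<Rightarrow> real^'n"
  assumes S: "open S" and u: "has_weak_jacobian S u U" and Un: "U \<in> Lp_loc CARD('n) S" and \<phi>: "\<phi> \<in> C1_c S"
  shows "(LINT x|lebesgue_on S. det (U x + jacobian \<phi> (at x)) - det (U x)) = 0"
proof -
  obtain p where p: "CARD('n) = Suc p" using not0_implies_Suc[of "CARD('n)"] by auto
  let ?n = "CARD('n)"
  obtain K where K: "compact K" "K \<subseteq> S" "\<And>x. x \<notin> K \<Longrightarrow> \<phi> x = 0"
    "\<And>x w. x \<notin> K \<Longrightarrow> frechet_derivative \<phi> (at x) w = 0"
    using C1_c_support[OF \<phi>] by metis
  \<comment> \<open>The difference of the mollified determinants is supported in \<open>K1\<close>, and \<open>K2\<close> leaves room for mollifying \<open>u\<close> at the points of \<open>K1\<close>.\<close>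
  obtain r K1 where r: "0 < r" and K1: "compact K1" "K1 \<subseteq> S" "\<And>x. x \<in> K \<Longrightarrow> cball x r \<subseteq> K1"
    using compact_neighbourhood[OF K(1) S K(2)] by blast
  obtain s K2 where s: "0 < s" and K2: "compact K2" "K2 \<subseteq> S" "\<And>x. x \<in> K1 \<Longrightarrow> cball x s \<subseteq> K2"
    using compact_neighbourhood[OF K1(1) S K1(2)] by blast
  have KK: "K \<subseteq> K1" "K1 \<subseteq> K2"
    using K1(3) K2(3) r s by (meson centre_in_cball less_imp_le subset_iff)+
  have sets: "K1 \<in> sets borel" "K2 \<in> sets borel" using K1 K2 by (auto simp: borel_compact)
  have uL: "integrable (lebesgue_on K2) u" "integrable (lebesgue_on K2) U"
    using u K2 unfolding has_weak_jacobian_def Lp_loc_def Lp_1_iff by auto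
  have UL: "integrable (lebesgue_on K2) (\<lambda>x. norm (U x) ^ ?n)"
    using Un K2 unfolding Lp_loc_def Lp_def by auto
  obtain u' where u': "u' \<in> borel_measurable borel" "\<And>x. x \<notin> K2 \<Longrightarrow> u' x = 0"
    "AE x in lborel. u' x = indicator K2 x *\<^sub>R u x"
    using borel_representative[OF K2(1) borel_measurable_integrable[OF uL(1)]] by blast
  obtain U' where U': "U' \<in> borel_measurable borel" "\<And>x. x \<notin> K2 \<Longrightarrow> U' x = 0"
    "AE x in lborel. U' x = indicator K2 x *\<^sub>R U x"
    using borel_representative[OF K2(1) borel_measurable_integrable[OF uL(2)]] by blast
  have ui: "integrable lborel u'"
    using uL(1) u'(3) sets
    by (subst integral_lebesgue_on_eq(1)[OF _ u'(1), of K2 u, symmetric]) (auto simp: eq_commute)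
  have Ui: "integrable lborel U'"
    using uL(2) U'(3) sets
    by (subst integral_lebesgue_on_eq(1)[OF _ U'(1), of K2 U, symmetric]) (auto simp: eq_commute)
  have Up: "integrable lborel (\<lambda>x. norm (U' x) ^ ?n)"
  proof (subst integral_lebesgue_on_eq(1)[of K2 "\<lambda>x. norm (U' x) ^ ?n" "\<lambda>x. norm (U x) ^ ?n", symmetric])
    show "AE x in lborel. indicator K2 x *\<^sub>R norm (U x) ^ ?n = norm (U' x) ^ ?n"
      using U'(3) by eventually_elim (auto simp: indicator_def zero_power)
  qed (use U'(1) UL sets in auto)
  define J where "J x = jacobian \<phi> (at x)" for x
  have Jc: "continuous_on UNIV J" unfolding J_def[abs_def] by (rule continuous_on_jacobian[OF \<phi>])
  have J0: "J x = 0" if "x \<notin> K" for x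
    using K(4)[OF that] by (simp add: J_def vec_eq_iff jacobian_nth)
  have \<phi>c: "continuous_on UNIV \<phi>" by (rule C1_cD(3)[OF \<phi>])
  obtain R where R: "\<And>x. x \<in> K2 \<Longrightarrow> norm x \<le> R"
    using compact_imp_bounded[OF K2(1)] bounded_iff by blast
  have out: "x \<notin> K2" "x \<notin> K" if "R < norm x" for x using R[of x] that KK by auto
  have Jm: "J \<in> borel_measurable borel" "\<phi> \<in> borel_measurable borel"
    using Jc \<phi>c by (auto intro: borel_measurable_continuous_onI)
  have Ji: "integrable lborel J" "integrable lborel \<phi>"
    using J0 K out by (auto intro!: integrable_continuous_compact_support[OF Jc, of R] integrable_continuous_compact_support[OF \<phi>c, of R])
  define W where "W x = U' x + J x" for x
  define w where "w x = u' x + \<phi> x" for x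
  have Wm: "W \<in> borel_measurable lborel" unfolding W_def[abs_def] using U'(1) Jm by measurable
  have Wi: "integrable lborel W" and wi: "integrable lborel w"
    unfolding W_def[abs_def] w_def[abs_def] using Ui ui Ji by auto
  have W0: "W x = 0" and w0: "w x = 0" and U0: "U' x = 0" and u0: "u' x = 0" if "R < norm x" for x
    using out[OF that] U'(2) u'(2) J0 K(3) by (auto simp: W_def w_def)
  have Wp: "integrable lborel (\<lambda>x. norm (W x) ^ ?n)"
  proof (rule Bochner_Integration.integrable_bound)
    have "integrable lborel (\<lambda>x. norm (J x) ^ ?n)"
      by (rule integrable_continuous_compact_support[where R = R])
         (use J0 out in \<open>auto intro!: continuous_intros Jc simp: zero_power\<close>)
    then show "integrable lborel (\<lambda>x. 2 ^ ?n * (norm (U' x) ^ ?n + norm (J x) ^ ?n))" using Up by auto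
    have "norm (W x) ^ ?n \<le> 2 ^ ?n * (norm (U' x) ^ ?n + norm (J x) ^ ?n)" for x
    proof -
      have "norm (W x) ^ ?n \<le> (norm (U' x) + norm (J x)) ^ ?n"
        unfolding W_def by (intro power_mono norm_triangle_ineq norm_ge_zero)
      also have "\<dots> \<le> 2 ^ ?n * (norm (U' x) ^ ?n + norm (J x) ^ ?n)"
        by (intro power_add_le norm_ge_zero)
      finally show ?thesis .
    qed
    then show "AE x in lborel. norm (norm (W x) ^ ?n) \<le> norm (2 ^ ?n * (norm (U' x) ^ ?n + norm (J x) ^ ?n))"
      by (auto intro: order_trans[OF _ abs_ge_self])
  qed (use Wm in measurable)
  \<comment> \<open>The total weight of the \<open>\<epsilon>\<close>-terms in the final estimate.\<close>
  define N where "N = (LINT x|lborel. norm (W x) ^ ?n) + (LINT x|lborel. norm (U' x) ^ ?n)"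
  have N: "0 \<le> N" unfolding N_def by simp
  let ?cW = "\<lambda>e. conv (mollifier e) W" and ?cU = "\<lambda>e. conv (mollifier e) U'"
  let ?I = "\<lambda>A B. LINT x|lborel. indicator K1 x * (det (A x) - det (B x))"
  \<comment> \<open>For each small \<open>e\<close> the statement holds exactly for the mollified fields.\<close>
  have smooth: "?I (?cW e) (?cU e) = 0" if e: "0 < e" "e < r" "e < s" for e
  proof -
    note molc = continuous_on_mollifier(1)[of e] and mols = mollifier_eq_0(1)[OF less_imp_le[OF e(1)]]
    define g where "g g' i j x = conv (\<lambda>z. mollifier_grad e z \<bullet> axis j 1) (\<lambda>y. g' y $ i) x"
      for g' :: "real^'n \<Rightarrow> real^'n" and i j :: 'n and x :: "real^'n"
    have gr: "continuous_on UNIV (\<lambda>z::real^'n. mollifier_grad e z \<bullet> axis j 1)"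
      "e < norm z \<Longrightarrow> mollifier_grad e z \<bullet> axis j 1 = 0" for j and z :: "real^'n"
      using mollifier_eq_0(2)[of e z] e by (auto intro!: continuous_intros continuous_on_mollifier)
    have nthi: "integrable lborel (\<lambda>y. h y $ i)" if "integrable lborel h" for h :: "real^'n \<Rightarrow> real^'n" and i
      by (rule integrable_bounded_linear[OF bounded_linear_vec_nth that])
    have gadd: "g w i j x = g u' i j x + g \<phi> i j x" for i j x
      unfolding g_def w_def vector_add_component
      by (rule conv_add[OF gr nthi[OF ui] nthi[OF Ji(2)]])
    have cnth: "conv (mollifier e) V x $ i $ j = conv (mollifier e) (\<lambda>y. V y $ i $ j) x"
      if V: "integrable lborel V" for V :: "real^'n \<Rightarrow> real^'n^'n" and x i j
      using conv_nth[OF molc mols V] conv_nth[OF molc mols integrable_bounded_linear[OF bounded_linear_vec_nth V]]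
      by simp
    \<comment> \<open>On \<open>K1\<close> the mollified Jacobian of \<open>u'\<close> is the mollification of \<open>U'\<close>. Elsewhere it also sees the jump of \<open>u'\<close> across the boundary of \<open>K2\<close>.\<close>
    have gu: "g u' i j x = ?cU e x $ i $ j" if x: "x \<in> K1" for i j x
    proof -
      have "cball x e \<subseteq> K2" using K2(3)[OF x] subset_cball[of e s x] e by auto
      then show ?thesis
        unfolding g_def cnth[OF Ui]
        by (rule mollified_weak_jacobian[OF S u K2(2) _ e(1) u'(1,3) U'(1,3)])
    qed
    have g\<phi>: "g \<phi> i j x = conv (mollifier e) J x $ i $ j" for i j x
      unfolding g_def cnth[OF Ji(1)] J_def
      by (rule mollified_weak_jacobian[OF open_UNIV has_weak_jacobian_C1_c[OF open_UNIV C1_c_mono[OF subset_UNIV \<phi>]],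
            of UNIV x e]) (use e Jm J_def[abs_def] in auto)
    \<comment> \<open>Outside \<open>K1\<close> the mollified \<open>\<phi>\<close> vanishes, so the jump of \<open>u'\<close> drops out of the difference.\<close>
    have g\<phi>0: "g \<phi> i j x = 0" if x: "x \<notin> K1" for i j x
    proof -
      have "(mollifier_grad e (x - y) \<bullet> axis j 1) *\<^sub>R \<phi> y $ i = 0" for y
      proof (cases "y \<in> K")
        case True
        then have "x \<notin> cball y e" using K1(3)[OF True] subset_cball[of e r y] e x by auto
        then have "e < norm (x - y)" by (simp add: dist_norm norm_minus_commute)
        then show ?thesis using gr(2) by simp
      next
        case False
        then show ?thesis using K(3) by simp
      qed
      then show ?thesis unfolding g_def conv_def by (simp only: Bochner_Integration.integral_zero)
    qed
    have cadd: "?cW e x = ?cU e x + conv (mollifier e) J x" for x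
      unfolding W_def[abs_def] by (rule conv_add[OF molc mols Ui Ji(1)])
    let ?d = "\<lambda>g' x. det (\<chi> i j. g g' i j x)"
    have eq: "indicator K1 x * (det (?cW e x) - det (?cU e x)) = ?d w x - ?d u' x" for x
    proof (cases "x \<in> K1")
      case True
      have "(\<chi> i j. g u' i j x) = ?cU e x" "(\<chi> i j. g w i j x) = ?cW e x"
        using gu[OF True] by (simp_all add: vec_eq_iff gadd g\<phi> cadd)
      then show ?thesis using True by simp
    next
      case False
      then have "(\<chi> i j. g w i j x) = (\<chi> i j. g u' i j x)" by (simp add: gadd g\<phi>0)
      then show ?thesis using False by simp
    qed
    have "?I (?cW e) (?cU e) = (LINT x|lborel. ?d w x - ?d u' x)" by (simp only: eq)
    also have "\<dots> = (LINT x|lborel. ?d w x) - (LINT x|lborel. ?d u' x)"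
      unfolding g_def
      by (intro Bochner_Integration.integral_diff integral_det_mollified_eq_0(1)[OF e(1) wi w0]
          integral_det_mollified_eq_0(1)[OF e(1) ui u0])
    also have "\<dots> = 0"
      unfolding g_def using integral_det_mollified_eq_0(2)[OF e(1) wi w0]
          integral_det_mollified_eq_0(2)[OF e(1) ui u0] by simp
    finally show ?thesis .
  qed
  have "\<bar>?I W U'\<bar> \<le> \<eta>" if \<eta>: "0 < \<eta>" for \<eta>
  proof -
    define \<epsilon> where "\<epsilon> = \<eta> / (2 * (N + 1))"
    have \<epsilon>: "0 < \<epsilon>" "\<epsilon> * N \<le> \<eta> / 2" using N \<eta> by (auto simp: \<epsilon>_def field_simps)
    obtain C where C: "0 \<le> C" "\<And>A B :: real^'n^'n.
        \<bar>det A - det B\<bar> \<le> \<epsilon> * norm A ^ ?n + C * norm (A - B) ^ ?n"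
      using det_diff_le[OF \<epsilon>(1), where 'n = 'n] by blast
    define d where "d = \<eta> / (4 * (C + 1))"
    have d: "0 < d" "C * d \<le> \<eta> / 4" using C(1) \<eta> by (auto simp: d_def field_simps)
    have U'm: "U' \<in> borel_measurable lborel" using U'(1) by simp
    obtain e1 where e1: "0 < e1" "\<And>e. \<lbrakk>0 < e; e < e1\<rbrakk> \<Longrightarrow> integrable lborel (\<lambda>x. norm (?cW e x - W x) ^ Suc p)
       \<and> (LINT x|lborel. norm (?cW e x - W x) ^ Suc p) < d"
      using conv_mollifier_tendsto_Lp[OF Wm Wp[unfolded p] W0 d(1)] by blast
    obtain e2 where e2: "0 < e2" "\<And>e. \<lbrakk>0 < e; e < e2\<rbrakk> \<Longrightarrow> integrable lborel (\<lambda>x. norm (?cU e x - U' x) ^ Suc p)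
       \<and> (LINT x|lborel. norm (?cU e x - U' x) ^ Suc p) < d"
      using conv_mollifier_tendsto_Lp[OF U'm Up[unfolded p] U0 d(1)] by blast
    define e where "e = min (min e1 e2) (min r s) / 2"
    have e: "0 < e" "e < e1" "e < e2" "e < r" "e < s" using e1 e2 r s by (auto simp: e_def)
    note L = e1(2)[OF e(1,2), folded p] e2(2)[OF e(1,3), folded p]
    have L': "integrable lborel (\<lambda>x. norm (W x - ?cW e x) ^ ?n)" "(LINT x|lborel. norm (W x - ?cW e x) ^ ?n) < d"
      "integrable lborel (\<lambda>x. norm (U' x - ?cU e x) ^ ?n)" "(LINT x|lborel. norm (U' x - ?cU e x) ^ ?n) < d"
      using L by (simp_all only: norm_minus_commute[of "W _"] norm_minus_commute[of "U' _"])
    have cm: "?cW e \<in> borel_measurable lborel" "?cU e \<in> borel_measurable lborel"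
      using continuous_on_conv[OF continuous_on_mollifier(1) mollifier_eq_0(1) Wi, of e e]
        continuous_on_conv[OF continuous_on_mollifier(1) mollifier_eq_0(1) Ui, of e e] e(1)
      by (auto intro: borel_measurable_continuous_onI)
    have K1l: "K1 \<in> sets lborel" using sets by simp
    note EW = abs_integral_det_diff_le[OF C(2) Wm Wp cm(1) L'(1) K1l less_imp_le[OF \<epsilon>(1)] C(1)]
    note EU = abs_integral_det_diff_le[OF C(2) U'm Up cm(2) L'(3) K1l less_imp_le[OF \<epsilon>(1)] C(1)]
    have IW: "integrable lborel (\<lambda>x. indicator K1 x * det (W x))" "integrable lborel (\<lambda>x. indicator K1 x * det (U' x))"
      using integrable_mult_indicator[OF K1l integrable_det[OF Wm Wp]]
        integrable_mult_indicator[OF K1l integrable_det[OF U'm Up]] by simp_all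
    have IcW: "integrable lborel (\<lambda>x. indicator K1 x * (det (?cW e x) - det (?cU e x)))"
    proof -
      have "(\<lambda>x. indicator K1 x * (det (?cW e x) - det (?cU e x)))
        = (\<lambda>x. (indicator K1 x * det (W x) - indicator K1 x * det (U' x))
          - (indicator K1 x * (det (W x) - det (?cW e x)) - indicator K1 x * (det (U' x) - det (?cU e x))))"
        by (simp add: fun_eq_iff algebra_simps)
      then show ?thesis using EW(1) EU(1) IW by simp
    qed
    have "?I W U' = (LINT x|lborel. indicator K1 x * (det (W x) - det (?cW e x))
        + indicator K1 x * (det (?cW e x) - det (?cU e x)) - indicator K1 x * (det (U' x) - det (?cU e x)))"
      by (intro Bochner_Integration.integral_cong) (auto simp: algebra_simps)
    also have "\<dots> = ?I W (?cW e) + ?I (?cW e) (?cU e) - ?I U' (?cU e)"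
      by (subst Bochner_Integration.integral_diff[OF Bochner_Integration.integrable_add[OF EW(1) IcW] EU(1)],
          subst Bochner_Integration.integral_add[OF EW(1) IcW]) simp
    finally have "\<bar>?I W U'\<bar> \<le> \<bar>?I W (?cW e)\<bar> + \<bar>?I U' (?cU e)\<bar>"
      using smooth[OF e(1,4,5)] by linarith
    also have "\<dots> \<le> \<epsilon> * N + 2 * (C * d)"
    proof -
      have "C * (LINT x|lborel. norm (W x - ?cW e x) ^ ?n) \<le> C * d"
        "C * (LINT x|lborel. norm (U' x - ?cU e x) ^ ?n) \<le> C * d"
        using L' C(1) by (auto intro!: mult_left_mono)
      then show ?thesis using EW(2) EU(2) unfolding N_def distrib_left by linarith
    qed
    also have "\<dots> \<le> \<eta>" using \<epsilon> d by linarith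
    finally show ?thesis .
  qed
  then have "\<bar>?I W U'\<bar> \<le> 0" by (rule field_le_epsilon[where y = 0, simplified])
  then have zero: "?I W U' = 0" by simp
  have "(LINT x|lebesgue_on S. det (U x + J x) - det (U x)) = ?I W U'"
  proof (rule integral_lebesgue_on_eq)
    show "S \<in> sets lebesgue" using S by auto
    have "det \<in> borel_measurable (borel :: (real^'n^'n) measure)"
      by (intro borel_measurable_continuous_onI continuous_on_det)
    then show "(\<lambda>x. indicator K1 x * (det (W x) - det (U' x))) \<in> borel_measurable borel"
      using Wm U'(1) sets by measurable
    show "AE x in lborel. indicator S x *\<^sub>R (det (U x + J x) - det (U x)) = indicator K1 x * (det (W x) - det (U' x))"
      using U'(3)
    proof eventually_elim
      case (elim x)
      show ?case
      proof (cases "x \<in> K1")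
        case True
        then have "x \<in> K2" "x \<in> S" using KK K1 by auto
        then show ?thesis using True elim by (simp add: W_def)
      next
        case False
        then have "J x = 0" using J0 KK by auto
        then show ?thesis using False by simp
      qed
    qed
  qed
  then show ?thesis using zero by (simp add: J_def)
qed

section \<open>Boundary values in \<open>W\<^sup>1\<^sub>0\<close>\<close>

lemma Lp_add:
  fixes f g :: "real^'n \<Rightarrow> 'b::euclidean_space"
  assumes "f \<in> Lp p S" "g \<in> Lp p S"
  shows "(\<lambda>x. f x + g x) \<in> Lp p S"
  unfolding Lp_def
proof (intro CollectI conjI)
  have f: "f \<in> borel_measurable (lebesgue_on S)" "integrable (lebesgue_on S) (\<lambda>x. norm (f x) ^ p)"
    and g: "g \<in> borel_measurable (lebesgue_on S)" "integrable (lebesgue_on S) (\<lambda>x. norm (g x) ^ p)"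
    using assms by (auto simp: Lp_def)
  show m: "(\<lambda>x. f x + g x) \<in> borel_measurable (lebesgue_on S)"
    using f g by (intro borel_measurable_add)
  have le: "norm (f x + g x) ^ p \<le> 2 ^ p * (norm (f x) ^ p + norm (g x) ^ p)" for x
  proof -
    have "norm (f x + g x) ^ p \<le> (norm (f x) + norm (g x)) ^ p"
      by (intro power_mono norm_triangle_ineq norm_ge_zero)
    also have "\<dots> \<le> 2 ^ p * (norm (f x) ^ p + norm (g x) ^ p)"
      by (intro power_add_le norm_ge_zero)
    finally show ?thesis .
  qed
  show "integrable (lebesgue_on S) (\<lambda>x. norm (f x + g x) ^ p)"
  proof (rule Bochner_Integration.integrable_bound)
    show "integrable (lebesgue_on S) (\<lambda>x. 2 ^ p * (norm (f x) ^ p + norm (g x) ^ p))"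
      using f g by auto
    show "(\<lambda>x. norm (f x + g x) ^ p) \<in> borel_measurable (lebesgue_on S)"
      using m by measurable
    show "AE x in lebesgue_on S. norm (norm (f x + g x) ^ p) \<le> norm (2 ^ p * (norm (f x) ^ p + norm (g x) ^ p))"
      using le by (auto intro: order_trans[OF _ abs_ge_self])
  qed
qed

lemma Lp_uminus: "f \<in> Lp p S \<Longrightarrow> (\<lambda>x. - f x) \<in> Lp p S"
  by (auto simp: Lp_def)

lemma Lp_diff: "f \<in> Lp p S \<Longrightarrow> g \<in> Lp p S \<Longrightarrow> (\<lambda>x. f x - g x) \<in> Lp p S"
  using Lp_add[OF _ Lp_uminus] by fastforce

lemma Lp_subset:
  fixes f :: "real^'n \<Rightarrow> 'b::euclidean_space"
  assumes "f \<in> Lp p T" "S \<subseteq> T" "S \<in> sets lebesgue" "T \<in> sets lebesgue"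
  shows "f \<in> Lp p S"
  unfolding Lp_def
proof (intro CollectI conjI)
  show "f \<in> borel_measurable (lebesgue_on S)"
    using assms(1,2) measurable_restrict_mono unfolding Lp_def by blast
  have "integrable lebesgue (\<lambda>x. indicator T x *\<^sub>R norm (f x) ^ p)"
    using assms by (simp add: Lp_def integrable_restrict_space)
  from integrable_mult_indicator[OF assms(3) this]
  have "integrable lebesgue (\<lambda>x. indicator S x *\<^sub>R norm (f x) ^ p)"
    by (rule back_subst[of "integrable lebesgue"]) (use assms(2) in \<open>auto simp: indicator_def fun_eq_iff\<close>)
  then show "integrable (lebesgue_on S) (\<lambda>x. norm (f x) ^ p)"
    using assms(3) by (simp add: integrable_restrict_space)
qed

lemma jacobian_C1_c_in_Lp:
  fixes \<phi> :: "real^'n \<Rightarrow> real^'m"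
  assumes S: "open S" and \<phi>: "\<phi> \<in> C1_c S" and "0 < p"
  shows "(\<lambda>x. jacobian \<phi> (at x)) \<in> Lp p S"
  unfolding Lp_def
proof (intro CollectI conjI)
  obtain K where K: "compact K" "K \<subseteq> S" "\<And>x w. x \<notin> K \<Longrightarrow> frechet_derivative \<phi> (at x) w = 0"
    using C1_c_support[OF \<phi>] by metis
  obtain R where R: "\<And>x. x \<in> K \<Longrightarrow> norm x \<le> R"
    using compact_imp_bounded[OF K(1)] bounded_iff by blast
  have J0: "jacobian \<phi> (at x) = 0" if "x \<notin> K" for x
    using K(3)[OF that] by (simp add: vec_eq_iff jacobian_nth)
  have c: "continuous_on UNIV (\<lambda>x. jacobian \<phi> (at x))" by (rule continuous_on_jacobian[OF \<phi>])
  show "(\<lambda>x. jacobian \<phi> (at x)) \<in> borel_measurable (lebesgue_on S)"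
    using borel_measurable_continuous_onI[OF c]
    by (intro measurable_restrict_space1 measurable_completion) simp
  have n: "continuous_on UNIV (\<lambda>x. norm (jacobian \<phi> (at x)) ^ p)" by (intro continuous_intros c)
  have I: "integrable lborel (\<lambda>x. norm (jacobian \<phi> (at x)) ^ p)"
  proof (rule integrable_continuous_compact_support[OF n])
    fix z :: "real^'n" assume "R < norm z"
    then have "z \<notin> K" using R[of z] by auto
    then show "norm (jacobian \<phi> (at z)) ^ p = 0" using J0 \<open>0 < p\<close> by (simp add: zero_power)
  qed
  have "AE x in lborel. indicator S x *\<^sub>R norm (jacobian \<phi> (at x)) ^ p = norm (jacobian \<phi> (at x)) ^ p"
    using J0 K(2) \<open>0 < p\<close> by (intro AE_I2) (auto simp: indicator_def zero_power)
  then show "integrable (lebesgue_on S) (\<lambda>x. norm (jacobian \<phi> (at x)) ^ p)"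
    using I S borel_measurable_continuous_onI[OF n]
    by (subst integral_lebesgue_on_eq(1)[where F' = "\<lambda>x. norm (jacobian \<phi> (at x)) ^ p"]) auto
qed

lemma borel_measurable_lebesgue_on_AE:
  fixes f g :: "'a::euclidean_space \<Rightarrow> 'b::euclidean_space"
  assumes S: "S \<in> sets lebesgue" and g: "g \<in> borel_measurable (lebesgue_on S)"
    and ae: "AE x in lebesgue_on S. f x = g x"
  shows "f \<in> borel_measurable (lebesgue_on S)"
proof (rule borel_measurable_if_D)
  have "(\<lambda>x. if x \<in> S then g x else 0) \<in> borel_measurable lebesgue"
    using g S by (simp add: borel_measurable_if)
  moreover have "AE x in lebesgue. x \<in> S \<longrightarrow> f x = g x"
    using ae S by (simp add: AE_restrict_space_iff)
  then have "AE x in lebesgue. (if x \<in> S then g x else 0) = (if x \<in> S then f x else 0)"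
    by eventually_elim simp
  ultimately show "(\<lambda>x. if x \<in> S then f x else 0) \<in> borel_measurable lebesgue"
    by (rule borel_measurable_AE)
qed

lemma weak_jacobian_AE_eq:
  assumes "open S" "has_weak_jacobian S u U"
  shows "AE x in lebesgue_on S. weak_jacobian S u x = U x"
proof (rule has_weak_jacobian_unique[OF assms(1) _ assms(2)])
  show "has_weak_jacobian S u (weak_jacobian S u)"
    unfolding weak_jacobian_def by (rule someI[of "has_weak_jacobian S u", OF assms(2)])
qed

lemma has_weak_jacobian_weak_jacobian:
  "weakly_differentiable S u \<Longrightarrow> has_weak_jacobian S u (weak_jacobian S u)"
  unfolding weak_jacobian_def weakly_differentiable_def by (rule someI_ex[of "has_weak_jacobian S u"])

text \<open>The norm in the definition of \<open>W1_0\<close> contains the chosen weak Jacobian of a difference. By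
uniqueness this is the difference of the Jacobians, so the approximating test functions converge to
\<open>w\<close> also in terms of the given \<open>W\<close>.\<close>
lemma W1_0_approximation:
  fixes w :: "real^'n \<Rightarrow> real^'m"
  assumes S: "open S" and w: "w \<in> W1_0 p S" and W: "has_weak_jacobian S w W" and Wp: "W \<in> Lp p S" and p: "0 < p"
  obtains \<phi> where "\<And>k::nat. \<phi> k \<in> C1_c S"
    "(\<lambda>k. LINT x|lebesgue_on S. norm (W x - jacobian (\<phi> k) (at x)) ^ p) \<longlonglongrightarrow> 0"
proof -
  obtain \<phi> :: "nat \<Rightarrow> real^'n \<Rightarrow> real^'m" where \<phi>: "\<And>k. \<phi> k \<in> C1_c S"
    and lim: "(\<lambda>k. W1_norm p S (\<lambda>x. \<phi> k x - w x)) \<longlonglongrightarrow> 0"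
    using w unfolding W1_0_def by blast
  let ?a = "\<lambda>k. LINT x|lebesgue_on S. norm (\<phi> k x - w x) ^ p"
  let ?b = "\<lambda>k. LINT x|lebesgue_on S. norm (weak_jacobian S (\<lambda>x. \<phi> k x - w x) x) ^ p"
  let ?c = "\<lambda>k. LINT x|lebesgue_on S. norm (W x - jacobian (\<phi> k) (at x)) ^ p"
  have Sl: "S \<in> sets lebesgue" using S by auto
  have bc: "?b k = ?c k" for k
  proof (rule integral_cong_AE)
    let ?J = "\<lambda>x. jacobian (\<phi> k) (at x)"
    have ae: "AE x in lebesgue_on S. weak_jacobian S (\<lambda>x. \<phi> k x - w x) x = ?J x - W x"
      by (intro weak_jacobian_AE_eq has_weak_jacobian_diff has_weak_jacobian_C1_c S \<phi> W)
    have m: "(\<lambda>x. ?J x - W x) \<in> borel_measurable (lebesgue_on S)"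
      using Lp_diff[OF jacobian_C1_c_in_Lp[OF S \<phi> p] Wp] by (simp add: Lp_def)
    show "(\<lambda>x. norm (weak_jacobian S (\<lambda>x. \<phi> k x - w x) x) ^ p) \<in> borel_measurable (lebesgue_on S)"
      using borel_measurable_lebesgue_on_AE[OF Sl m ae] by measurable
    show "(\<lambda>x. norm (W x - ?J x) ^ p) \<in> borel_measurable (lebesgue_on S)"
      using Lp_diff[OF Wp jacobian_C1_c_in_Lp[OF S \<phi> p]] by (auto simp: Lp_def)
    show "AE x in lebesgue_on S. norm (weak_jacobian S (\<lambda>x. \<phi> k x - w x) x) ^ p = norm (W x - ?J x) ^ p"
      using ae by eventually_elim (simp add: norm_minus_commute)
  qed
  have nn: "0 \<le> ?a k" "0 \<le> ?c k" for k by (simp_all add: Bochner_Integration.integral_nonneg)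
  have "W1_norm p S (\<lambda>x. \<phi> k x - w x) ^ p = ?a k + ?c k" for k
    unfolding W1_norm_def bc using nn[of k] p by (intro real_root_pow_pos2) auto
  moreover have "(\<lambda>k. W1_norm p S (\<lambda>x. \<phi> k x - w x) ^ p) \<longlonglongrightarrow> 0 ^ p"
    by (intro tendsto_power lim)
  ultimately have "(\<lambda>k. ?a k + ?c k) \<longlonglongrightarrow> 0" using p by (simp add: zero_power)
  then have "?c \<longlonglongrightarrow> 0"
    by (rule tendsto_sandwich[OF _ _ tendsto_const, rotated 2]) (use nn in auto)
  then show ?thesis using that \<phi> by blast
qed

text \<open>Adding a test function does not change the integral of the determinant of \<open>U\<close>, and \<open>V\<close> is the
limit in \<open>L\<^sup>n\<close> of \<open>U\<close> plus Jacobians of test functions.\<close>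
lemma integral_det_eq_if_W1_0:
  fixes u v :: "real^'n \<Rightarrow> real^'n"
  assumes G: "open G" and u: "has_weak_jacobian G u U" "U \<in> Lp CARD('n) G"
    and v: "has_weak_jacobian G v V" "V \<in> Lp CARD('n) G" and w: "(\<lambda>x. v x - u x) \<in> W1_0 CARD('n) G"
  shows "(LINT x|lebesgue_on G. det (V x)) = (LINT x|lebesgue_on G. det (U x))"
proof -
  let ?n = "CARD('n)" and ?M = "lebesgue_on G"
  have "(\<lambda>x. V x - U x) \<in> Lp ?n G" by (rule Lp_diff[OF v(2) u(2)])
  then obtain \<phi> where \<phi>: "\<And>k::nat. \<phi> k \<in> C1_c G"
    and lim: "(\<lambda>k. LINT x|?M. norm (V x - U x - jacobian (\<phi> k) (at x)) ^ ?n) \<longlonglongrightarrow> 0"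
    using W1_0_approximation[OF G w has_weak_jacobian_diff[OF G v(1) u(1)]] by auto
  have Uloc: "U \<in> Lp_loc ?n G"
    unfolding Lp_loc_def using Lp_subset[OF u(2)] G by (auto simp: borel_compact)
  have Lpm: "F \<in> borel_measurable ?M" "integrable ?M (\<lambda>x. norm (F x) ^ ?n)" if "F \<in> Lp ?n G" for F :: "real^'n \<Rightarrow> real^'n^'n"
    using that by (auto simp: Lp_def)
  let ?D = "(LINT x|?M. det (V x)) - (LINT x|?M. det (U x))"
  define N where "N = (LINT x|?M. norm (V x) ^ ?n)"
  have N: "0 \<le> N" unfolding N_def by simp
  have "\<bar>?D\<bar> \<le> \<eta>" if \<eta>: "0 < \<eta>" for \<eta>
  proof -
    define \<epsilon> where "\<epsilon> = \<eta> / (2 * (N + 1))"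
    have \<epsilon>: "0 < \<epsilon>" "\<epsilon> * N \<le> \<eta> / 2" using N \<eta> by (auto simp: \<epsilon>_def field_simps)
    obtain C where C: "0 \<le> C" "\<And>A B :: real^'n^'n.
        \<bar>det A - det B\<bar> \<le> \<epsilon> * norm A ^ ?n + C * norm (A - B) ^ ?n"
      using det_diff_le[OF \<epsilon>(1), where 'n = 'n] by blast
    define d where "d = \<eta> / (2 * (C + 1))"
    have d: "0 < d" "C * d \<le> \<eta> / 2" using C(1) \<eta> by (auto simp: d_def field_simps)
    obtain k where k: "(LINT x|?M. norm (V x - U x - jacobian (\<phi> k) (at x)) ^ ?n) < d"
      using order_tendstoD(2)[OF lim d(1)] by (meson eventually_happens' sequentially_bot)
    define A where "A x = U x + jacobian (\<phi> k) (at x)" for x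
    have A: "A \<in> Lp ?n G"
      unfolding A_def[abs_def] by (rule Lp_add[OF u(2) jacobian_C1_c_in_Lp[OF G \<phi>]]) simp
    have VA: "V x - U x - jacobian (\<phi> k) (at x) = V x - A x" for x by (simp add: A_def)
    note E = abs_integral_det_diff_le(2)[OF C(2) Lpm[OF v(2)] Lpm(1)[OF A] Lpm(2)[OF Lp_diff[OF v(2) A]]
      sets.top less_imp_le[OF \<epsilon>(1)] C(1)]
    have eqI: "(LINT x|?M. indicator (space ?M) x * (det (V x) - det (A x))) = (LINT x|?M. det (V x) - det (A x))"
      by (intro Bochner_Integration.integral_cong) auto
    have ints: "integrable ?M (\<lambda>x. det (V x))" "integrable ?M (\<lambda>x. det (U x))" "integrable ?M (\<lambda>x. det (A x))"
      by (intro integrable_det Lpm v(2) u(2) A)+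
    have "(LINT x|?M. det (A x) - det (U x)) = 0"
      unfolding A_def by (rule integral_det_add_C1_c[OF G u(1) Uloc \<phi>])
    then have "?D = (LINT x|?M. det (V x) - det (A x))" using ints by simp
    then have "\<bar>?D\<bar> \<le> \<epsilon> * N + C * (LINT x|?M. norm (V x - A x) ^ ?n)"
      using E unfolding eqI N_def by simp
    also have "\<dots> \<le> \<epsilon> * N + C * d"
      using k C(1) unfolding VA by (intro add_left_mono mult_left_mono) auto
    finally show ?thesis using \<epsilon> d by linarith
  qed
  then have "\<bar>?D\<bar> \<le> 0" by (rule field_le_epsilon[where y = 0, simplified])
  then show ?thesis by simp
qed

section \<open>Convexity of the energy density\<close>

lemma primitive_has_real_derivative:
  fixes h f :: "real \<Rightarrow> real"
  assumes h: "continuous_on UNIV h" and f: "\<And>t. f t = (LBINT s=ereal 0..ereal t. h s)"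
  shows "(f has_real_derivative h t) (at t)"
proof -
  let ?b = "\<bar>t\<bar> + 1"
  have "((\<lambda>t. LBINT s=ereal 0..ereal t. h s) has_vector_derivative h t) (at t within {- ?b..?b})"
    by (rule interval_integral_FTC2) (auto intro: continuous_on_subset[OF h])
  moreover have "at t within {- ?b..?b} = at t" by (rule at_within_interior) auto
  ultimately show ?thesis
    unfolding has_real_derivative_iff_has_vector_derivative f[abs_def] by simp
qed

text \<open>A function with nondecreasing derivative is convex, that is, above its tangents.\<close>
lemma primitive_subgradient:
  fixes h f :: "real \<Rightarrow> real"
  assumes der: "\<And>t. (f has_real_derivative h t) (at t)" and h: "mono h"
  shows "f s + h s * (t - s) \<le> f t"
proof (cases s t rule: linorder_cases)
  case less
  then obtain z where z: "s < z" "f t - f s = (t - s) * h z" using MVT2[OF less der] by blast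
  have "(t - s) * h s \<le> (t - s) * h z" using less z monoD[OF h, of s z] by (intro mult_left_mono) auto
  then show ?thesis using z by (simp add: mult.commute)
next
  case greater
  then obtain z where z: "z < s" "f s - f t = (s - t) * h z" using MVT2[OF greater der] by blast
  have "(s - t) * h z \<le> (s - t) * h s" using greater z monoD[OF h, of z s] by (intro mult_left_mono) auto
  then show ?thesis using z by (simp add: algebra_simps)
qed simp

lemma ext_integral_integrable:
  assumes g: "integrable (lebesgue_on S) g"
  shows "ext_integral S g = ereal (LINT x|lebesgue_on S. g x)"
proof -
  obtain r q where "0 \<le> r" "0 \<le> q" and P: "(\<integral>\<^sup>+ x. ennreal (g x) \<partial>lebesgue_on S) = ennreal r"
    and N: "(\<integral>\<^sup>+ x. ennreal (- g x) \<partial>lebesgue_on S) = ennreal q"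
    using g by (rule integrableE)
  then show ?thesis
    unfolding ext_integral_def Let_def real_lebesgue_integral_def[OF g] P N by simp
qed

lemma ext_integral_eq_PInf:
  assumes "(\<integral>\<^sup>+ x. ennreal (g x) \<partial>lebesgue_on S) = \<infinity>" "(\<integral>\<^sup>+ x. ennreal (- g x) \<partial>lebesgue_on S) \<noteq> \<infinity>"
  shows "ext_integral S g = \<infinity>"
proof -
  obtain q where "0 \<le> q" "(\<integral>\<^sup>+ x. ennreal (- g x) \<partial>lebesgue_on S) = ennreal q"
    using assms(2) by (cases "\<integral>\<^sup>+ x. ennreal (- g x) \<partial>lebesgue_on S") auto
  then show ?thesis using assms(1) by (simp add: ext_integral_def)
qed

section \<open>Minimality\<close>

theorem proposition2p7:
  fixes \<Omega> :: "(real^'n) set"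
    and h f :: "real \<Rightarrow> real"
    and u :: "real^'n \<Rightarrow> real^'n"
  assumes "CARD('n) \<ge> 2"
    and "is_domain \<Omega>" and "bounded \<Omega>"
    and "continuous_on UNIV h" and "mono h"
    and "\<And>t. f t = (LBINT s=ereal 0..ereal t. h s)"
    and "u \<in> W1_loc CARD('n) \<Omega>"
    and "weak_solution h \<Omega> u"
    and "\<exists>c. AE x in lebesgue_on \<Omega>. h (det (weak_jacobian \<Omega> u x)) = c"
  shows "\<forall>G. is_domain G \<and> compactly_contained G \<Omega> \<longrightarrow>
           (\<forall>v. v \<in> W1 CARD('n) G \<and> (\<lambda>x. v x - u x) \<in> W1_0 CARD('n) G \<longrightarrow>
              ext_integral G (\<lambda>x. f (det (weak_jacobian \<Omega> u x)))
                \<le> ext_integral G (\<lambda>x. f (det (weak_jacobian G v x))))"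
proof (intro allI impI, elim conjE)
  fix G v
  assume G: "is_domain G" "compactly_contained G \<Omega>"
    and v: "v \<in> W1 CARD('n) G" and w: "(\<lambda>x. v x - u x) \<in> W1_0 CARD('n) G"
  let ?n = "CARD('n)" and ?M = "lebesgue_on G"
  define U where "U = weak_jacobian \<Omega> u"
  define V where "V = weak_jacobian G v"
  have oG: "open G" and o\<Omega>: "open \<Omega>" using G(1) assms(2) by (auto simp: is_domain_def)
  have cl: "compact (closure G)" "closure G \<subseteq> \<Omega>" using G(2) by (auto simp: compactly_contained_def)
  then have G\<Omega>: "G \<subseteq> \<Omega>" using closure_subset by blast
  have U: "has_weak_jacobian \<Omega> u U"
    unfolding U_def using assms(7) by (intro has_weak_jacobian_weak_jacobian) (simp add: W1_loc_def)
  have UG: "has_weak_jacobian G u U" by (rule has_weak_jacobian_subset[OF oG G\<Omega> o\<Omega> U])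
  have "U \<in> Lp ?n (closure G)"
    using assms(7) cl by (simp add: U_def W1_loc_def Lp_loc_def)
  then have Up: "U \<in> Lp ?n G"
    by (rule Lp_subset) (use oG closure_subset in auto)
  have VG: "has_weak_jacobian G v V" and Vp: "V \<in> Lp ?n G"
    using v by (auto simp: V_def W1_def intro: has_weak_jacobian_weak_jacobian)
  have dU: "integrable ?M (\<lambda>x. det (U x))" and dV: "integrable ?M (\<lambda>x. det (V x))"
    using Up Vp by (auto simp: Lp_def intro: integrable_det)
  have det_eq: "(LINT x|?M. det (V x)) = (LINT x|?M. det (U x))"
    by (rule integral_det_eq_if_W1_0[OF oG UG Up VG Vp w])
  obtain c where "AE x in lebesgue_on \<Omega>. h (det (U x)) = c"
    using assms(9) by (auto simp: U_def)
  then have "AE x in lebesgue. x \<in> \<Omega> \<longrightarrow> h (det (U x)) = c"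
    using o\<Omega> by (simp add: AE_restrict_space_iff)
  then have "AE x in lebesgue. x \<in> G \<longrightarrow> h (det (U x)) = c"
    by eventually_elim (use G\<Omega> in auto)
  then have hc: "AE x in ?M. h (det (U x)) = c"
    using oG by (simp add: AE_restrict_space_iff)
  have der: "(f has_real_derivative h t) (at t)" for t
    by (rule primitive_has_real_derivative[OF assms(4) assms(6)])
  note sub = primitive_subgradient[OF der assms(5)]
  have f0: "f 0 = 0" using assms(6)[of 0] by simp
  have fm: "f \<in> borel_measurable borel"
    by (intro borel_measurable_continuous_onI continuous_at_imp_continuous_on ballI DERIV_isCont[OF der])
  have m: "(\<lambda>x. f (det (U x))) \<in> borel_measurable ?M" "(\<lambda>x. f (det (V x))) \<in> borel_measurable ?M"
    using measurable_compose[OF borel_measurable_integrable[OF dU] fm]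
      measurable_compose[OF borel_measurable_integrable[OF dV] fm] by simp_all
  \<comment> \<open>The tangent at the origin bounds \<open>f\<close> from below, so negative parts are integrable and the extended integrals are well defined.\<close>
  have low: "h 0 * t \<le> f t" for t using sub[of 0 t] f0 by simp
  \<comment> \<open>Where the slope of \<open>f\<close> is \<open>c\<close>, comparing with the value at \<open>0\<close> bounds \<open>f\<close> from above by a linear function.\<close>
  have fU: "integrable ?M (\<lambda>x. f (det (U x)))"
  proof (rule Bochner_Integration.integrable_bound[OF _ m(1)])
    show "integrable ?M (\<lambda>x. \<bar>h 0 * det (U x)\<bar> + \<bar>c * det (U x)\<bar>)" using dU by auto
    show "AE x in ?M. norm (f (det (U x))) \<le> norm (\<bar>h 0 * det (U x)\<bar> + \<bar>c * det (U x)\<bar>)"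
      using hc
    proof eventually_elim
      case (elim x)
      then have "f (det (U x)) \<le> c * det (U x)" using sub[of "det (U x)" 0] f0 by simp
      then show ?case using low[of "det (U x)"] by auto
    qed
  qed
  have "(\<integral>\<^sup>+ x. ennreal (- f (det (V x))) \<partial>?M) \<le> (\<integral>\<^sup>+ x. ennreal (- (h 0 * det (V x))) \<partial>?M)"
    using low by (intro nn_integral_mono ennreal_leI) simp
  moreover have "(\<integral>\<^sup>+ x. ennreal (- (h 0 * det (V x))) \<partial>?M) \<noteq> \<infinity>"
    using dV integrable_mult_right[OF dV, of "h 0"] unfolding real_integrable_def by blast
  ultimately have negV: "(\<integral>\<^sup>+ x. ennreal (- f (det (V x))) \<partial>?M) \<noteq> \<infinity>" by (auto simp: top_unique)
  have "ext_integral G (\<lambda>x. f (det (U x))) \<le> ext_integral G (\<lambda>x. f (det (V x)))"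
  proof (cases "(\<integral>\<^sup>+ x. ennreal (f (det (V x))) \<partial>?M) = \<infinity>")
    case True
    then show ?thesis using ext_integral_eq_PInf[OF _ negV] by simp
  next
    case False
    with negV have fV: "integrable ?M (\<lambda>x. f (det (V x)))"
      using m(2) by (simp add: real_integrable_def)
    have "(LINT x|?M. f (det (U x))) = (LINT x|?M. f (det (U x)) + c * (det (V x) - det (U x)))"
      using fU dU dV det_eq by simp
    also have "\<dots> \<le> (LINT x|?M. f (det (V x)))"
    proof (rule integral_mono_AE[OF _ fV])
      show "integrable ?M (\<lambda>x. f (det (U x)) + c * (det (V x) - det (U x)))" using fU dU dV by simp
      show "AE x in ?M. f (det (U x)) + c * (det (V x) - det (U x)) \<le> f (det (V x))"
        using hc
      proof eventually_elim
        case (elim x)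
        then show ?case using sub[of "det (U x)" "det (V x)"] by simp
      qed
    qed
    finally show ?thesis by (simp add: ext_integral_integrable fU fV)
  qed
  then show "ext_integral G (\<lambda>x. f (det (weak_jacobian \<Omega> u x)))
      \<le> ext_integral G (\<lambda>x. f (det (weak_jacobian G v x)))"
    by (simp only: U_def V_def)
qed

end
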